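(* There are infinitely many class-$0$ non-affine knots in $\mathbb{R}P^3$ with genus $1$.
   Context: A knot in $\mathbb{R}P^3$ is a (smooth, tame) embedding of $S^1$ in $\mathbb{R}P^3$, considered up to ambient isotopy. It is of class-$0$ or class-$1$ according to whether it represents $\bar 0$ or $\bar 1$ in $\pi_1(\mathbb{R}P^3)\cong\mathbb{Z}/2\mathbb{Z}$. View $\mathbb{R}P^3$ as the quotient of a closed round 3-ball $D^3$ by identifying antipodal boundary points (a ball model). A standard projective plane is an embedded $\mathbb{R}P^2\subset\mathbb{R}P^3$ whose preimage in $D^3$, for some ball model, is a flat (diametral) 2-disk or $\partial D^3$; an asymptotic projective plane is an embedded projective plane isotopic to a standard one. A knot is affine if it is disjoint from some asymptotic projective plane, and non-affine otherwise. Genus: let $h:S^3\to\mathbb{R}P^3$ be the canonical two-sheeted covering. A closed connected surface $S\subset\mathbb{R}P^3$ containing $K$ is a good surface for $K$ if $h^{-1}(S)$ is connected ($h^{-1}(S)$ is then a closed orientable surface in $S^3$). The genus of $K$ is the minimum of the genus of $h^{-1}(S)$ over all good surfaces $S$ for $K$ (with $K$ taken up to ambient isotopy). *)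

theory Defs
  imports "HOL-Analysis.Analysis" "HOL-Homology.Homology"
begin

subsection \<open>Smooth maps and submanifolds of Euclidean space\<close>

text \<open>Only meaningful for open \<open>U\<close>.\<close>

primrec Ck_on :: "nat \<Rightarrow> 'a::euclidean_space set \<Rightarrow> ('a \<Rightarrow> 'b::euclidean_space) \<Rightarrow> bool" where
  "Ck_on 0 U f \<longleftrightarrow> continuous_on U f"
| "Ck_on (Suc k) U f \<longleftrightarrow>
     (\<forall>x\<in>U. f differentiable (at x)) \<and>
     (\<forall>v. Ck_on k U (\<lambda>x. frechet_derivative f (at x) v))"

definition smooth_on :: "'a::euclidean_space set \<Rightarrow> ('a \<Rightarrow> 'b::euclidean_space) \<Rightarrow> bool" where
  "smooth_on U f \<longleftrightarrow> (\<forall>k. Ck_on k U f)"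

text \<open>Embedded submanifolds without boundary, by slice charts.\<close>

definition smooth_submanifold :: "nat \<Rightarrow> 'a::euclidean_space set \<Rightarrow> bool" where
  "smooth_submanifold k M \<longleftrightarrow>
     (\<forall>p\<in>M. \<exists>(U::'a set) (V::'a set) \<phi> \<psi> L.
        open U \<and> p \<in> U \<and> open V \<and> homeomorphism U V \<phi> \<psi> \<and>
        smooth_on U \<phi> \<and> smooth_on V \<psi> \<and>
        subspace L \<and> dim L = k \<and> \<phi> ` (M \<inter> U) = V \<inter> L)"


subsection \<open>Projective spaces\<close>

text \<open>The points of the projective space of a Euclidean space are the pairs of antipodal
  unit vectors, and the covering \<open>h\<close> is the restriction of \<^term>\<open>antipodal_pair\<close> to the unit sphere.\<close>

definition antipodal_pair :: "'a::euclidean_space \<Rightarrow> 'a set" where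
  "antipodal_pair x = {x, - x}"

definition projective_space :: "'a::euclidean_space set topology" where
  "projective_space = topology (\<lambda>U. U \<subseteq> antipodal_pair ` sphere 0 1 \<and>
     openin (top_of_set (sphere 0 1)) {x \<in> sphere 0 1. antipodal_pair x \<in> U})"

lemma openin_projective_space:
  "openin (projective_space :: 'a::euclidean_space set topology) U \<longleftrightarrow>
     U \<subseteq> antipodal_pair ` sphere 0 1 \<and>
     openin (top_of_set (sphere 0 1)) {x \<in> sphere 0 1. antipodal_pair x \<in> U}"
proof -
  let ?P = "\<lambda>U::'a set set. U \<subseteq> antipodal_pair ` sphere 0 1 \<and>
     openin (top_of_set (sphere 0 1)) {x \<in> sphere 0 1. antipodal_pair x \<in> U}"
  have "?P (S \<inter> T)" if "?P S" "?P T" for S T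
  proof -
    have "{x \<in> sphere 0 1. antipodal_pair x \<in> S \<inter> T} =
        {x \<in> sphere 0 1. antipodal_pair x \<in> S} \<inter> {x \<in> sphere 0 1. antipodal_pair x \<in> T}"
      by blast
    with that show ?thesis by (auto intro: openin_Int)
  qed
  moreover have "?P (\<Union>\<K>)" if "\<forall>K\<in>\<K>. ?P K" for \<K>
  proof -
    have "{x \<in> sphere 0 1. antipodal_pair x \<in> \<Union>\<K>} =
        (\<Union>K\<in>\<K>. {x \<in> sphere 0 1. antipodal_pair x \<in> K})"
      by blast
    moreover have "openin (top_of_set (sphere 0 1))
        (\<Union>K\<in>\<K>. {x \<in> sphere 0 1. antipodal_pair x \<in> K})"
      using that by (intro openin_Union) blast
    ultimately show ?thesis using that by auto
  qed
  ultimately have "istopology ?P"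
    unfolding istopology_def by blast
  then show ?thesis
    unfolding projective_space_def by (simp add: topology_inverse')
qed

lemma topspace_projective_space:
  "topspace (projective_space :: 'a::euclidean_space set topology) = antipodal_pair ` sphere 0 1"
proof -
  have "{x \<in> sphere 0 1. antipodal_pair x \<in> antipodal_pair ` sphere (0::'a) 1} = sphere 0 1"
    by blast
  then have "openin (projective_space :: 'a set topology) (antipodal_pair ` sphere 0 1)"
    unfolding openin_projective_space by (metis openin_subtopology_self order_refl)
  then show ?thesis
    by (meson openin_projective_space openin_subset openin_topspace subset_antisym)
qed

lemma quotient_map_antipodal_pair:
  "quotient_map (top_of_set (sphere 0 1)) (projective_space :: 'a::euclidean_space set topology)
     antipodal_pair"
  unfolding quotient_map_def topspace_projective_space openin_projective_space
  by auto

abbreviation RP2 :: "(real^3) set topology" where "RP2 \<equiv> projective_space"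
abbreviation RP3 :: "(real^4) set topology" where "RP3 \<equiv> projective_space"

definition cover_preimage :: "(real^4) set set \<Rightarrow> (real^4) set" where
  "cover_preimage A = {x \<in> sphere 0 1. antipodal_pair x \<in> A}"

text \<open>\<open>RP3\<close> carries the smooth structure that makes the covering a local diffeomorphism.
  Hence a map into it is smooth iff it has smooth local lifts to the sphere, a map out of it is
  smooth iff its composition with the covering is, and a subset is a submanifold iff its preimage
  is. As usual, smoothness on a subset \<open>A\<close> of Euclidean space means the local existence of smooth
  extensions.\<close>

definition smooth_to_RP3 :: "'a::euclidean_space set \<Rightarrow> ('a \<Rightarrow> (real^4) set) \<Rightarrow> bool" where
  "smooth_to_RP3 A f \<longleftrightarrow>
     (\<forall>p\<in>A. \<exists>U g. open U \<and> p \<in> U \<and> smooth_on U g \<and>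
        (\<forall>x\<in>A \<inter> U. g x \<in> sphere 0 1 \<and> antipodal_pair (g x) = f x))"

definition diffeo_RP3 :: "((real^4) set \<Rightarrow> (real^4) set) \<Rightarrow> bool" where
  "diffeo_RP3 F \<longleftrightarrow>
     bij_betw F (topspace RP3) (topspace RP3) \<and>
     smooth_to_RP3 (sphere 0 1) (F \<circ> antipodal_pair) \<and>
     smooth_to_RP3 (sphere 0 1) (inv_into (topspace RP3) F \<circ> antipodal_pair)"

definition ambient_isotopic :: "(real^4) set set \<Rightarrow> (real^4) set set \<Rightarrow> bool" where
  "ambient_isotopic A B \<longleftrightarrow>
     (\<exists>\<Phi> :: real \<Rightarrow> (real^4) set \<Rightarrow> (real^4) set.
        smooth_to_RP3 ({0..1} \<times> sphere 0 1) (\<lambda>(t, x). \<Phi> t (antipodal_pair x)) \<and>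
        (\<forall>t\<in>{0..1}. diffeo_RP3 (\<Phi> t)) \<and>
        (\<forall>p\<in>topspace RP3. \<Phi> 0 p = p) \<and>
        \<Phi> 1 ` A = B)"

definition closed_surface :: "(real^4) set set \<Rightarrow> bool" where
  "closed_surface S \<longleftrightarrow> compactin RP3 S \<and> smooth_submanifold 2 (cover_preimage S)"


subsection \<open>Knots\<close>

text \<open>The circle is the unit circle of the complex plane. In angular coordinates a smooth immersed
  curve in \<open>RP3\<close> lifts to a smooth regular curve \<open>g\<close> in the sphere; the lift need not have
  period \<open>2 * pi\<close>.\<close>

definition knot :: "(complex \<Rightarrow> (real^4) set) \<Rightarrow> bool" where
  "knot f \<longleftrightarrow>
     inj_on f (sphere 0 1) \<and>
     (\<exists>g :: real \<Rightarrow> real^4. smooth_on UNIV g \<and>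
        (\<forall>t. g t \<in> sphere 0 1 \<and> antipodal_pair (g t) = f (cis t) \<and>
             vector_derivative g (at t) \<noteq> 0))"

abbreviation knot_image :: "(complex \<Rightarrow> (real^4) set) \<Rightarrow> (real^4) set set" where
  "knot_image f \<equiv> f ` sphere 0 1"

definition knot_isotopy ::
  "((complex \<Rightarrow> (real^4) set) \<times> (complex \<Rightarrow> (real^4) set)) set" where
  "knot_isotopy = {(f, g). knot f \<and> knot g \<and> ambient_isotopic (knot_image f) (knot_image g)}"

text \<open>The loop is trivial in the fundamental group based at \<open>f 1\<close>.\<close>

definition class_0 :: "(complex \<Rightarrow> (real^4) set) \<Rightarrow> bool" where
  "class_0 f \<longleftrightarrow>
     homotopic_with (\<lambda>q. q 0 = f 1 \<and> q 1 = f 1) (top_of_set {0..1::real}) RP3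
       (\<lambda>t. f (cis (2 * pi * t))) (\<lambda>t. f 1)"


subsection \<open>Projective planes and affine knots\<close>

definition ball_model :: "(real^3 \<Rightarrow> (real^4) set) \<Rightarrow> bool" where
  "ball_model q \<longleftrightarrow>
     quotient_map (top_of_set (cball 0 1)) RP3 q \<and>
     (\<forall>x\<in>cball 0 1. \<forall>y\<in>cball 0 1.
        q x = q y \<longleftrightarrow> x = y \<or> (norm x = 1 \<and> y = - x))"

definition projective_plane :: "(real^4) set set \<Rightarrow> bool" where
  "projective_plane P \<longleftrightarrow> closed_surface P \<and> subtopology RP3 P homeomorphic_space RP2"

definition standard_plane :: "(real^4) set set \<Rightarrow> bool" where
  "standard_plane P \<longleftrightarrow> projective_plane P \<and>
     (\<exists>q. ball_model q \<and>
        ({x \<in> cball 0 1. q x \<in> P} = sphere 0 1 \<or>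
         (\<exists>v. v \<noteq> 0 \<and> {x \<in> cball 0 1. q x \<in> P} = {x \<in> cball 0 1. v \<bullet> x = 0})))"

definition asymptotic_plane :: "(real^4) set set \<Rightarrow> bool" where
  "asymptotic_plane P \<longleftrightarrow> projective_plane P \<and> (\<exists>Q. standard_plane Q \<and> ambient_isotopic Q P)"

definition affine_knot :: "(complex \<Rightarrow> (real^4) set) \<Rightarrow> bool" where
  "affine_knot f \<longleftrightarrow> (\<exists>P. asymptotic_plane P \<and> knot_image f \<inter> P = {})"


subsection \<open>Genus\<close>

text \<open>A closed connected orientable surface has genus \<open>g\<close> iff its first integral homology group
  is free abelian of rank \<open>2 * g\<close>.\<close>

definition surface_has_genus :: "'a::topological_space set \<Rightarrow> nat \<Rightarrow> bool" where
  "surface_has_genus F g \<longleftrightarrow>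
     homology_group 1 (top_of_set F) \<cong> free_Abelian_group {..<2 * g}"

definition good_surface :: "(real^4) set set \<Rightarrow> (complex \<Rightarrow> (real^4) set) \<Rightarrow> bool" where
  "good_surface S f \<longleftrightarrow>
     closed_surface S \<and> connectedin RP3 S \<and> knot_image f \<subseteq> S \<and> connected (cover_preimage S)"

definition good_genus :: "(complex \<Rightarrow> (real^4) set) \<Rightarrow> nat \<Rightarrow> bool" where
  "good_genus f g \<longleftrightarrow>
     (\<exists>f' S. (f, f') \<in> knot_isotopy \<and> good_surface S f' \<and> surface_has_genus (cover_preimage S) g)"

definition knot_has_genus :: "(complex \<Rightarrow> (real^4) set) \<Rightarrow> nat \<Rightarrow> bool" where
  "knot_has_genus f g \<longleftrightarrow> good_genus f g \<and> (\<forall>g'. good_genus f g' \<longrightarrow> g \<le> g')"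

end

theory Submission
  imports Defs
begin

text \<open>For \<open>n \<ge> 1\<close> the knot \<open>K\<close> lifts to the curve \<open>w = z ^ (2 * n)\<close> of the unit sphere of \<open>\<complex>\<^sup>2\<close>, and
  the preimage of \<open>K\<close> consists of this curve and its antipode. Their linking number, the winding number
  of \<open>w - z ^ (2 * n)\<close> along the antipode, is \<open>2 * n\<close>, and everything follows from it.

  Over the complement of a projective plane the covering is trivial and continuous nonvanishing functions
  have logarithms, so an affine knot would have linking number \<open>0\<close>. In the complement of the lifted
  curve its antipode is homotopic to the \<open>2 * n\<close>-fold circle \<open>z = 0\<close>, so every continuous function on the
  sphere that vanishes only on the curve has a winding number divisible by \<open>2 * n\<close> along the antipode;
  this makes \<open>n\<close> an invariant of \<open>K\<close>. If \<open>K\<close> lies on a surface whose preimage \<open>M\<close> has trivial first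
  homology, then the square of \<open>w - z ^ (2 * n)\<close>, normalized to modulus \<open>1\<close>, extends continuously from the
  complement of the curve to \<open>M\<close>, since its limits at the curve are the squares of the directions of
  lines; so it has winding number \<open>0\<close> along the antipode, but this number is \<open>4 * n\<close>. Hence the
  genus is positive, and it is \<open>1\<close> because \<open>K\<close> lies on the torus on which \<open>\<bar>z\<bar>\<close> and \<open>\<bar>w\<bar>\<close> are constant.\<close>


subsection \<open>Smooth and strictly differentiable maps\<close>

text \<open>The exponent is even so that the antipode of \<open>w = z ^ (2 * n)\<close> is the
  disjoint curve \<open>w = - z ^ (2 * n)\<close>: the knot then lifts to a closed curve, and its
  two lifts can link. Winding numbers are gains of continuous logarithms, so they rest on uniqueness
  of logarithms over connected sets. An ambient isotopy enters through its final diffeomorphism,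
  which lifts to an odd homeomorphism of the sphere with smooth local extensions. The degree with
  which this lift reparametrizes the curve is not known at first; it is 1 or -1 because the inverse
  lift has the inverse degree. For the genus, the surface through the knot is arbitrary. Across the
  curve the argument of \<open>defect\<close> on the surface jumps by pi, which is why only the
  square of the direction can extend. Its limit is a first order fact: the derivative of
  \<open>defect\<close> kills the tangent of the knot, hence maps the tangent plane of the surface
  into a real line. Reading this off from secants with both ends moving requires strict
  differentiability.\<close>

lemma Ck_on_subset: "Ck_on k U f \<Longrightarrow> V \<subseteq> U \<Longrightarrow> Ck_on k V f"
  by (induction k arbitrary: f) (auto intro: continuous_on_subset)

lemma smooth_on_subset: "smooth_on U f \<Longrightarrow> V \<subseteq> U \<Longrightarrow> smooth_on V f"
  unfolding smooth_on_def using Ck_on_subset by blast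

lemma frechet_derivative_eqI:
  "(f has_derivative f') (at x) \<Longrightarrow> frechet_derivative f (at x) = f'"
  using frechet_derivative_at by metis

lemma Ck_on_cong:
  assumes "open U" "\<And>x. x \<in> U \<Longrightarrow> f x = g x" "Ck_on k U f"
  shows "Ck_on k U g"
  using assms(2,3)
proof (induction k arbitrary: f g)
  case 0
  then show ?case using continuous_on_cong[of U U f g] by simp
next
  case (Suc k)
  have d: "(g has_derivative frechet_derivative f (at x)) (at x)" if "x \<in> U" for x
    using has_derivative_transform_within_open[OF _ assms(1) that, of f "frechet_derivative f (at x)" UNIV g]
      frechet_derivative_works Suc.prems that by auto
  have "Ck_on k U (\<lambda>x. frechet_derivative g (at x) v)" for v
    by (rule Suc.IH[of "\<lambda>x. frechet_derivative f (at x) v"])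
      (use frechet_derivative_eqI[OF d] Suc.prems in auto)
  with d show ?case
    by (auto simp: differentiable_def)
qed

text \<open>Lets the inductions on \<open>k\<close> below supply a derivative in any convenient
  form; they work for families of functions that are closed under directional derivatives.\<close>

lemma Ck_on_SucI:
  assumes "open U" "\<And>x. x \<in> U \<Longrightarrow> (f has_derivative f' x) (at x)"
    "\<And>v. Ck_on k U (\<lambda>x. f' x v)"
  shows "Ck_on (Suc k) U f"
proof -
  have "Ck_on k U (\<lambda>x. frechet_derivative f (at x) v)" for v
    by (rule Ck_on_cong[OF assms(1) _ assms(3)[of v]])
      (use frechet_derivative_eqI[OF assms(2)] in auto)
  with assms(2) show ?thesis by (auto simp: differentiable_def)
qed

lemma Ck_on_const: "open U \<Longrightarrow> Ck_on k U (\<lambda>x. c)"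
proof (induction k arbitrary: c)
  case (Suc k)
  then show ?case by (intro Ck_on_SucI[where f' = "\<lambda>x v. 0"]) auto
qed simp

lemma Ck_on_bounded_linear: "open U \<Longrightarrow> bounded_linear h \<Longrightarrow> Ck_on k U h"
proof (cases k)
  case (Suc j)
  assume "open U" "bounded_linear h"
  then show ?thesis unfolding Suc
    by (intro Ck_on_SucI[where f' = "\<lambda>x v. h v"] Ck_on_const)
      (auto intro: bounded_linear_imp_has_derivative)
qed (auto intro: linear_continuous_on)

lemma Ck_on_add:
  assumes "open U" "Ck_on k U f" "Ck_on k U g"
  shows "Ck_on k U (\<lambda>x. f x + g x)"
  using assms(2,3)
proof (induction k arbitrary: f g)
  case (Suc k)
  show ?case
  proof (rule Ck_on_SucI[OF assms(1)])
    show "((\<lambda>x. f x + g x) has_derivative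
        (\<lambda>v. frechet_derivative f (at x) v + frechet_derivative g (at x) v)) (at x)"
      if "x \<in> U" for x
      using Suc.prems that by (auto intro!: has_derivative_add simp flip: frechet_derivative_works)
  qed (use Suc in auto)
qed (auto intro: continuous_on_add)

lemma Ck_on_linear_compose:
  assumes "open U" "bounded_linear h" "Ck_on k U f"
  shows "Ck_on k U (\<lambda>x. h (f x))"
  using assms(3)
proof (induction k arbitrary: f)
  case 0
  then show ?case using linear_continuous_on_compose[OF _ bounded_linear.linear[OF assms(2)]] by auto
next
  case (Suc k)
  show ?case
  proof (rule Ck_on_SucI[OF assms(1)])
    show "((\<lambda>x. h (f x)) has_derivative (\<lambda>v. h (frechet_derivative f (at x) v))) (at x)"
      if "x \<in> U" for x
      by (intro bounded_linear.has_derivative[OF assms(2)])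
        (use Suc.prems that in \<open>auto simp flip: frechet_derivative_works\<close>)
  qed (use Suc in auto)
qed

text \<open>The directional derivative along \<open>v\<close> has the same shape, with exponent
  \<open>j + 1\<close> and with \<open>h\<close> precomposed with multiplication by
  \<open>- (of_nat j * l v)\<close>. This is why \<open>h\<close> and \<open>j\<close> are
  generalized in the induction.\<close>

lemma Ck_on_inverse_power:
  fixes l :: "'a::euclidean_space \<Rightarrow> complex" and h :: "complex \<Rightarrow> 'b::euclidean_space"
  assumes "open U" "bounded_linear l" "\<And>x. x \<in> U \<Longrightarrow> l x + c \<noteq> 0" "bounded_linear h"
  shows "Ck_on k U (\<lambda>x. h (inverse (l x + c) ^ j))"
  using assms(4)
proof (induction k arbitrary: h j)
  case 0
  then show ?case
    using assms(3)
    by (auto intro!: continuous_intros bounded_linear.continuous_on[OF 0]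
        bounded_linear.continuous_on[OF assms(2)])
next
  case (Suc k)
  show ?case
  proof (rule Ck_on_SucI[OF assms(1)])
    fix x assume x: "x \<in> U"
    have "((\<lambda>x. inverse (l x + c) ^ j) has_derivative
        (\<lambda>v. - (of_nat j * l v) * inverse (l x + c) ^ (j + 1))) (at x)"
    proof -
      let ?i = "inverse (l x + c)"
      have "((\<lambda>x. inverse (l x + c)) has_derivative (\<lambda>v. - (?i * l v * ?i))) (at x)"
        using assms(3)[OF x]
        by (auto intro!: derivative_eq_intros bounded_linear.has_derivative[OF assms(2)])
      from has_derivative_power[OF this, of j]
      have "((\<lambda>x. inverse (l x + c) ^ j) has_derivative
          (\<lambda>v. of_nat j * - (?i * l v * ?i) * ?i ^ (j - 1))) (at x)" .
      moreover have "of_nat j * - (?i * l v * ?i) * ?i ^ (j - 1) = - (of_nat j * l v) * ?i ^ (j + 1)" for v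
        by (cases j) (simp_all add: algebra_simps)
      ultimately show ?thesis by (simp only:)
    qed
    from bounded_linear.has_derivative[OF Suc.prems this]
    show "((\<lambda>x. h (inverse (l x + c) ^ j)) has_derivative
        (\<lambda>v. h (- (of_nat j * l v) * inverse (l x + c) ^ (j + 1)))) (at x)" .
  next
    fix v
    show "Ck_on k U (\<lambda>x. h (- (of_nat j * l v) * inverse (l x + c) ^ (j + 1)))"
      by (rule Suc.IH) (intro bounded_linear_compose[OF Suc.prems] bounded_linear_mult_right)
  qed
qed

text \<open>Differentiation replaces the pair \<open>A\<close>, \<open>B\<close> by multiples of
  \<open>B\<close> and \<open>- A\<close>, so the induction generalizes over both vectors.\<close>

lemma Ck_on_cos_sin:
  fixes A B :: "'b::euclidean_space"
  shows "Ck_on k UNIV (\<lambda>t::real. cos (m * t) *\<^sub>R A + sin (m * t) *\<^sub>R B)"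
proof (induction k arbitrary: A B)
  case 0
  show ?case by (auto intro!: continuous_intros)
next
  case (Suc k)
  show ?case
  proof (rule Ck_on_SucI)
    fix x :: real
    show "((\<lambda>t. cos (m * t) *\<^sub>R A + sin (m * t) *\<^sub>R B) has_derivative
       (\<lambda>v. cos (m * x) *\<^sub>R ((m * v) *\<^sub>R B) + sin (m * x) *\<^sub>R (- (m * v) *\<^sub>R A))) (at x)"
      by (auto intro!: derivative_eq_intros simp: fun_eq_iff algebra_simps)
  next
    show "Ck_on k UNIV (\<lambda>x. cos (m * x) *\<^sub>R ((m * v) *\<^sub>R B) + sin (m * x) *\<^sub>R (- (m * v) *\<^sub>R A))" for v
      by (rule Suc.IH)
  qed simp
qed

text \<open>Strict differentiability: both ends of the secant may move near \<open>p\<close> while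
  the derivative stays the one at \<open>p\<close>. The genus argument compares secants that end at
  varying points of the knot with the derivative at a fixed one.\<close>

definition strictly_differentiable ::
  "('a::euclidean_space \<Rightarrow> 'b::euclidean_space) \<Rightarrow> ('a \<Rightarrow> 'b) \<Rightarrow> 'a \<Rightarrow> bool" where
  "strictly_differentiable f A p \<longleftrightarrow> bounded_linear A \<and>
     (\<forall>e>0. \<exists>d>0. \<forall>x\<in>ball p d. \<forall>y\<in>ball p d. norm (f x - f y - A (x - y)) \<le> e * norm (x - y))"

text \<open>The mean value inequality for \<open>f - f' p\<close>, whose derivative has small
  operator norm on a small ball around \<open>p\<close>.\<close>

lemma continuous_derivative_imp_strictly_differentiable:
  fixes f :: "'a::euclidean_space \<Rightarrow> 'b::euclidean_space"
  assumes "open U" "p \<in> U" and d: "\<And>x. x \<in> U \<Longrightarrow> (f has_derivative f' x) (at x)"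
    and c: "\<And>v. continuous_on U (\<lambda>x. f' x v)"
  shows "strictly_differentiable f (f' p) p"
  unfolding strictly_differentiable_def
proof (intro conjI allI impI)
  show bl: "bounded_linear (f' p)" using d[OF \<open>p \<in> U\<close>] has_derivative_bounded_linear by blast
  fix e :: real assume "e > 0"
  \<comment> \<open>Only the continuity of each directional derivative is given; summing over the
    basis turns it into a bound on the operator norm.\<close>
  define h where "h = (\<lambda>x. \<Sum>b\<in>Basis. norm (f' x b - f' p b))"
  have "continuous_on U h" unfolding h_def by (intro continuous_intros c)
  moreover have "h p = 0" by (simp add: h_def)
  ultimately obtain d where "d > 0" and hd: "\<And>x. x \<in> U \<Longrightarrow> dist x p < d \<Longrightarrow> h x < e"
    using \<open>e > 0\<close> \<open>p \<in> U\<close> unfolding continuous_on_iff by (fastforce simp: dist_real_def)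
  obtain d' where "d' > 0" and d': "ball p d' \<subseteq> U"
    using assms(1,2) open_contains_ball by blast
  define r where "r = min d d'"
  have r: "r > 0" "ball p r \<subseteq> U" using \<open>d > 0\<close> \<open>d' > 0\<close> d' by (auto simp: r_def)
  have *: "onorm (\<lambda>v. f' x v - f' p v) \<le> e" if x: "x \<in> ball p r" for x
  proof (rule onorm_le)
    fix v
    have lin: "linear (\<lambda>v. f' x v - f' p v)"
      using d[THEN has_derivative_linear] bl x r by (intro linear_compose_sub) (auto simp: bounded_linear.linear)
    have "norm (f' x v - f' p v) = norm (\<Sum>b\<in>Basis. (v \<bullet> b) *\<^sub>R (f' x b - f' p b))"
      using linear_sum[OF lin, of "\<lambda>b. (v \<bullet> b) *\<^sub>R b" Basis] linear_cmul[OF lin]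
      by (simp add: euclidean_representation)
    also have "\<dots> \<le> (\<Sum>b\<in>Basis. norm v * norm (f' x b - f' p b))"
      by (rule sum_norm_le) (auto intro!: mult_right_mono simp: Basis_le_norm)
    also have "\<dots> = h x * norm v" by (simp add: h_def sum_distrib_left mult.commute)
    also have "\<dots> \<le> e * norm v"
      using hd[of x] x r by (intro mult_right_mono) (auto simp: dist_commute r_def less_imp_le subset_eq)
    finally show "norm (f' x v - f' p v) \<le> e * norm v" .
  qed
  have "norm (f x - f y - f' p (x - y)) \<le> e * norm (x - y)" if xy: "x \<in> ball p r" "y \<in> ball p r" for x y
  proof -
    have "norm ((f x - f' p x) - (f y - f' p y)) \<le> e * norm (x - y)"
    proof (rule differentiable_bound[of "ball p r" "\<lambda>x. f x - f' p x" "\<lambda>x v. f' x v - f' p v"])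
      show "((\<lambda>x. f x - f' p x) has_derivative (\<lambda>v. f' x v - f' p v)) (at x within ball p r)"
        if "x \<in> ball p r" for x
        using that r bl
        by (intro has_derivative_diff has_derivative_at_withinI[OF d]
            bounded_linear_imp_has_derivative) auto
    qed (use * xy in auto)
    then show ?thesis by (simp add: bounded_linear.linear[OF bl] linear_diff algebra_simps)
  qed
  with r show "\<exists>d>0. \<forall>x\<in>ball p d. \<forall>y\<in>ball p d. norm (f x - f y - f' p (x - y)) \<le> e * norm (x - y)"
    by blast
qed

lemma smooth_on_imp_strictly_differentiable:
  assumes "smooth_on U f" "open U" "p \<in> U"
  obtains A where "strictly_differentiable f A p"
proof -
  have "Ck_on (Suc 0) U f" using assms(1) unfolding smooth_on_def by blast
  then show thesis
    using continuous_derivative_imp_strictly_differentiable[OF assms(2,3), of f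
        "\<lambda>x. frechet_derivative f (at x)"] frechet_derivative_works that by auto
qed

lemma strictly_differentiable_lipschitz:
  assumes "strictly_differentiable f A p"
  obtains C d where "C > 0" "d > 0"
    "\<And>x y. x \<in> ball p d \<Longrightarrow> y \<in> ball p d \<Longrightarrow> norm (f x - f y) \<le> C * norm (x - y)"
proof -
  obtain K where K: "K > 0" "\<And>x. norm (A x) \<le> norm x * K"
    using assms bounded_linear.pos_bounded unfolding strictly_differentiable_def by blast
  obtain d where d: "d > 0" "\<And>x y. x \<in> ball p d \<Longrightarrow> y \<in> ball p d \<Longrightarrow> norm (f x - f y - A (x - y)) \<le> 1 * norm (x - y)"
    using assms unfolding strictly_differentiable_def by (meson zero_less_one)
  show thesis
  proof (rule that[of "K + 1" d])
    fix x y assume "x \<in> ball p d" "y \<in> ball p d"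
    then have "norm (f x - f y - A (x - y)) \<le> norm (x - y)" using d by simp
    moreover have "norm (f x - f y) \<le> norm (f x - f y - A (x - y)) + norm (A (x - y))"
      by (metis diff_add_cancel norm_triangle_ineq)
    ultimately show "norm (f x - f y) \<le> (K + 1) * norm (x - y)"
      using K(2)[of "x - y"] by (simp add: algebra_simps)
  qed (use K d in auto)
qed

lemma strictly_differentiable_continuous:
  assumes "strictly_differentiable f A p"
  shows "continuous (at p) f"
proof -
  obtain C d where C: "C > 0" "d > 0"
    "\<And>x y. x \<in> ball p d \<Longrightarrow> y \<in> ball p d \<Longrightarrow> norm (f x - f y) \<le> C * norm (x - y)"
    using strictly_differentiable_lipschitz[OF assms] by blast
  show ?thesis
    unfolding continuous_at_eps_delta
  proof (intro allI impI)
    fix e :: real assume "e > 0"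
    have "norm (f x - f p) < e" if "dist x p < min d (e / C)" for x
    proof -
      have "norm (f x - f p) \<le> C * norm (x - p)" using that C by (auto simp: dist_commute)
      also have "\<dots> < e" using that C by (simp add: dist_norm field_simps)
      finally show ?thesis .
    qed
    then show "\<exists>d>0. \<forall>x'. dist x' p < d \<longrightarrow> dist (f x') (f p) < e"
      using C \<open>e > 0\<close> by (intro exI[of _ "min d (e / C)"]) (auto simp: dist_norm)
  qed
qed

lemma strictly_differentiable_compose:
  assumes f: "strictly_differentiable f A p" and g: "strictly_differentiable g B (f p)"
  shows "strictly_differentiable (\<lambda>x. g (f x)) (\<lambda>x. B (A x)) p"
  unfolding strictly_differentiable_def
proof (intro conjI allI impI)
  have A: "bounded_linear A" and B: "bounded_linear B"
    using f g by (auto simp: strictly_differentiable_def)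
  then show "bounded_linear (\<lambda>x. B (A x))" using bounded_linear_compose by blast
  fix e :: real assume "e > 0"
  obtain C d where C: "C > 0" "d > 0"
    "\<And>x y. x \<in> ball p d \<Longrightarrow> y \<in> ball p d \<Longrightarrow> norm (f x - f y) \<le> C * norm (x - y)"
    using strictly_differentiable_lipschitz[OF f] by blast
  obtain K where K: "K > 0" "\<And>x. norm (B x) \<le> norm x * K"
    using B bounded_linear.pos_bounded by blast
  have "e / (2 * C) > 0" "e / (2 * K) > 0" using C K \<open>e > 0\<close> by auto
  obtain d1 where d1: "d1 > 0" "\<And>x y. x \<in> ball (f p) d1 \<Longrightarrow> y \<in> ball (f p) d1 \<Longrightarrow>
      norm (g x - g y - B (x - y)) \<le> e / (2 * C) * norm (x - y)"
    using g \<open>e / (2 * C) > 0\<close> unfolding strictly_differentiable_def by meson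
  obtain d2 where d2: "d2 > 0" "\<And>x y. x \<in> ball p d2 \<Longrightarrow> y \<in> ball p d2 \<Longrightarrow>
      norm (f x - f y - A (x - y)) \<le> e / (2 * K) * norm (x - y)"
    using f \<open>e / (2 * K) > 0\<close> unfolding strictly_differentiable_def by meson
  obtain d3 where d3: "d3 > 0" "\<And>x. x \<in> ball p d3 \<Longrightarrow> f x \<in> ball (f p) d1"
    using strictly_differentiable_continuous[OF f] \<open>d1 > 0\<close>
    unfolding continuous_at_eps_delta by (metis dist_commute mem_ball)
  define r where "r = min d (min d2 d3)"
  have "norm (g (f x) - g (f y) - B (A (x - y))) \<le> e * norm (x - y)"
    if "x \<in> ball p r" "y \<in> ball p r" for x y
  proof -
    have xy: "x \<in> ball p d" "y \<in> ball p d" "x \<in> ball p d2" "y \<in> ball p d2" "x \<in> ball p d3" "y \<in> ball p d3"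
      using that by (auto simp: r_def)
    have "g (f x) - g (f y) - B (A (x - y)) = (g (f x) - g (f y) - B (f x - f y)) + B (f x - f y - A (x - y))"
      by (simp add: bounded_linear.linear[OF B] linear_diff)
    then have "norm (g (f x) - g (f y) - B (A (x - y)))
        \<le> norm (g (f x) - g (f y) - B (f x - f y)) + norm (B (f x - f y - A (x - y)))"
      by (metis norm_triangle_ineq)
    also have "\<dots> \<le> e / (2 * C) * norm (f x - f y) + norm (f x - f y - A (x - y)) * K"
      using d1(2)[OF d3(2)[OF xy(5)] d3(2)[OF xy(6)]] K(2) by (intro add_mono) auto
    also have "\<dots> \<le> e / (2 * C) * (C * norm (x - y)) + e / (2 * K) * norm (x - y) * K"
      using C(3)[OF xy(1,2)] d2(2)[OF xy(3,4)] K C \<open>e > 0\<close>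
      by (intro add_mono mult_left_mono mult_right_mono) auto
    also have "\<dots> = e * norm (x - y)" using C K by (simp add: field_simps)
    finally show ?thesis .
  qed
  moreover have "r > 0" using C d2 d3 by (auto simp: r_def)
  ultimately show "\<exists>d>0. \<forall>x\<in>ball p d. \<forall>y\<in>ball p d.
      norm (g (f x) - g (f y) - B (A (x - y))) \<le> e * norm (x - y)"
    by blast
qed


subsection \<open>Lifting maps to the sphere\<close>

definition zc :: "real^4 \<Rightarrow> complex" where "zc x = Complex (x$1) (x$2)"
definition wc :: "real^4 \<Rightarrow> complex" where "wc x = Complex (x$3) (x$4)"
definition mk :: "complex \<Rightarrow> complex \<Rightarrow> real^4" where
  "mk z w = (\<chi> i. if i = 1 then Re z else if i = 2 then Im z else if i = 3 then Re w else Im w)"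

lemma mk_nth: "mk z w $ 1 = Re z" "mk z w $ 2 = Im z" "mk z w $ 3 = Re w" "mk z w $ 4 = Im w"
  by (simp_all add: mk_def)

lemma zc_mk [simp]: "zc (mk z w) = z" and wc_mk [simp]: "wc (mk z w) = w"
  by (simp_all add: zc_def wc_def mk_nth)

lemma mk_zc_wc [simp]: "mk (zc x) (wc x) = x"
  by (simp add: vec_eq_iff forall_4 mk_nth zc_def wc_def)

lemma mk_eq_iff [simp]: "mk z w = mk z' w' \<longleftrightarrow> z = z' \<and> w = w'"
  by (metis zc_mk wc_mk)

lemma mk_add: "mk z w + mk z' w' = mk (z + z') (w + w')"
  and mk_diff: "mk z w - mk z' w' = mk (z - z') (w - w')"
  and mk_scaleR: "r *\<^sub>R mk z w = mk (r *\<^sub>R z) (r *\<^sub>R w)"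
  by (simp_all add: vec_eq_iff forall_4 mk_nth)

lemma bounded_linear_zc: "bounded_linear zc" and bounded_linear_wc: "bounded_linear wc"
  by (auto intro!: linearI simp: linear_conv_bounded_linear [symmetric] zc_def wc_def complex_eq_iff)

lemma bounded_linear_mk: "bounded_linear (\<lambda>p. mk (fst p) (snd p))"
  by (auto intro!: linearI simp: linear_conv_bounded_linear [symmetric] mk_add mk_scaleR)

lemmas zc_minus [simp] = linear_neg[OF bounded_linear.linear[OF bounded_linear_zc]]
lemmas wc_minus [simp] = linear_neg[OF bounded_linear.linear[OF bounded_linear_wc]]

lemmas continuous_on_zc [continuous_intros] = bounded_linear.continuous_on[OF bounded_linear_zc]
lemmas continuous_on_wc [continuous_intros] = bounded_linear.continuous_on[OF bounded_linear_wc]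

lemma continuous_on_mk [continuous_intros]:
  "continuous_on S f \<Longrightarrow> continuous_on S g \<Longrightarrow> continuous_on S (\<lambda>x. mk (f x) (g x))"
  using bounded_linear.continuous_on[OF bounded_linear_mk, of S "\<lambda>x. (f x, g x)"]
  by (auto intro: continuous_on_Pair)

lemma norm_sq_C2: "(norm x)\<^sup>2 = (cmod (zc x))\<^sup>2 + (cmod (wc x))\<^sup>2"
  by (simp add: norm_vec_def L2_set_def sum_4 zc_def wc_def cmod_power2 sum_nonneg)

lemma sphere_C2_iff: "x \<in> sphere 0 1 \<longleftrightarrow> (cmod (zc x))\<^sup>2 + (cmod (wc x))\<^sup>2 = 1"
proof -
  have "norm x = 1 \<longleftrightarrow> (norm x)\<^sup>2 = 1" by (simp add: abs_square_eq_1)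
  then show ?thesis by (simp add: norm_sq_C2)
qed

lemma norm_mk_le: "norm (mk z w) \<le> cmod z + cmod w"
proof (rule power2_le_imp_le)
  show "(norm (mk z w))\<^sup>2 \<le> (cmod z + cmod w)\<^sup>2"
    by (simp add: norm_sq_C2 power2_sum)
qed simp

lemma antipodal_pair_eq_iff: "antipodal_pair x = antipodal_pair y \<longleftrightarrow> x = y \<or> x = - y"
  by (auto simp: antipodal_pair_def doubleton_eq_iff)

lemma antipodal_pair_minus [simp]: "antipodal_pair (- x) = antipodal_pair x"
  by (auto simp: antipodal_pair_def)

lemma antipodal_pair_in_RP3 [simp]: "x \<in> sphere 0 1 \<Longrightarrow> antipodal_pair x \<in> topspace RP3"
  by (auto simp: topspace_projective_space)

lemma continuous_map_antipodal_pair: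
  "continuous_map (top_of_set (sphere 0 1)) RP3 antipodal_pair"
  by (rule quotient_imp_continuous_map[OF quotient_map_antipodal_pair])

lemma sphere_neq_minus: "x \<in> sphere (0::'a::real_normed_vector) 1 \<Longrightarrow> x \<noteq> - x"
proof
  assume "x \<in> sphere 0 1" "x = - x"
  then have "2 *\<^sub>R x = 0" by (metis scaleR_2 add.right_inverse)
  then show False using \<open>x \<in> sphere 0 1\<close> by (simp only: scaleR_eq_0_iff) auto
qed

section \<open>The Veronese embedding and lifts through the double covering\<close>

lemma continuous_on_matrix_vector_mult [continuous_intros]:
  fixes M :: "'a::topological_space \<Rightarrow> real^'n^'m"
  assumes "continuous_on S M"
  shows "continuous_on S (\<lambda>x. M x *v v)"
  unfolding matrix_vector_mult_def by (intro continuous_intros assms)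

text \<open>The rank one matrix of \<open>x\<close> times its transpose. It is even and separates
  antipodal pairs, so it realizes projective space as a subset of a Euclidean space, to which
  lifting theorems for \<open>covering_space\<close> apply.\<close>

definition veronese :: "real^4 \<Rightarrow> real^4^4" where "veronese x = (\<chi> i j. x $ i * x $ j)"

lemma veronese_apply: "veronese x *v y = (x \<bullet> y) *\<^sub>R x"
  by (simp add: vec_eq_iff veronese_def matrix_vector_mult_def inner_vec_def sum_distrib_left algebra_simps)

lemma veronese_minus [simp]: "veronese (- x) = veronese x"
  by (simp add: veronese_def)

lemma continuous_on_veronese: "continuous_on S veronese"
  unfolding veronese_def by (intro continuous_intros)

lemma veronese_eqD:
  assumes "veronese x = veronese y" "norm x = 1" "norm y = 1"
  shows "x = y \<or> x = - y"
proof -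
  have eq: "x = (y \<bullet> x) *\<^sub>R y"
    using veronese_apply[of x x] veronese_apply[of y x] assms by (simp add: dot_square_norm)
  have "\<bar>y \<bullet> x\<bar> = 1" using arg_cong[OF eq, of norm] assms by simp
  then have "y \<bullet> x = 1 \<or> y \<bullet> x = -1" by linarith
  then show ?thesis using eq by (elim disjE) (simp_all only: scaleR_minus1_left scaleR_one, simp_all)
qed

text \<open>\<open>veronese x *v x0\<close> is a multiple of \<open>x\<close>, so normalizing it
  recovers \<open>x\<close> up to sign, and \<open>s\<close> selects the sign. The two open
  hemispheres around \<open>x0\<close> and \<open>- x0\<close> are thus the two sheets over the
  matrices that do not kill \<open>x0\<close>.\<close>

lemma homeomorphism_veronese_half:
  assumes x0: "norm x0 = 1" and s: "s = 1 \<or> s = (-1::real)"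
  shows "homeomorphism {x \<in> sphere 0 1. s * (x \<bullet> x0) > 0}
    {M \<in> veronese ` sphere 0 1. M *v x0 \<noteq> 0} veronese (\<lambda>M. (s / norm (M *v x0)) *\<^sub>R (M *v x0))"
    (is "homeomorphism ?u ?T _ ?q")
proof -
  have ss: "s * s = 1" "\<bar>s\<bar> = 1" using s by auto
  have nx: "norm (veronese x *v x0) = \<bar>x \<bullet> x0\<bar>" if "norm x = 1" for x
    using that by (simp add: veronese_apply)
  have q: "?q (veronese x) = x" if "x \<in> ?u" for x
  proof -
    have "\<bar>x \<bullet> x0\<bar> = s * (x \<bullet> x0)" using that s by auto
    moreover have "s / norm (veronese x *v x0) * (x \<bullet> x0) = (s * (x \<bullet> x0)) / \<bar>x \<bullet> x0\<bar>"
      using nx[of x] that by simp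
    ultimately have "s / norm (veronese x *v x0) * (x \<bullet> x0) = 1"
      using that by auto
    moreover have "?q (veronese x) = (s / norm (veronese x *v x0) * (x \<bullet> x0)) *\<^sub>R x"
      unfolding veronese_apply by simp
    ultimately show ?thesis by (simp only: scaleR_one)
  qed
  have T: "veronese x \<in> ?T" if "x \<in> ?u" for x
    using that by (auto simp: veronese_apply)
  have ex: "\<exists>x\<in>?u. M = veronese x" if M: "M \<in> ?T" for M
  proof -
    obtain x where x: "x \<in> sphere 0 1" "M = veronese x" "M *v x0 \<noteq> 0" using M by blast
    then have "x \<bullet> x0 \<noteq> 0" by (auto simp: veronese_apply)
    show ?thesis
    proof (cases "s * (x \<bullet> x0) > 0")
      case False
      then have "- x \<in> ?u" using \<open>x \<bullet> x0 \<noteq> 0\<close> x s by auto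
      then show ?thesis using x(2) by (intro bexI[of _ "- x"]) simp_all
    next
      case True
      then show ?thesis using x(1,2) by blast
    qed
  qed
  show ?thesis
  proof
    show "continuous_on ?T ?q"
      by (intro continuous_intros) auto
    show "continuous_on ?u veronese" by (rule continuous_on_veronese)
    show "veronese ` ?u \<subseteq> ?T" using T by blast
    show "?q ` ?T \<subseteq> ?u"
    proof (rule image_subsetI)
      fix M assume "M \<in> ?T"
      then obtain x where x: "x \<in> ?u" "M = veronese x" using ex[of M] by blast
      show "?q M \<in> ?u" unfolding x(2) q[OF x(1)] by (rule x(1))
    qed
    show "?q (veronese x) = x" if "x \<in> ?u" for x using q that .
    show "veronese (?q M) = M" if M: "M \<in> ?T" for M
    proof -
      obtain x where x: "x \<in> ?u" "M = veronese x" using ex[OF M] by blast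
      show ?thesis unfolding x(2) q[OF x(1)] by (rule refl)
    qed
  qed
qed

lemma covering_space_veronese:
  "covering_space (sphere 0 1) veronese (veronese ` sphere 0 1)"
proof
  fix M assume "M \<in> veronese ` sphere 0 1"
  then obtain x0 where x0: "x0 \<in> sphere 0 1" "M = veronese x0" by blast
  let ?T = "{M \<in> veronese ` sphere 0 1. M *v x0 \<noteq> 0}"
  let ?u = "\<lambda>s. {x \<in> sphere 0 1. s * (x \<bullet> x0) > (0::real)}"
  let ?v = "{?u 1, ?u (-1)}"
  have "openin (top_of_set (veronese ` sphere 0 1))
      ((veronese ` sphere 0 1) \<inter> (\<lambda>M. M *v x0) -` (- {0}))"
    by (intro continuous_openin_preimage_gen continuous_intros open_Compl closed_singleton)
  moreover have "(veronese ` sphere 0 1) \<inter> (\<lambda>M. M *v x0) -` (- {0}) = ?T" by blast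
  ultimately have T: "openin (top_of_set (veronese ` sphere 0 1)) ?T" by simp
  have u: "openin (top_of_set (sphere 0 1)) (?u s)" for s
  proof -
    have "openin (top_of_set (sphere 0 1)) (sphere 0 1 \<inter> (\<lambda>x. s * (x \<bullet> x0)) -` {0<..})"
      by (intro continuous_openin_preimage_gen continuous_intros open_greaterThan)
    moreover have "sphere 0 1 \<inter> (\<lambda>x. s * (x \<bullet> x0)) -` {0<..} = ?u s" by auto
    ultimately show ?thesis by simp
  qed
  have "M \<in> ?T" using x0 by (auto simp: veronese_apply)
  moreover have "\<Union>?v = sphere 0 1 \<inter> veronese -` ?T"
    using x0 by (auto simp: veronese_apply)
  moreover have "\<exists>q. homeomorphism u ?T veronese q" if "u \<in> ?v" for u
    using that homeomorphism_veronese_half[of x0 1] homeomorphism_veronese_half[of x0 "-1"] x0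
    by auto
  moreover have "pairwise disjnt ?v"
    by (auto simp: pairwise_def disjnt_def)
  ultimately show "\<exists>T. M \<in> T \<and> openin (top_of_set (veronese ` sphere 0 1)) T \<and>
      (\<exists>v. \<Union>v = sphere 0 1 \<inter> veronese -` T \<and> (\<forall>u\<in>v. openin (top_of_set (sphere 0 1)) u) \<and>
        pairwise disjnt v \<and> (\<forall>u\<in>v. \<exists>q. homeomorphism u T veronese q))"
    using T u by (intro exI[of _ ?T] conjI exI[of _ ?v]) blast+
qed (auto intro: continuous_on_veronese)

definition embed :: "(real^4) set \<Rightarrow> real^4^4" where "embed s = veronese (SOME x. x \<in> s)"

lemma embed_antipodal_pair [simp]: "embed (antipodal_pair x) = veronese x"
proof -
  have "(SOME y. y \<in> {x, - x}) \<in> {x, - x}" by (rule someI[of _ x]) simp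
  then show ?thesis by (auto simp: embed_def antipodal_pair_def)
qed

lemma continuous_map_embed: "continuous_map RP3 euclidean embed"
  by (rule continuous_compose_quotient_map[OF quotient_map_antipodal_pair])
    (simp add: continuous_on_veronese o_def)

lemma lift_to_sphere:
  fixes f :: "'a::real_normed_vector \<Rightarrow> (real^4) set"
  assumes "simply_connected U" "locally path_connected U"
    and c: "continuous_on U (\<lambda>x. embed (f x))" and f: "\<And>x. x \<in> U \<Longrightarrow> f x \<in> topspace RP3"
  obtains g where "continuous_on U g" "\<And>x. x \<in> U \<Longrightarrow> g x \<in> sphere 0 1"
    "\<And>x. x \<in> U \<Longrightarrow> antipodal_pair (g x) = f x"
proof -
  have "(\<lambda>x. embed (f x)) \<in> U \<rightarrow> veronese ` sphere 0 1"
    using f by (force simp: topspace_projective_space)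
  then obtain g where g: "continuous_on U g" "g \<in> U \<rightarrow> sphere 0 1" "\<And>x. x \<in> U \<Longrightarrow> veronese (g x) = embed (f x)"
    using covering_space_lift[OF covering_space_veronese assms(1,2) c] by blast
  show thesis
  proof
    fix x assume x: "x \<in> U"
    then obtain y where y: "y \<in> sphere 0 1" "f x = antipodal_pair y"
      using f[OF x] unfolding topspace_projective_space by blast
    then show "antipodal_pair (g x) = f x"
      using g(2) g(3)[OF x] x veronese_eqD[of "g x" y] by (force simp: antipodal_pair_eq_iff)
  qed (use g in auto)
qed

text \<open>The inner product of the two lifts is continuous with values in \<open>{1, -1}\<close>,
  hence constant on a connected set.\<close>

lemma lifts_agree_up_to_sign:
  fixes g h :: "'a::topological_space \<Rightarrow> real^4"
  assumes "connected U" "continuous_on U g" "continuous_on U h"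
    and s: "\<And>x. x \<in> U \<Longrightarrow> g x \<in> sphere 0 1" and "\<And>x. x \<in> U \<Longrightarrow> antipodal_pair (g x) = antipodal_pair (h x)"
  shows "(\<forall>x\<in>U. g x = h x) \<or> (\<forall>x\<in>U. g x = - h x)"
proof -
  have gh: "g x = h x \<or> g x = - h x" if "x \<in> U" for x
    using assms(5)[OF that] by (simp add: antipodal_pair_eq_iff)
  have h1: "norm (h x) = 1" "norm (g x) = 1" if "x \<in> U" for x
    using gh[OF that] s[OF that] by auto
  have sub: "(\<lambda>x. g x \<bullet> h x) ` U \<subseteq> {1, -1}"
    using gh h1 by (force simp: dot_square_norm)
  have "(\<lambda>x. g x \<bullet> h x) constant_on U"
    using continuous_finite_range_constant[OF assms(1), of "\<lambda>x. g x \<bullet> h x"]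
      finite_subset[OF sub] assms by (auto intro: continuous_intros)
  then obtain c where c: "\<And>x. x \<in> U \<Longrightarrow> g x \<bullet> h x = c" unfolding constant_on_def by blast
  show ?thesis
  proof (cases "c = 1")
    case True
    then have "g x = h x" if "x \<in> U" for x
      using gh[OF that] c[OF that] h1[OF that] by (auto simp: dot_square_norm)
    then show ?thesis by blast
  next
    case False
    then have "g x = - h x" if "x \<in> U" for x
      using gh[OF that] c[OF that] h1[OF that] by (auto simp: dot_square_norm)
    then show ?thesis by blast
  qed
qed

lemma connected_S3: "connected (sphere (0::real^4) 1)"
  and simply_connected_S3: "simply_connected (sphere (0::real^4) 1)"
  by (simp_all add: connected_sphere simply_connected_sphere)

lemma locally_path_connected_S3: "locally path_connected (sphere (0::real^4) 1)"
  by (simp add: locally_path_connected_sphere)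

section \<open>Lifting smooth maps and diffeomorphisms\<close>

lemma smooth_to_RP3_imp_continuous:
  assumes "smooth_to_RP3 A f"
  shows "continuous_on A (\<lambda>x. embed (f x))"
  unfolding continuous_on_eq_continuous_within
proof
  fix p assume p: "p \<in> A"
  then obtain U g where U: "open U" "p \<in> U" "smooth_on U g" and
    g: "\<forall>x\<in>A \<inter> U. g x \<in> sphere 0 1 \<and> antipodal_pair (g x) = f x"
    using assms unfolding smooth_to_RP3_def by meson
  have "continuous_on U g" using U(3) unfolding smooth_on_def by (metis Ck_on.simps(1))
  then have "continuous_on U (\<lambda>x. veronese (g x))"
    by (rule continuous_on_compose2[OF continuous_on_veronese[of UNIV]]) auto
  then have "continuous (at p) (\<lambda>x. veronese (g x))"
    using U by (simp add: continuous_on_eq_continuous_at)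
  then have c: "continuous (at p within A) (\<lambda>x. veronese (g x))"
    by (rule continuous_at_imp_continuous_at_within)
  from U obtain d where d: "d > 0" "ball p d \<subseteq> U" using open_contains_ball by blast
  show "continuous (at p within A) (\<lambda>x. embed (f x))"
  proof (rule continuous_transform_within[OF c d(1) p])
    fix x assume "x \<in> A" "dist x p < d"
    then have "x \<in> A \<inter> U" using d by (auto simp: dist_commute subset_eq)
    then show "veronese (g x) = embed (f x)" using g by (metis embed_antipodal_pair)
  qed
qed

text \<open>A local smooth lift provided by \<open>smooth_to_RP3\<close> may differ in sign from the
  global continuous lift \<open>\<psi>\<close>. The sign is corrected at \<open>p\<close>, and the
  neighbourhood is shrunk to where the inner product of the two stays positive.\<close>

lemma smooth_to_RP3_lift:
  assumes f: "smooth_to_RP3 (sphere 0 1) f" and g: "continuous_on (sphere 0 1) \<psi>"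
    "\<And>x. x \<in> sphere 0 1 \<Longrightarrow> \<psi> x \<in> sphere 0 1" "\<And>x. x \<in> sphere 0 1 \<Longrightarrow> antipodal_pair (\<psi> x) = f x"
    and p: "p \<in> sphere 0 (1::real)"
  obtains U g where "open U" "p \<in> U" "smooth_on U g" "\<And>x. x \<in> sphere 0 1 \<inter> U \<Longrightarrow> g x = \<psi> x"
proof -
  obtain U g where U: "open U" "p \<in> U" "smooth_on U g" and
    gU: "\<forall>x\<in>sphere 0 1 \<inter> U. g x \<in> sphere 0 1 \<and> antipodal_pair (g x) = f x"
    using f p unfolding smooth_to_RP3_def by meson
  define e :: real where "e = (if g p = \<psi> p then 1 else -1)"
  define h where "h x = e *\<^sub>R g x" for x
  have e: "e = 1 \<or> e = -1" by (simp add: e_def)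
  have "antipodal_pair (g p) = antipodal_pair (\<psi> p)" using gU U p g by auto
  then have hp: "h p = \<psi> p" by (auto simp: h_def e_def antipodal_pair_eq_iff)
  have hU: "h x \<in> sphere 0 1" "antipodal_pair (h x) = antipodal_pair (\<psi> x)" if "x \<in> sphere 0 1 \<inter> U" for x
  proof -
    have "antipodal_pair (h x) = antipodal_pair (g x)" using e by (auto simp: h_def)
    moreover have "norm (h x) = norm (g x)" using e by (auto simp: h_def)
    ultimately show "h x \<in> sphere 0 1" "antipodal_pair (h x) = antipodal_pair (\<psi> x)"
      using gU g that by auto
  qed
  have sh: "smooth_on U h" unfolding smooth_on_def h_def
    using U Ck_on_linear_compose[OF U(1) bounded_linear_scaleR_right] by (auto simp: smooth_on_def)
  then have ch: "continuous_on U h" unfolding smooth_on_def by (metis Ck_on.simps(1))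
  have "continuous_on (sphere 0 1 \<inter> U) (\<lambda>x. h x \<bullet> \<psi> x)"
    by (intro continuous_intros continuous_on_subset[OF ch] continuous_on_subset[OF g(1)]) auto
  then have "openin (top_of_set (sphere 0 1 \<inter> U)) ((sphere 0 1 \<inter> U) \<inter> (\<lambda>x. h x \<bullet> \<psi> x) -` {0<..})"
    by (intro continuous_openin_preimage_gen) auto
  then obtain W where W: "open W" "(sphere 0 1 \<inter> U) \<inter> (\<lambda>x. h x \<bullet> \<psi> x) -` {0<..} = (sphere 0 1 \<inter> U) \<inter> W"
    by (meson openin_open)
  show thesis
  proof
    show "open (U \<inter> W)" using U W by auto
    have "h p \<bullet> \<psi> p > 0" using hp g(2)[OF p] by (simp add: dot_square_norm)
    then have "p \<in> (sphere 0 1 \<inter> U) \<inter> (\<lambda>x. h x \<bullet> \<psi> x) -` {0<..}" using U p by simp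
    then show "p \<in> U \<inter> W" unfolding W(2) by blast
    show "smooth_on (U \<inter> W) h" using sh smooth_on_subset by blast
    fix x assume x: "x \<in> sphere 0 1 \<inter> (U \<inter> W)"
    then have "x \<in> (sphere 0 1 \<inter> U) \<inter> W" by blast
    then have "h x \<bullet> \<psi> x > 0" unfolding W(2)[symmetric] by simp
    moreover have "h x = \<psi> x \<or> h x = - \<psi> x" using hU x by (auto simp: antipodal_pair_eq_iff)
    moreover have "\<not> (- \<psi> x) \<bullet> \<psi> x > 0"
      using inner_ge_zero[of "\<psi> x"] by (simp only: inner_minus_left)
    ultimately show "h x = \<psi> x" by fastforce
  qed
qed

lemma lift_diffeo_RP3:
  assumes "diffeo_RP3 F"
  obtains \<Psi> \<Psi>' where "homeomorphism (sphere 0 1) (sphere 0 1) \<Psi> \<Psi>'"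
    "\<And>x. x \<in> sphere 0 1 \<Longrightarrow> antipodal_pair (\<Psi> x) = F (antipodal_pair x)"
    "\<And>x. x \<in> sphere 0 1 \<Longrightarrow> \<Psi> (- x) = - \<Psi> x"
    "\<And>x. x \<in> sphere 0 1 \<Longrightarrow> \<Psi>' (- x) = - \<Psi>' x"
    "\<And>p. p \<in> sphere 0 1 \<Longrightarrow> \<exists>U g. open U \<and> p \<in> U \<and> smooth_on U g \<and> (\<forall>x\<in>sphere 0 1 \<inter> U. g x = \<Psi> x)"
    "\<And>p. p \<in> sphere 0 1 \<Longrightarrow> \<exists>U g. open U \<and> p \<in> U \<and> smooth_on U g \<and> (\<forall>x\<in>sphere 0 1 \<inter> U. g x = \<Psi>' x)"
proof -
  let ?S = "sphere (0::real^4) 1"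
  let ?G = "inv_into (topspace RP3) F"
  have bij: "bij_betw F (topspace RP3) (topspace RP3)"
    and sF: "smooth_to_RP3 ?S (F \<circ> antipodal_pair)" and sG: "smooth_to_RP3 ?S (?G \<circ> antipodal_pair)"
    using assms by (auto simp: diffeo_RP3_def)
  have bijG: "bij_betw ?G (topspace RP3) (topspace RP3)" using bij bij_betw_inv_into by blast
  obtain f where f: "continuous_on ?S f" "\<And>x. x \<in> ?S \<Longrightarrow> f x \<in> ?S"
    "\<And>x. x \<in> ?S \<Longrightarrow> antipodal_pair (f x) = F (antipodal_pair x)"
    using lift_to_sphere[OF simply_connected_S3 locally_path_connected_S3 smooth_to_RP3_imp_continuous[OF sF]]
      bij_betwE[OF bij] by (metis antipodal_pair_in_RP3 comp_apply)
  obtain g0 where g0: "continuous_on ?S g0" "\<And>x. x \<in> ?S \<Longrightarrow> g0 x \<in> ?S"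
    "\<And>x. x \<in> ?S \<Longrightarrow> antipodal_pair (g0 x) = ?G (antipodal_pair x)"
    using lift_to_sphere[OF simply_connected_S3 locally_path_connected_S3 smooth_to_RP3_imp_continuous[OF sG]]
      bij_betwE[OF bijG] by (metis antipodal_pair_in_RP3 comp_apply)
  have GF: "?G (F p) = p" "F (?G p) = p" if "p \<in> topspace RP3" for p
    using that bij by (auto simp: bij_betw_def f_inv_into_f)
  have "(\<forall>x\<in>?S. g0 (f x) = x) \<or> (\<forall>x\<in>?S. g0 (f x) = - x)"
  proof (rule lifts_agree_up_to_sign[OF connected_S3])
    show "continuous_on ?S (\<lambda>x. g0 (f x))"
      using continuous_on_compose2[OF g0(1) f(1)] f(2) by blast
    show "antipodal_pair (g0 (f x)) = antipodal_pair x" if "x \<in> ?S" for x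
      using g0(3)[OF f(2)[OF that]] f(3)[OF that] GF that by simp
  qed (use f g0 in auto)
  \<comment> \<open>The lift of the inverse is determined up to a global sign; absorbing
    \<open>e\<close> makes \<open>g\<close> a left inverse of \<open>f\<close>.\<close>
  then obtain e :: real where e: "e = 1 \<or> e = -1" "\<And>x. x \<in> ?S \<Longrightarrow> g0 (f x) = e *\<^sub>R x"
    by (metis scaleR_minus1_left scaleR_one)
  define g where "g x = e *\<^sub>R g0 x" for x
  have g: "continuous_on ?S g" "\<And>x. x \<in> ?S \<Longrightarrow> g x \<in> ?S"
    "\<And>x. x \<in> ?S \<Longrightarrow> antipodal_pair (g x) = ?G (antipodal_pair x)"
    using g0 e(1) by (auto simp: g_def intro!: continuous_intros)
  have gf: "g (f x) = x" if "x \<in> ?S" for x using e(1) e(2)[OF that] by (auto simp: g_def)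
  \<comment> \<open>The minus sign is excluded at a point of the form \<open>f x\<close>, where
    \<open>g (f x) = x\<close>.\<close>
  have "(\<forall>x\<in>?S. f (g x) = x) \<or> (\<forall>x\<in>?S. f (g x) = - x)"
  proof (rule lifts_agree_up_to_sign[OF connected_S3])
    show "continuous_on ?S (\<lambda>x. f (g x))"
      using continuous_on_compose2[OF f(1) g(1)] g(2) by blast
    show "antipodal_pair (f (g x)) = antipodal_pair x" if "x \<in> ?S" for x
      using f(3)[OF g(2)[OF that]] g(3)[OF that] GF that by simp
  qed (use f g in auto)
  moreover have ne: "x \<noteq> - x" if "x \<in> ?S" for x using sphere_neq_minus[OF that] .
  moreover have "f (g (f x)) = f x" if "x \<in> ?S" for x using gf that by simp
  moreover have "axis 1 1 \<in> ?S" by simp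
  ultimately have "\<forall>x\<in>?S. f (g x) = x"
    using f(2) by metis
  then have fg: "f (g x) = x" if "x \<in> ?S" for x using that by blast
  have hom: "homeomorphism ?S ?S f g"
    using f(2) g(2) fg gf by (intro homeomorphismI f(1) g(1)) blast+
  have mS: "- x \<in> ?S" if "x \<in> ?S" for x using that by simp
  \<comment> \<open>The values at \<open>x\<close> and \<open>- x\<close> lie over the same point of
    projective space, and injectivity forbids that they are equal.\<close>
  have odd: "h (- x) = - h x" if "x \<in> ?S" "inj_on h ?S" "\<And>x. x \<in> ?S \<Longrightarrow> antipodal_pair (h x) = H (antipodal_pair x)" for h x and H :: "(real^4) set \<Rightarrow> (real^4) set"
  proof -
    have "antipodal_pair (h (- x)) = antipodal_pair (h x)" using that mS by simp
    moreover have "h (- x) \<noteq> h x" using inj_onD[OF that(2), of "- x" x] that(1) mS ne by metis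
    ultimately show ?thesis by (simp add: antipodal_pair_eq_iff)
  qed
  have inj: "inj_on f ?S" "inj_on g ?S" using gf fg by (metis inj_onI)+
  show thesis
  proof
    show "homeomorphism ?S ?S f g" by (rule hom)
    show "antipodal_pair (f x) = F (antipodal_pair x)" if "x \<in> ?S" for x using f that by blast
    show "f (- x) = - f x" if "x \<in> ?S" for x using odd[OF that inj(1)] f by blast
    show "g (- x) = - g x" if "x \<in> ?S" for x using odd[OF that inj(2)] g by blast
    show "\<exists>U h. open U \<and> p \<in> U \<and> smooth_on U h \<and> (\<forall>x\<in>sphere 0 1 \<inter> U. h x = f x)" if "p \<in> ?S" for p
      using smooth_to_RP3_lift[OF sF f(1,2) _ that] f(3) by (metis comp_apply)
    show "\<exists>U h. open U \<and> p \<in> U \<and> smooth_on U h \<and> (\<forall>x\<in>sphere 0 1 \<inter> U. h x = g x)" if "p \<in> ?S" for p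
      using smooth_to_RP3_lift[OF sG g(1,2) _ that] g(3) by (metis comp_apply)
  qed
qed


subsection \<open>The knots\<close>

lemma ambient_isotopic_refl: "A \<subseteq> topspace RP3 \<Longrightarrow> ambient_isotopic A A"
proof -
  have s: "smooth_on UNIV (f :: 'a::euclidean_space \<Rightarrow> 'b::euclidean_space)" if "bounded_linear f" for f
    using Ck_on_bounded_linear[OF open_UNIV that] by (simp add: smooth_on_def)
  have id: "smooth_to_RP3 (sphere 0 1) antipodal_pair"
    unfolding smooth_to_RP3_def using s[OF bounded_linear_ident] by (intro ballI exI[of _ UNIV] exI[of _ "\<lambda>x. x"]) auto
  have inv: "inv_into (topspace RP3) (\<lambda>p. p) (antipodal_pair x) = antipodal_pair x" if "x \<in> sphere 0 1" for x
    using inv_into_f_f[of "\<lambda>p. p" "topspace RP3" "antipodal_pair x"] that by simp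
  have "smooth_to_RP3 (sphere 0 1) (inv_into (topspace RP3) (\<lambda>p. p) \<circ> antipodal_pair)"
    unfolding smooth_to_RP3_def using s[OF bounded_linear_ident] inv
    by (intro ballI exI[of _ UNIV] exI[of _ "\<lambda>x. x"]) auto
  then have d: "diffeo_RP3 (\<lambda>p. p)"
    unfolding diffeo_RP3_def using id by (auto simp: o_def bij_betw_def)
  have "smooth_to_RP3 ({0..1::real} \<times> sphere 0 1) (\<lambda>(t, x). antipodal_pair x)"
    unfolding smooth_to_RP3_def using s[OF bounded_linear_snd]
    by (intro ballI exI[of _ UNIV] exI[of _ snd]) auto
  then show ?thesis
    unfolding ambient_isotopic_def using d by (intro exI[of _ "\<lambda>t p. p"]) auto
qed

lemma knot_image_subset: "knot f \<Longrightarrow> knot_image f \<subseteq> topspace RP3"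
proof
  fix p assume "knot f" "p \<in> knot_image f"
  then obtain z g where "p = f z" "z \<in> sphere 0 1" and g: "\<forall>t. g t \<in> sphere 0 1 \<and> antipodal_pair (g t) = f (cis t)"
    unfolding knot_def by blast
  then have "f z = antipodal_pair (g (Arg z))"
    by (metis cis_Arg sgn_eq complex_norm_eq_1_exp dist_0_norm div_by_1 mem_sphere norm_zero of_real_1 zero_neq_one)
  then show "p \<in> topspace RP3" using g \<open>p = f z\<close> by (metis antipodal_pair_in_RP3)
qed

lemma unit_circle_iff: "z \<in> sphere 0 1 \<longleftrightarrow> (\<exists>t. z = cis t)"
proof
  assume "z \<in> sphere 0 1"
  then have "z = cis (Arg z)" by (subst cis_Arg) (auto simp: sgn_eq)
  then show "\<exists>t. z = cis t" ..
qed auto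

text \<open>The difference takes values in the integer multiples of 2 pi i, which are at least 2 pi
  apart, so by continuity it is constant. This makes the gain of a logarithm along a path
  independent of the logarithm chosen.\<close>

lemma logs_differ_by_constant:
  fixes f g :: "'a::topological_space \<Rightarrow> complex"
  assumes U: "connected U" and f: "continuous_on U f" and g: "continuous_on U g"
    and e: "\<And>x. x \<in> U \<Longrightarrow> exp (f x) = exp (g x)"
  shows "\<exists>k::int. \<forall>x\<in>U. f x = g x + 2 * of_int k * of_real pi * \<i>"
proof (cases "U = {}")
  case False
  then obtain u where u: "u \<in> U" by blast
  have ex: "\<exists>k::int. f x - g x = 2 * of_int k * of_real pi * \<i>" if "x \<in> U" for x
    using e[OF that] by (auto simp: exp_eq)
  have "(\<lambda>x. f x - g x) constant_on U"
  proof (rule continuous_discrete_range_constant[OF U])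
    show "continuous_on U (\<lambda>x. f x - g x)" by (intro continuous_intros f g)
    fix x assume x: "x \<in> U"
    show "\<exists>e>0. \<forall>y. y \<in> U \<and> f y - g y \<noteq> f x - g x \<longrightarrow> e \<le> norm (f y - g y - (f x - g x))"
    proof (intro exI[of _ "2 * pi"] conjI allI impI)
      fix y assume y: "y \<in> U \<and> f y - g y \<noteq> f x - g x"
      obtain k l :: int where kl: "f x - g x = 2 * of_int k * of_real pi * \<i>" "f y - g y = 2 * of_int l * of_real pi * \<i>"
        using ex x y by meson
      then have "k \<noteq> l" using y by auto
      have "f y - g y - (f x - g x) = of_real (2 * pi * of_int (l - k)) * \<i>"
        unfolding kl by (simp add: algebra_simps)
      then have "norm (f y - g y - (f x - g x)) = 2 * pi * \<bar>real_of_int (l - k)\<bar>"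
        by (simp only: norm_mult norm_of_real) (simp add: abs_mult)
      moreover have "\<bar>real_of_int (l - k)\<bar> \<ge> 1" using \<open>k \<noteq> l\<close> by linarith
      ultimately show "2 * pi \<le> norm (f y - g y - (f x - g x))"
        using mult_left_mono[of 1 "\<bar>real_of_int (l - k)\<bar>" "2 * pi"] by simp
    qed simp
  qed
  then obtain c where c: "\<And>x. x \<in> U \<Longrightarrow> f x - g x = c" unfolding constant_on_def by blast
  obtain k :: int where "f u - g u = 2 * of_int k * of_real pi * \<i>" using ex u by blast
  then have "f x = g x + 2 * of_int k * of_real pi * \<i>" if "x \<in> U" for x
    using c[OF that] c[OF u] by (simp add: algebra_simps)
  then show ?thesis by blast
qed auto

text \<open>The equation for \<open>a\<close> says that \<open>(z, z ^ (2 * n))\<close> with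
  \<open>\<bar>z\<bar> = a\<close> lies on the unit sphere.\<close>

locale torus_knot =
  fixes n :: nat and a :: real
  assumes n: "n \<ge> 1" and a: "a > 0" "a\<^sup>2 + (a ^ (2 * n))\<^sup>2 = 1"
begin

definition curve :: "complex \<Rightarrow> real^4" where
  "curve c = mk (of_real a * c) ((of_real a * c) ^ (2 * n))"

definition defect :: "real^4 \<Rightarrow> complex" where
  "defect x = wc x - zc x ^ (2 * n)"

definition tknot :: "complex \<Rightarrow> (real^4) set" where
  "tknot c = antipodal_pair (curve c)"

lemma curve_in_sphere [simp]: "cmod c = 1 \<Longrightarrow> curve c \<in> sphere 0 1"
  unfolding sphere_C2_iff using a by (simp add: curve_def norm_mult norm_power)

lemma norm_curve [simp]: "cmod c = 1 \<Longrightarrow> norm (curve c) = 1"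
  using curve_in_sphere[of c] by simp

lemma defect_curve [simp]: "defect (curve c) = 0"
  by (simp add: defect_def curve_def)

lemma defect_minus_curve: "defect (- curve c) = - 2 * (of_real a * c) ^ (2 * n)"
  by (simp add: defect_def curve_def)

lemma continuous_on_curve [continuous_intros]:
  "continuous_on S f \<Longrightarrow> continuous_on S (\<lambda>x. curve (f x))"
  unfolding curve_def by (intro continuous_intros)

lemma continuous_on_defect [continuous_intros]:
  "continuous_on S f \<Longrightarrow> continuous_on S (\<lambda>x. defect (f x))"
  unfolding defect_def by (intro continuous_intros)

text \<open>On the sphere one of \<open>\<bar>z\<bar>\<close>, \<open>\<bar>w\<bar>\<close> decreases when the other increases, so the two errors
  below have the same sign and add up.\<close>

lemma defect_estimate:
  assumes "x \<in> sphere 0 1"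
  shows "\<bar>cmod (zc x) ^ (2 * n) - a ^ (2 * n)\<bar> + \<bar>a ^ (2 * n) - cmod (wc x)\<bar> \<le> cmod (defect x)"
proof -
  let ?z = "cmod (zc x)" and ?w = "cmod (wc x)" and ?b = "a ^ (2 * n)"
  have s: "?z\<^sup>2 + ?w\<^sup>2 = a\<^sup>2 + ?b\<^sup>2" using assms a by (simp only: sphere_C2_iff)
  have b: "?b > 0" using a by simp
  have d: "\<bar>?w - ?z ^ (2 * n)\<bar> \<le> cmod (defect x)"
    unfolding defect_def by (metis norm_power norm_triangle_ineq3)
  show ?thesis
  proof (cases "a \<le> ?z")
    case True
    then have "?b \<le> ?z ^ (2 * n)" "a\<^sup>2 \<le> ?z\<^sup>2" using a by (intro power_mono; simp)+
    then have "?w\<^sup>2 \<le> ?b\<^sup>2" using s by linarith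
    then have "?w \<le> ?b" using b by (simp add: power2_le_iff_abs_le)
    then show ?thesis using d \<open>?b \<le> ?z ^ (2 * n)\<close> by linarith
  next
    case False
    then have "?z ^ (2 * n) \<le> ?b" "?z\<^sup>2 \<le> a\<^sup>2" by (intro power_mono; simp)+
    then have "?b\<^sup>2 \<le> ?w\<^sup>2" using s by linarith
    then have "?b \<le> ?w" by (rule power2_le_imp_le) simp
    then show ?thesis using d \<open>?z ^ (2 * n) \<le> ?b\<close> by linarith
  qed
qed

text \<open>By \<open>defect_estimate\<close> a zero of \<open>defect\<close> has
  \<open>\<bar>z\<bar> = a\<close>, so the parameter on the curve is \<open>z / a\<close>.\<close>

lemma defect_eq_0_iff:
  assumes "x \<in> sphere 0 1"
  shows "defect x = 0 \<longleftrightarrow> (\<exists>c. cmod c = 1 \<and> x = curve c)"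
proof
  assume d: "defect x = 0"
  then have "cmod (zc x) ^ (2 * n) = a ^ (2 * n)" using defect_estimate[OF assms] by auto
  then have z: "cmod (zc x) = a" using a n by (subst (asm) power_eq_iff_eq_base) auto
  define c where "c = zc x / of_real a"
  have "zc x = of_real a * c" "cmod c = 1" using z a by (auto simp: c_def norm_divide)
  moreover have "wc x = zc x ^ (2 * n)" using d by (simp add: defect_def)
  ultimately show "\<exists>c. cmod c = 1 \<and> x = curve c"
    unfolding curve_def by (metis mk_zc_wc)
qed auto

lemma defect_minus_curve_ne_0: "cmod c = 1 \<Longrightarrow> defect (- curve c) \<noteq> 0"
  using a n by (auto simp: defect_minus_curve)

lemma curve_eq_iff: "curve c = curve d \<longleftrightarrow> c = d"
  using a by (auto simp: curve_def)

lemma curve_neq_minus: "cmod c = 1 \<Longrightarrow> curve d \<noteq> - curve c"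
  using defect_minus_curve_ne_0 defect_curve by metis

lemma tknot_eq_iff: "cmod c = 1 \<Longrightarrow> tknot c = tknot d \<longleftrightarrow> c = d"
  using curve_neq_minus[of c d] by (auto simp: tknot_def antipodal_pair_eq_iff curve_eq_iff)

text \<open>A sum of two trigonometric curves, of frequencies 1 and \<open>2 * n\<close>, which is
  the form treated by \<open>Ck_on_cos_sin\<close>.\<close>

lemma curve_cis:
  "curve (cis t) = (cos (1 * t) *\<^sub>R mk (of_real a) 0 + sin (1 * t) *\<^sub>R mk (of_real a * \<i>) 0) +
     (cos (real (2 * n) * t) *\<^sub>R mk 0 (of_real (a ^ (2 * n))) +
      sin (real (2 * n) * t) *\<^sub>R mk 0 (of_real (a ^ (2 * n)) * \<i>))"
proof -
  have "(complex_of_real a * cis t) ^ (2 * n) = of_real (a ^ (2 * n)) * cis (real (2 * n) * t)"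
    by (simp only: power_mult_distrib Complex.DeMoivre of_real_power)
  then show ?thesis
    by (simp add: curve_def mk_scaleR mk_add complex_eq_iff)
qed

lemma knot_tknot: "knot tknot"
  unfolding knot_def
proof (intro conjI exI[of _ "\<lambda>t. curve (cis t)"] allI)
  show "inj_on tknot (sphere 0 1)"
    by (rule inj_onI) (simp add: tknot_eq_iff)
  show "smooth_on UNIV (\<lambda>t. curve (cis t))"
    unfolding smooth_on_def curve_cis by (intro allI Ck_on_add Ck_on_cos_sin open_UNIV)
  fix t
  show "curve (cis t) \<in> sphere 0 1" by simp
  show "antipodal_pair (curve (cis t)) = tknot (cis t)" by (simp add: tknot_def)
  \<comment> \<open>The first complex coordinate of the velocity has modulus \<open>a\<close>, so it
    alone shows that the velocity is nonzero.\<close>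
  obtain D where D: "((\<lambda>t. curve (cis t)) has_vector_derivative D) (at t)"
    and zD: "zc D = of_real a * (\<i> * cis t)"
  proof
    let ?A = "mk (of_real a) 0" and ?B = "mk (of_real a * \<i>) 0"
    let ?C = "mk 0 (of_real (a ^ (2 * n)))" and ?E = "mk 0 (of_real (a ^ (2 * n)) * \<i>)"
    let ?m = "real (2 * n)"
    show "((\<lambda>t. curve (cis t)) has_vector_derivative
      ((- sin t *\<^sub>R ?A + cos t *\<^sub>R ?B) + ((- ?m * sin (?m * t)) *\<^sub>R ?C + (?m * cos (?m * t)) *\<^sub>R ?E))) (at t)"
      unfolding curve_cis has_vector_derivative_def
      by (auto intro!: derivative_eq_intros simp: fun_eq_iff algebra_simps)
    show "zc ((- sin t *\<^sub>R ?A + cos t *\<^sub>R ?B) + ((- ?m * sin (?m * t)) *\<^sub>R ?C + (?m * cos (?m * t)) *\<^sub>R ?E))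
      = of_real a * (\<i> * cis t)"
      by (simp only: mk_scaleR mk_add zc_mk) (simp add: complex_eq_iff)
  qed
  have "D \<noteq> 0"
  proof
    assume "D = 0"
    then have "zc D = 0" by (simp add: zc_def complex_eq_iff)
    then show False using zD a by simp
  qed
  then show "vector_derivative (\<lambda>t. curve (cis t)) (at t) \<noteq> 0"
    using vector_derivative_at[OF D] by simp
qed

text \<open>The lift \<open>curve\<close> is a closed loop in the simply connected sphere, and its
  null homotopy is projected down.\<close>

lemma class_0_tknot: "class_0 tknot"
proof -
  define p where "p = (\<lambda>t. curve (cis (2 * pi * t)))"
  have "path p" unfolding path_def p_def
    by (intro continuous_intros)
  moreover have "path_image p \<subseteq> sphere 0 1" by (auto simp: path_image_def p_def)
  moreover have p01: "pathstart p = curve 1" "pathfinish p = curve 1"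
    by (auto simp: pathstart_def pathfinish_def p_def)
  ultimately have "homotopic_paths (sphere 0 1) p (linepath (curve 1) (curve 1))"
    using simply_connected_S3 unfolding simply_connected_eq_contractible_path by metis
  then have "homotopic_with (\<lambda>q. q 0 = tknot 1 \<and> q 1 = tknot 1) (top_of_set {0..1}) RP3
      (antipodal_pair \<circ> p) (antipodal_pair \<circ> linepath (curve 1) (curve 1))"
    unfolding homotopic_paths_def
    by (rule homotopic_with_compose_continuous_map_left[OF _ continuous_map_antipodal_pair])
      (use p01 in \<open>auto simp: tknot_def pathstart_def pathfinish_def\<close>)
  moreover have "antipodal_pair \<circ> linepath (curve 1) (curve 1) = (\<lambda>t. tknot 1)"
    by (auto simp: tknot_def linepath_refl)
  moreover have "antipodal_pair \<circ> p = (\<lambda>t. tknot (cis (2 * pi * t)))"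
    by (auto simp: tknot_def p_def)
  ultimately show ?thesis by (simp add: class_0_def)
qed

text \<open>For \<open>j = 1\<close> the gain is \<open>2 \<pi> \<i>\<close> times the linking number \<open>2 * n\<close> of the two lifts of the knot.\<close>

lemma log_defect_minus_curve:
  assumes L: "continuous_on {0..2 * pi} L" and eL: "\<And>t. t \<in> {0..2 * pi} \<Longrightarrow> exp (L t) = defect (- curve (cis t)) ^ j"
  shows "L (2 * pi) - L 0 = 2 * of_nat (2 * n * j) * of_real pi * \<i>"
proof -
  define c where "c = ((- 2) * of_real a ^ (2 * n) :: complex) ^ j"
  have "c \<noteq> 0" using a by (simp add: c_def)
  have e: "exp (L t) = c * exp (of_nat (2 * n * j) * of_real t * \<i>)" if "t \<in> {0..2 * pi}" for t
  proof -
    have "exp (L t) = c * (cis t ^ (2 * n)) ^ j"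
      using eL[OF that] by (simp only: defect_minus_curve c_def power_mult_distrib mult.assoc)
    also have "(cis t ^ (2 * n)) ^ j = exp (of_nat (2 * n * j) * (of_real t * \<i>))"
      by (simp add: cis_conv_exp power_mult[symmetric] ac_simps exp_of_nat_mult[symmetric])
    finally show ?thesis by (simp add: mult.assoc)
  qed
  then have e': "exp (L t) = exp (Ln c + of_nat (2 * n * j) * of_real t * \<i>)" if "t \<in> {0..2 * pi}" for t
    using that \<open>c \<noteq> 0\<close> by (simp add: exp_add)
  have "continuous_on {0..2 * pi} (\<lambda>t. Ln c + of_nat (2 * n * j) * of_real t * \<i>)"
    by (intro continuous_intros)
  from logs_differ_by_constant[OF connected_Icc L this e']
  obtain k :: int where k: "\<And>t. t \<in> {0..2 * pi} \<Longrightarrow>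
      L t = Ln c + of_nat (2 * n * j) * of_real t * \<i> + 2 * of_int k * of_real pi * \<i>"
    by blast
  then show ?thesis using k[of 0] k[of "2 * pi"] by simp
qed

end

lemma torus_knot_exists:
  assumes "n \<ge> 1"
  obtains a where "torus_knot n a"
proof -
  have "\<exists>x\<ge>0. x \<le> 1 \<and> x\<^sup>2 + (x ^ (2 * n))\<^sup>2 = (1::real)"
    by (rule IVT') (use assms in \<open>auto intro!: continuous_intros simp: power_0_left\<close>)
  then obtain x :: real where x: "x \<ge> 0" "x\<^sup>2 + (x ^ (2 * n))\<^sup>2 = 1" by blast
  then have "x \<noteq> 0" using assms by (auto simp: power_0_left)
  then show thesis using x assms by (intro that[of x]) (auto simp: torus_knot_def)
qed


subsection \<open>The torus\<close>

text \<open>Sliding the second coordinate straight to \<open>e\<close> moves the larger space into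
  the smaller one and keeps the smaller one inside itself throughout.\<close>

lemma trivial_relative_homology_Times:
  fixes Y P Q :: "complex set"
  assumes "P \<subseteq> Q" "e \<in> P" "\<And>w. w \<in> P \<Longrightarrow> closed_segment e w \<subseteq> P" "\<And>w. w \<in> Q \<Longrightarrow> closed_segment e w \<subseteq> Q"
  shows "trivial_group (relative_homology_group p (top_of_set (Y \<times> Q)) (Y \<times> P))"
proof (rule trivial_relative_homology_group_gen)
  have sub: "subtopology (top_of_set (Y \<times> Q)) (Y \<times> P) = top_of_set (Y \<times> P)"
    using assms(1) by (simp add: subtopology_subtopology Times_Int_Times Int_absorb1)
  have seg: "closed_segment (y, e) (y, w) \<subseteq> Y \<times> R" if "y \<in> Y" "closed_segment e w \<subseteq> R" for y w R
  proof
    fix v assume "v \<in> closed_segment (y, e) (y, w)"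
    then obtain u where u: "0 \<le> u" "u \<le> 1" "v = (1 - u) *\<^sub>R (y, e) + u *\<^sub>R (y, w)"
      by (auto simp: in_segment)
    then have "v = (y, (1 - u) *\<^sub>R e + u *\<^sub>R w)"
      by (simp add: scaleR_left_distrib[symmetric])
    moreover have "(1 - u) *\<^sub>R e + u *\<^sub>R w \<in> closed_segment e w" using u by (auto simp: in_segment)
    ultimately show "v \<in> Y \<times> R" using that by auto
  qed
  have h: "homotopic_with (\<lambda>h. True) (top_of_set (Y \<times> R)) (top_of_set (Y \<times> R)) (\<lambda>(y, w). (y, e)) id"
    if "\<And>w. w \<in> R \<Longrightarrow> closed_segment e w \<subseteq> R" for R
    unfolding case_prod_beta id_def
    by (rule homotopic_with_linear) (use that seg in \<open>fastforce intro!: continuous_intros\<close>)+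
  show "continuous_map (top_of_set (Y \<times> Q)) (subtopology (top_of_set (Y \<times> Q)) (Y \<times> P)) (\<lambda>(y, w). (y, e))"
    unfolding sub using assms(2) by (auto simp: case_prod_beta intro!: continuous_intros)
  show "homotopic_with (\<lambda>h. True) (subtopology (top_of_set (Y \<times> Q)) (Y \<times> P))
     (subtopology (top_of_set (Y \<times> Q)) (Y \<times> P)) (\<lambda>(y, w). (y, e)) id"
    unfolding sub by (rule h) (rule assms)
  show "homotopic_with (\<lambda>k. True) (top_of_set (Y \<times> Q)) (top_of_set (Y \<times> Q)) (\<lambda>(y, w). (y, e)) id"
    by (rule h) (rule assms)
qed

text \<open>The class comes from crossing the negative real axis. \<open>Y \<times> {1}\<close> is
  thickened to the slit plane, the right half is excised, and the boundary map lowers the degree: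
  what remains is the zeroth homology of \<open>Y\<close> times one open quadrant, which is the
  group of integers because \<open>Y\<close> is path-connected.\<close>

lemma relative_homology_punctured_plane:
  fixes Y :: "complex set"
  assumes "path_connected Y" "Y \<noteq> {}"
  shows "relative_homology_group 1 (top_of_set (Y \<times> (- {0::complex}))) (Y \<times> {1}) \<cong> integer_group"
proof -
  let ?X = "top_of_set (Y \<times> (- {0::complex}))"
  let ?A = "Y \<times> {1::complex}" and ?B = "Y \<times> (- \<real>\<^sub>\<le>\<^sub>0)"
  let ?N = "{w. Re w < 0}" and ?E = "Y \<times> {w. Re w < 0 \<and> Im w \<noteq> 0}"
  let ?P = "Y \<times> {w. Re w < 0 \<and> Im w > 0}" and ?M = "Y \<times> {w. Re w < 0 \<and> Im w < 0}"
  let ?X' = "top_of_set (Y \<times> ?N)" and ?U = "Y \<times> {w. w \<noteq> 0 \<and> Re w \<ge> 0}"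
  have subB: "subtopology ?X ?B = top_of_set ?B"
    by (auto simp: subtopology_subtopology Times_Int_Times intro!: arg_cong[where f = top_of_set])
  have trivBA: "trivial_group (relative_homology_group p (subtopology ?X ?B) ?A)" for p
    unfolding subB
  proof (rule trivial_relative_homology_Times[where e = 1])
    show "closed_segment 1 w \<subseteq> - \<real>\<^sub>\<le>\<^sub>0" if w: "w \<in> - \<real>\<^sub>\<le>\<^sub>0" for w :: complex
    proof
      fix v assume "v \<in> closed_segment 1 w"
      then obtain u where u: "0 \<le> u" "u \<le> 1" "v = (1 - u) *\<^sub>R 1 + u *\<^sub>R w" by (auto simp: in_segment)
      show "v \<in> - \<real>\<^sub>\<le>\<^sub>0"
      proof (cases "u = 0 \<or> Im w \<noteq> 0")
        case False
        then have "Re w > 0" "Im w = 0" using w by (auto simp: complex_nonpos_Reals_iff)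
        have "1 - u + u * Re w > 0"
        proof (cases "u = 1")
          case False
          then have "1 - u > 0" "u * Re w \<ge> 0" using u \<open>Re w > 0\<close> by auto
          then show ?thesis by linarith
        qed (use \<open>Re w > 0\<close> in simp)
        then have "Re v > 0" using u by simp
        then show ?thesis by (simp add: complex_nonpos_Reals_iff)
      qed (use u in \<open>auto simp: complex_nonpos_Reals_iff\<close>)
    qed
  qed auto
  have AB: "?A \<subseteq> ?B" by auto
  \<comment> \<open>Exactness for the triple \<open>?A\<close>, \<open>?B\<close>,
    \<open>?X\<close>: the groups of \<open>?B\<close> relative to \<open>?A\<close> on both sides
    vanish, since the slit plane is star-shaped about 1.\<close>
  have "hom_induced 1 ?X ?A ?X ?B id \<in> iso (relative_homology_group 1 ?X ?A) (relative_homology_group 1 ?X ?B)"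
    by (rule very_short_exact_sequence[where f = "hom_induced 1 (subtopology ?X ?B) ?A ?X ?A id"
          and h = "hom_relboundary 1 ?X ?B ?A", OF _ trivBA[of 1] trivBA[of "1 - 1"]])
      (use homology_exactness_triple_1[OF AB, of 1 ?X] homology_exactness_triple_3[OF AB, of 1 ?X] in
        \<open>simp only: exact_seq_cons_iff simp_thms\<close>)
  then have 1: "relative_homology_group 1 ?X ?A \<cong> relative_homology_group 1 ?X ?B" by (rule is_isoI)
  have oB: "openin ?X ?B"
    unfolding openin_open by (intro exI[of _ "UNIV \<times> (- \<real>\<^sub>\<le>\<^sub>0)"]) (auto intro!: open_Times)
  have cU: "closedin ?X ?U"
    unfolding closedin_closed
    by (intro exI[of _ "UNIV \<times> {w. Re w \<ge> 0}"]) (auto intro!: closed_Times closed_halfspace_Re_ge)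
  have "?X closure_of ?U \<subseteq> ?X interior_of ?B"
    using closure_of_closedin[OF cU] interior_of_openin[OF oB] by (auto simp: complex_nonpos_Reals_iff complex_eq_iff)
  moreover have "?B \<subseteq> topspace ?X" by auto
  ultimately have "relative_homology_group 1 (subtopology ?X (topspace ?X - ?U)) (?B - ?U) \<cong> relative_homology_group 1 (subtopology ?X (topspace ?X)) ?B"
    using is_isoI[OF homology_excision_axiom] by blast
  moreover have "subtopology ?X (topspace ?X - ?U) = ?X'"
    by (auto simp: subtopology_subtopology intro!: arg_cong[where f = top_of_set])
  moreover have "subtopology ?X (topspace ?X) = ?X" by (rule subtopology_topspace)
  moreover have "?B - ?U = ?E" by (auto simp: complex_nonpos_Reals_iff)
  ultimately have 2: "relative_homology_group 1 ?X' ?E \<cong> relative_homology_group 1 ?X ?B"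
    by (simp only:)
  have cv: "convex {w. Re w < 0 \<and> Im w > 0}" "convex {w. Re w < 0 \<and> Im w < 0}" "convex ?N"
    by (auto intro!: convex_Int convex_halfspace_Re_lt convex_halfspace_Im_lt convex_halfspace_Im_gt
        simp: Collect_conj_eq)
  have triv0: "trivial_group (relative_homology_group p ?X' ?P)" for p
  proof (rule trivial_relative_homology_Times[where e = "Complex (-1) 1"])
    show "closed_segment (Complex (-1) 1) w \<subseteq> {w. Re w < 0 \<and> Im w > 0}"
      if "w \<in> {w. Re w < 0 \<and> Im w > 0}" for w
      using that by (intro closed_segment_subset cv) auto
    show "closed_segment (Complex (-1) 1) w \<subseteq> ?N" if "w \<in> ?N" for w
      using that by (intro closed_segment_subset cv) auto
  qed auto
  have E0E: "?P \<subseteq> ?E" by auto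
  \<comment> \<open>Exactness for the triple \<open>?P\<close>, \<open>?E\<close>,
    \<open>?X'\<close>: the left half plane contracts to a point of its upper quadrant, so the
    groups of \<open>?X'\<close> relative to \<open>?P\<close> vanish.\<close>
  have "hom_relboundary 1 ?X' ?E ?P \<in> iso (relative_homology_group 1 ?X' ?E) (relative_homology_group (1 - 1) (subtopology ?X' ?E) ?P)"
    by (rule very_short_exact_sequence[where f = "hom_induced 1 ?X' ?P ?X' ?E id"
          and h = "hom_induced (1 - 1) (subtopology ?X' ?E) ?P ?X' ?P id", OF _ triv0[of 1] triv0[of "1 - 1"]])
      (use homology_exactness_triple_1[OF E0E, of 1 ?X'] homology_exactness_triple_2[OF E0E, of 1 ?X'] in
        \<open>simp only: exact_seq_cons_iff simp_thms\<close>)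
  then have 3: "relative_homology_group 1 ?X' ?E \<cong> relative_homology_group 0 (subtopology ?X' ?E) ?P"
    using is_isoI by fastforce
  have subE: "subtopology ?X' ?E = top_of_set ?E"
    by (auto simp: subtopology_subtopology intro!: arg_cong[where f = top_of_set])
  have oE: "openin (top_of_set ?E) ?P"
    unfolding openin_open by (intro exI[of _ "UNIV \<times> {w. Im w > 0}"]) (auto intro!: open_Times open_halfspace_Im_gt)
  have cE: "closedin (top_of_set ?E) ?P"
    unfolding closedin_closed by (intro exI[of _ "UNIV \<times> {w. Im w \<ge> 0}"]) (auto intro!: closed_Times closed_halfspace_Im_ge)
  have "top_of_set ?E closure_of ?P \<subseteq> top_of_set ?E interior_of ?P"
    using closure_of_closedin[OF cE] interior_of_openin[OF oE] by auto
  \<comment> \<open>The quadrants in \<open>?E\<close> are separated, so \<open>?P\<close> is open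
    and closed there and can be excised completely, leaving \<open>?M\<close> relative to the empty
    set.\<close>
  then have "relative_homology_group 0 (subtopology (top_of_set ?E) (?E - ?P)) (?P - ?P) \<cong>
      relative_homology_group 0 (subtopology (top_of_set ?E) ?E) ?P"
    using is_isoI[OF homology_excision_axiom] E0E by blast
  moreover have "subtopology (top_of_set ?E) (?E - ?P) = top_of_set ?M"
    by (auto simp: subtopology_subtopology intro!: arg_cong[where f = top_of_set])
  ultimately have 4: "homology_group 0 (top_of_set ?M) \<cong> relative_homology_group 0 (top_of_set ?E) ?P"
    by (simp add: subtopology_subtopology)
  have "homology_group 0 (top_of_set ?M) \<cong> integer_group"
  proof (rule isomorphic_integer_zeroth_homology_group)
    show "path_connected_space (top_of_set ?M)"
      using path_connected_Times[OF assms(1) convex_imp_path_connected[OF cv(2)]]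
      by (simp add: path_connectedin_topspace[symmetric] path_connectedin_subtopology)
    obtain y where "y \<in> Y" using assms(2) by blast
    then have "(y, Complex (-1) (-1)) \<in> topspace (top_of_set ?M)" by simp
    then show "topspace (top_of_set ?M) \<noteq> {}" by blast
  qed
  then have 5: "relative_homology_group 0 (top_of_set ?E) ?P \<cong> integer_group"
    using group.iso_sym[OF _ 4] iso_trans by auto
  have "relative_homology_group 1 ?X ?A \<cong> relative_homology_group 1 ?X' ?E"
    using iso_trans[OF 1 group.iso_sym[OF _ 2]] by simp
  then show ?thesis using iso_trans[OF _ iso_trans[OF 3[unfolded subE] 5]] by blast
qed

text \<open>\<open>Y \<times> {1}\<close> is a retract, so its homology splits off, and the
  complementary summand is the relative group.\<close>

lemma homology_Times_punctured_plane:
  fixes Y :: "complex set"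
  assumes "path_connected Y" "Y \<noteq> {}"
  shows "homology_group 1 (top_of_set (Y \<times> (- {0::complex}))) \<cong>
    homology_group 1 (top_of_set (Y \<times> {1::complex})) \<times>\<times> integer_group"
proof -
  let ?X = "top_of_set (Y \<times> (- {0::complex}))"
  have sub: "subtopology ?X (Y \<times> {1}) = top_of_set (Y \<times> {1})"
    by (auto simp: subtopology_subtopology intro!: arg_cong[where f = top_of_set])
  have "(Y \<times> {1}) retract_of_space ?X"
    unfolding retract_of_space_def sub
    by (intro conjI exI[of _ "\<lambda>(y, w). (y, 1)"]) (auto simp: case_prod_beta intro!: continuous_intros)
  then have "homology_group 1 ?X \<cong> homology_group 1 (top_of_set (Y \<times> {1::complex})) \<times>\<times> relative_homology_group 1 ?X (Y \<times> {1})"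
    using isomorphic_group_homology_group_prod_retract[of "Y \<times> {1}" ?X 1] by (simp add: sub)
  also have "\<dots> \<cong> homology_group 1 (top_of_set (Y \<times> {1::complex})) \<times>\<times> integer_group"
    by (intro group.DirProd_iso_trans relative_homology_punctured_plane assms) (auto simp: iso_refl)
  finally show ?thesis .
qed

lemma trivial_DirProd_iso:
  assumes "trivial_group G" "group H"
  shows "G \<times>\<times> H \<cong> H"
proof -
  have "snd \<in> iso (G \<times>\<times> H) H"
    using assms by (auto simp: iso_def hom_def bij_betw_def inj_on_def trivial_group_def image_iff)
  then show ?thesis by (rule is_isoI)
qed

lemma integer_group_square_iso: "integer_group \<times>\<times> integer_group \<cong> free_Abelian_group {..<2 * 1::nat}"
proof -
  let ?f = "\<lambda>(m, n). frag_cmul m (frag_of (0::nat)) + frag_cmul n (frag_of 1)"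
  have l: "poly_mapping.lookup (?f (m, n)) k = (if k = 0 then m else if k = 1 then n else 0)" for m n k
    by (simp add: lookup_add lookup_one when_def)
  have "?f \<in> iso (integer_group \<times>\<times> integer_group) (free_Abelian_group {..<2 * 1::nat})"
  proof (rule isoI [OF homI])
    show "?f x \<in> carrier (free_Abelian_group {..<2 * 1})" for x
      using l by (auto simp: in_keys_iff split: prod.splits if_splits)
    show "?f (x \<otimes>\<^bsub>integer_group \<times>\<times> integer_group\<^esub> y) = ?f x \<otimes>\<^bsub>free_Abelian_group {..<2 * 1}\<^esub> ?f y" for x y
      by (cases x; cases y) (simp add: frag_cmul_distrib)
    show "bij_betw ?f (carrier (integer_group \<times>\<times> integer_group)) (carrier (free_Abelian_group {..<2 * 1}))"
      unfolding bij_betw_def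
    proof
      show "inj_on ?f (carrier (integer_group \<times>\<times> integer_group))"
      proof (rule inj_onI)
        fix x y assume "?f x = ?f y"
        then have "poly_mapping.lookup (?f (fst x, snd x)) k = poly_mapping.lookup (?f (fst y, snd y)) k" for k
          by simp
        from this[of 0] this[of 1] show "x = y" unfolding l by (simp add: prod_eq_iff)
      qed
      have "\<exists>m n. x = ?f (m, n)" if "Poly_Mapping.keys x \<subseteq> {..<2 * 1}" for x
      proof (intro exI poly_mapping_eqI)
        fix k
        have "poly_mapping.lookup x k = 0" if "k \<noteq> 0" "k \<noteq> 1"
          using \<open>Poly_Mapping.keys x \<subseteq> {..<2 * 1}\<close> that by (force simp: in_keys_iff)
        then show "poly_mapping.lookup x k = poly_mapping.lookup (?f (poly_mapping.lookup x 0, poly_mapping.lookup x 1)) k"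
          unfolding l by auto
      qed
      moreover have "Poly_Mapping.keys (?f x) \<subseteq> {..<2 * 1}" for x
        using l by (auto simp: in_keys_iff split: prod.splits if_splits)
      ultimately show "?f ` carrier (integer_group \<times>\<times> integer_group) = carrier (free_Abelian_group {..<2 * 1})"
        by (auto simp: image_iff)
    qed
  qed
  then show ?thesis by (rule is_isoI)
qed

text \<open>Each punctured factor adds one copy of the integers, starting from a point; the swap in
  between puts the first factor into the position of \<open>Y\<close>.\<close>

lemma homology_punctured_plane_square:
  "homology_group 1 (top_of_set ((- {0::complex}) \<times> (- {0::complex}))) \<cong> free_Abelian_group {..<2 * 1::nat}"
proof -
  let ?W = "- {0::complex}"
  have pc: "path_connected ?W" by (rule path_connected_punctured_universe) simp
  have "1 \<in> ?W" by simp
  then have ne: "?W \<noteq> {}" by blast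
  have "homology_group 1 (top_of_set ({1::complex} \<times> {1::complex})) \<times>\<times> integer_group \<cong> integer_group"
    by (intro trivial_DirProd_iso homology_dimension_axiom[where a = "(1, 1)"]) auto
  with homology_Times_punctured_plane[of "{1}"]
  have "homology_group 1 (top_of_set ({1::complex} \<times> ?W)) \<cong> integer_group"
    by (auto intro: iso_trans)
  moreover have "top_of_set (?W \<times> {1::complex}) homeomorphic_space top_of_set ({1::complex} \<times> ?W)"
    unfolding homeomorphic_space_def homeomorphic_maps_def
    by (intro exI[of _ prod.swap]) (auto intro!: continuous_intros simp: prod.swap_def)
  ultimately have "homology_group 1 (top_of_set (?W \<times> {1::complex})) \<cong> integer_group"
    using homeomorphic_space_imp_isomorphic_homology_groups iso_trans by blast
  then have "homology_group 1 (top_of_set (?W \<times> {1::complex})) \<times>\<times> integer_group \<cong> integer_group \<times>\<times> integer_group"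
    by (intro group.DirProd_iso_trans) (auto simp: iso_refl)
  then show ?thesis
    using homology_Times_punctured_plane[OF pc ne] integer_group_square_iso by (blast intro: iso_trans)
qed

section \<open>The torus as a surface in the sphere\<close>

definition torus :: "real \<Rightarrow> real \<Rightarrow> (real^4) set" where
  "torus r s = {x. cmod (zc x) = r \<and> cmod (wc x) = s}"

text \<open>The product of two punctured planes retracts radially onto the torus. The connecting
  segments avoid zero because each coordinate is only multiplied by positive numbers.\<close>

lemma surface_has_genus_torus:
  assumes "r > 0" "s > 0"
  shows "surface_has_genus (torus r s) 1"
proof -
  let ?W = "(- {0::complex}) \<times> (- {0::complex})"
  let ?f = "\<lambda>x. (zc x, wc x)" and ?g = "\<lambda>(z, w). mk (of_real (r / cmod z) * z) (of_real (s / cmod w) * w)"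
  have "top_of_set (torus r s) homotopy_equivalent_space top_of_set ?W"
    unfolding homotopy_equivalent_space_def
  proof (intro exI conjI)
    show "continuous_map (top_of_set (torus r s)) (top_of_set ?W) ?f"
      using assms by (auto simp: torus_def intro!: continuous_intros)
    show "continuous_map (top_of_set ?W) (top_of_set (torus r s)) ?g"
      using assms by (auto simp: torus_def case_prod_beta norm_mult norm_divide intro!: continuous_intros)
    show "homotopic_with (\<lambda>x. True) (top_of_set (torus r s)) (top_of_set (torus r s)) (?g \<circ> ?f) id"
      using assms by (intro homotopic_with_equal) (auto simp: torus_def id_def norm_mult intro!: continuous_intros)
    have c: "u *\<^sub>R z + (1 - u) *\<^sub>R (of_real q * z) \<noteq> 0" if "z \<noteq> 0" "q > 0" "0 \<le> u" "u \<le> 1" for u q and z :: complex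
    proof -
      have "u + (1 - u) * q > 0" using that
        by (metis add_nonneg_pos add_pos_nonneg diff_ge_0_iff_ge le_less mult_nonneg_nonneg mult_pos_pos diff_gt_0_iff_gt zero_less_one)
      moreover have "u *\<^sub>R z + (1 - u) *\<^sub>R (of_real q * z) = of_real (u + (1 - u) * q) * z"
        by (simp add: scaleR_conv_of_real algebra_simps)
      ultimately show ?thesis using that by (metis mult_eq_0_iff of_real_eq_0_iff less_irrefl)
    qed
    show "homotopic_with (\<lambda>x. True) (top_of_set ?W) (top_of_set ?W) (?f \<circ> ?g) id"
    proof (rule homotopic_with_linear)
      show "continuous_on ?W (?f \<circ> ?g)"
        by (auto simp: o_def case_prod_beta intro!: continuous_intros)
      fix x assume x: "x \<in> ?W"
      show "closed_segment ((?f \<circ> ?g) x) (id x) \<subseteq> ?W"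
      proof
        fix v assume "v \<in> closed_segment ((?f \<circ> ?g) x) (id x)"
        then obtain u where "0 \<le> u" "u \<le> 1" "v = (1 - u) *\<^sub>R (?f \<circ> ?g) x + u *\<^sub>R id x"
          by (auto simp: in_segment)
        then show "v \<in> ?W" using c[of "fst x" "r / cmod (fst x)" u] c[of "snd x" "s / cmod (snd x)" u] x assms
          by (cases x) (auto simp: add.commute)
      qed
    qed simp
  qed
  then show ?thesis
    unfolding surface_has_genus_def
    using homotopy_equivalent_space_imp_isomorphic_homology_groups homology_punctured_plane_square iso_trans by blast
qed

text \<open>The Cayley transform \<open>\<i> * (1 - u) / (u + 1)\<close>, which takes the unit
  circle without -1 to the real line and 1 to 0. A constant plus a multiple of an inverse is the
  form covered by \<open>Ck_on_inverse_power\<close>.\<close>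

definition moebius :: "complex \<Rightarrow> complex" where "moebius u = - \<i> + 2 * \<i> * inverse (u + 1)"
definition moebius_inv :: "complex \<Rightarrow> complex" where "moebius_inv v = - 1 + 2 * \<i> * inverse (v + \<i>)"

lemma moebius_inverse:
  "u \<noteq> - 1 \<Longrightarrow> moebius_inv (moebius u) = u" "v \<noteq> - \<i> \<Longrightarrow> moebius (moebius_inv v) = v"
  "u \<noteq> - 1 \<Longrightarrow> moebius u \<noteq> - \<i>" "v \<noteq> - \<i> \<Longrightarrow> moebius_inv v \<noteq> - 1"
proof -
  have [simp]: "u + 1 \<noteq> 0 \<longleftrightarrow> u \<noteq> - 1" "v + \<i> \<noteq> 0 \<longleftrightarrow> v \<noteq> - \<i>" for u v :: complex
    by (simp_all add: eq_neg_iff_add_eq_0)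
  show "u \<noteq> - 1 \<Longrightarrow> moebius_inv (moebius u) = u" "v \<noteq> - \<i> \<Longrightarrow> moebius (moebius_inv v) = v"
    "u \<noteq> - 1 \<Longrightarrow> moebius u \<noteq> - \<i>" "v \<noteq> - \<i> \<Longrightarrow> moebius_inv v \<noteq> - 1"
    by (auto simp: moebius_def moebius_inv_def)
qed

lemma Im_moebius_eq_0_iff:
  assumes "u \<noteq> - 1"
  shows "Im (moebius u) = 0 \<longleftrightarrow> cmod u = 1"
proof -
  have nz: "u + 1 \<noteq> 0" using assms by (simp add: eq_neg_iff_add_eq_0)
  have "moebius u = \<i> * (1 - u) / (u + 1)"
    using nz by (simp add: moebius_def field_simps)
  also have "\<dots> = \<i> * (1 - u) * cnj (u + 1) / ((u + 1) * cnj (u + 1))"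
    using nz by (simp del: complex_cnj_add)
  also have "(u + 1) * cnj (u + 1) = of_real ((cmod (u + 1))\<^sup>2)"
    by (rule complex_norm_square[symmetric])
  finally have "moebius u = \<i> * (1 - u) * cnj (u + 1) / of_real ((cmod (u + 1))\<^sup>2)" .
  then have "Im (moebius u) = Im (\<i> * (1 - u) * cnj (u + 1)) / (cmod (u + 1))\<^sup>2"
    by (simp only: Im_divide_of_real)
  also have "Im (\<i> * (1 - u) * cnj (u + 1)) = 1 - (cmod u)\<^sup>2"
    by (simp only: cmod_power2) (simp add: power2_eq_square algebra_simps)
  finally show ?thesis using nz by (auto simp: abs_square_eq_1)
qed

text \<open>Dividing the coordinates by those of \<open>p\<close> moves \<open>p\<close> to
  \<open>(1, 1)\<close>; there the Cayley transform in each coordinate straightens both circles, and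
  the slice is the real plane \<open>L\<close>.\<close>

lemma smooth_submanifold_torus:
  assumes "r > 0" "s > 0"
  shows "smooth_submanifold 2 (torus r s)"
  unfolding smooth_submanifold_def
proof
  fix p assume p: "p \<in> torus r s"
  define z0 w0 where "z0 = zc p" and "w0 = wc p"
  have z0: "z0 \<noteq> 0" "w0 \<noteq> 0" "cmod z0 = r" "cmod w0 = s"
    using p assms by (auto simp: torus_def z0_def w0_def)
  define U where "U = {x. zc x / z0 \<noteq> - 1 \<and> wc x / w0 \<noteq> - 1}"
  define V where "V = {x. zc x \<noteq> - \<i> \<and> wc x \<noteq> - \<i>}"
  define \<phi> where "\<phi> x = mk (moebius (zc x / z0)) (moebius (wc x / w0))" for x
  define \<psi> where "\<psi> x = mk (z0 * moebius_inv (zc x)) (w0 * moebius_inv (wc x))" for x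
  define L where "L = {x. Im (zc x) = 0 \<and> Im (wc x) = 0}"
  have "open U" "open V"
    unfolding U_def V_def using z0 by (auto intro!: open_Collect_conj open_Collect_neq continuous_intros)
  have bl: "bounded_linear (\<lambda>u. mk (c * u) 0)" "bounded_linear (\<lambda>u. mk 0 (c * u))" for c
    by (auto intro!: linearI simp: linear_conv_bounded_linear[symmetric] mk_add mk_scaleR algebra_simps)
  have bz: "bounded_linear (\<lambda>x. zc x / c)" "bounded_linear (\<lambda>x. wc x / c)" for c
    using bounded_linear_compose[OF bounded_linear_divide bounded_linear_zc]
      bounded_linear_compose[OF bounded_linear_divide bounded_linear_wc] by auto
  \<comment> \<open>The exponents 1, and the divisions by 1 in the formula for \<open>\<psi>\<close>
    below, make the terms match \<open>Ck_on_inverse_power\<close> and \<open>bz\<close>.\<close>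
  have "\<phi> = (\<lambda>x. mk (- \<i>) (- \<i>) + (mk (2 * \<i> * inverse (zc x / z0 + 1) ^ 1) 0 + mk 0 (2 * \<i> * inverse (wc x / w0 + 1) ^ 1)))"
    by (simp add: fun_eq_iff \<phi>_def moebius_def mk_add)
  then have "smooth_on U \<phi>"
    unfolding smooth_on_def using \<open>open U\<close>
    by (simp only:) (intro allI Ck_on_add Ck_on_const Ck_on_inverse_power bl bz;
        auto simp: U_def eq_neg_iff_add_eq_0)
  have "\<psi> = (\<lambda>x. mk (- z0) (- w0) + (mk (z0 * 2 * \<i> * inverse (zc x / 1 + \<i>) ^ 1) 0 + mk 0 (w0 * 2 * \<i> * inverse (wc x / 1 + \<i>) ^ 1)))"
    by (simp add: fun_eq_iff \<psi>_def moebius_inv_def mk_add algebra_simps)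
  then have "smooth_on V \<psi>"
    unfolding smooth_on_def using \<open>open V\<close>
    by (simp only:) (intro allI Ck_on_add Ck_on_const Ck_on_inverse_power bl bz;
        auto simp: V_def eq_neg_iff_add_eq_0)
  have \<psi>\<phi>: "\<psi> (\<phi> x) = x" "\<phi> x \<in> V" if "x \<in> U" for x
    using that z0 moebius_inverse by (auto simp: \<phi>_def \<psi>_def U_def V_def)
  have \<phi>\<psi>: "\<phi> (\<psi> x) = x" "\<psi> x \<in> U" if "x \<in> V" for x
    using that z0 moebius_inverse by (auto simp: \<phi>_def \<psi>_def U_def V_def)
  have hom: "homeomorphism U V \<phi> \<psi>"
  proof (rule homeomorphismI)
    show "continuous_on U \<phi>" "continuous_on V \<psi>"
      using \<open>smooth_on U \<phi>\<close> \<open>smooth_on V \<psi>\<close> unfolding smooth_on_def by (metis Ck_on.simps(1))+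
  qed (use \<psi>\<phi> \<phi>\<psi> in auto)
  have UL: "x \<in> torus r s \<longleftrightarrow> \<phi> x \<in> L" if "x \<in> U" for x
    using that z0 assms by (auto simp: L_def U_def \<phi>_def torus_def Im_moebius_eq_0_iff norm_divide)
  have img: "\<phi> ` (torus r s \<inter> U) = V \<inter> L"
  proof
    show "\<phi> ` (torus r s \<inter> U) \<subseteq> V \<inter> L" using UL \<psi>\<phi> by auto
    show "V \<inter> L \<subseteq> \<phi> ` (torus r s \<inter> U)"
    proof
      fix y assume "y \<in> V \<inter> L"
      then show "y \<in> \<phi> ` (torus r s \<inter> U)"
        using \<phi>\<psi>[of y] UL[of "\<psi> y"] by (intro image_eqI[of _ _ "\<psi> y"]) auto
    qed
  qed
  have "subspace L"
    unfolding subspace_def L_def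
    by (auto simp: zc_def wc_def)
  have "dim L = 2"
  proof (rule dim_unique[of "{mk 1 0, mk 0 1}"])
    show "{mk 1 0, mk 0 1} \<subseteq> L" by (auto simp: L_def)
    show "L \<subseteq> span {mk 1 0, mk 0 1}"
    proof
      fix x assume "x \<in> L"
      then have "x = Re (zc x) *\<^sub>R mk 1 0 + Re (wc x) *\<^sub>R mk 0 1"
      proof -
        have "of_real (Re (zc x)) = zc x" "of_real (Re (wc x)) = wc x"
          using \<open>x \<in> L\<close> by (simp_all add: L_def complex_eq_iff)
        moreover have "Re (zc x) *\<^sub>R mk 1 0 + Re (wc x) *\<^sub>R mk 0 1 = mk (of_real (Re (zc x))) (of_real (Re (wc x)))"
          by (simp add: mk_scaleR mk_add scaleR_conv_of_real[where 'a = complex])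
        ultimately show ?thesis by simp
      qed
      then show "x \<in> span {mk 1 0, mk 0 1}"
        by (metis span_add span_scale span_base insertI1 insertI2)
    qed
    have "mk 1 0 \<bullet> mk 0 1 = 0" "mk 1 0 \<noteq> (0 :: real^4)" "mk 0 1 \<noteq> (0 :: real^4)"
      by (auto simp: inner_vec_def sum_4 mk_nth vec_eq_iff forall_4)
    then show "independent {mk 1 0, mk 0 1 :: real^4}"
      by (intro pairwise_orthogonal_independent) (auto simp: pairwise_def orthogonal_def inner_commute)
    show "card {mk 1 0, mk 0 1 :: real^4} = 2" by simp
  qed
  moreover have "p \<in> U" using z0 by (auto simp: U_def z0_def w0_def)
  ultimately show "\<exists>U (V::(real^4) set) \<phi> \<psi> L. open U \<and> p \<in> U \<and> open V \<and> homeomorphism U V \<phi> \<psi> \<and>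
      smooth_on U \<phi> \<and> smooth_on V \<psi> \<and> subspace L \<and> dim L = 2 \<and> \<phi> ` (torus r s \<inter> U) = V \<inter> L"
    using \<open>open U\<close> \<open>open V\<close> hom \<open>smooth_on U \<phi>\<close> \<open>smooth_on V \<psi>\<close> \<open>subspace L\<close> img
    by - (rule exI[of _ U], rule exI[of _ V], rule exI[of _ \<phi>], rule exI[of _ \<psi>], rule exI[of _ L],
        intro conjI)
qed

lemma connected_torus: "connected (torus r s)"
proof -
  have "torus r s = (\<lambda>(t, u). mk (of_real r * cis t) (of_real s * cis u)) ` UNIV" if "r \<ge> 0" "s \<ge> 0"
  proof
    show "torus r s \<subseteq> (\<lambda>(t, u). mk (of_real r * cis t) (of_real s * cis u)) ` UNIV"
    proof
      fix x assume x: "x \<in> torus r s"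
      have p: "of_real (cmod z) * cis (Arg z) = z" for z using rcis_cmod_Arg[of z] by (simp add: rcis_def)
      have "of_real r * cis (Arg (zc x)) = zc x" "of_real s * cis (Arg (wc x)) = wc x"
        using p[of "zc x"] p[of "wc x"] x by (simp_all only: torus_def mem_Collect_eq)
      then have "x = mk (of_real r * cis (Arg (zc x))) (of_real s * cis (Arg (wc x)))"
        by (simp only: mk_zc_wc)
      then have "x = (\<lambda>(t, u). mk (of_real r * cis t) (of_real s * cis u)) (Arg (zc x), Arg (wc x))"
        unfolding prod.case .
      then show "x \<in> (\<lambda>(t, u). mk (of_real r * cis t) (of_real s * cis u)) ` UNIV"
        by (rule image_eqI) simp
    qed
  qed (use that in \<open>auto simp: torus_def norm_mult\<close>)
  moreover have "connected ((\<lambda>(t, u). mk (of_real r * cis t) (of_real s * cis u)) ` UNIV)"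
    by (rule connected_continuous_image) (auto simp: case_prod_beta intro!: continuous_intros)
  moreover have "torus r s = {}" if "\<not> (r \<ge> 0 \<and> s \<ge> 0)"
    using that by (auto simp: torus_def)
  ultimately show ?thesis by (metis connected_empty)
qed

context torus_knot begin

text \<open>The radii are the moduli of the two coordinates along \<open>curve\<close>. The torus is
  invariant under the antipode, so it is the full preimage of its image.\<close>

lemma good_surface_torus:
  defines "S \<equiv> antipodal_pair ` torus a (a ^ (2 * n))"
  shows "good_surface S tknot" "surface_has_genus (cover_preimage S) 1"
proof -
  let ?T = "torus a (a ^ (2 * n))"
  have sph: "?T \<subseteq> sphere 0 1"
    by (rule subsetI) (simp only: sphere_C2_iff torus_def mem_Collect_eq a)
  have m: "- x \<in> ?T" if "x \<in> ?T" for x using that by (auto simp: torus_def)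
  have pre: "cover_preimage S = ?T"
    using sph m by (auto simp: cover_preimage_def S_def antipodal_pair_eq_iff)
  show "surface_has_genus (cover_preimage S) 1"
    unfolding pre using a by (intro surface_has_genus_torus) auto
  have "closed ?T" unfolding torus_def
    by (intro closed_Collect_conj closed_Collect_eq continuous_intros)
  moreover have "bounded ?T" using bounded_subset[OF bounded_sphere sph] .
  ultimately have "compact ?T" by (simp add: compact_eq_bounded_closed)
  then have "compactin (top_of_set (sphere 0 1)) ?T" using sph by (simp add: compactin_subtopology)
  then have c: "compactin RP3 S" unfolding S_def using image_compactin continuous_map_antipodal_pair by blast
  have "connectedin (top_of_set (sphere 0 1)) ?T" using sph connected_torus by (simp add: connectedin_subtopology)
  then have "connectedin RP3 S" unfolding S_def
    using connectedin_continuous_map_image continuous_map_antipodal_pair by blast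
  moreover have "knot_image tknot \<subseteq> S"
    using a by (auto simp: S_def tknot_def torus_def curve_def norm_mult norm_power intro!: imageI)
  ultimately show "good_surface S tknot"
    unfolding good_surface_def closed_surface_def pre
    using c smooth_submanifold_torus connected_torus a by auto
qed

end


subsection \<open>The knots are not affine\<close>

lemma logarithm_on_convex:
  fixes f :: "'a::real_normed_vector \<Rightarrow> complex"
  assumes "continuous_on S f" "convex S" "\<And>z. z \<in> S \<Longrightarrow> f z \<noteq> 0"
  obtains g where "continuous_on S g" "\<And>x. x \<in> S \<Longrightarrow> exp (g x) = f x"
  using continuous_logarithm_on_contractible[OF assms(1) convex_imp_contractible[OF assms(2)] assms(3)]
  by metis

lemma shift_by_int_multiple:
  fixes f :: "real \<Rightarrow> 'b::real_vector"
  assumes "\<And>t. f (t + p) = f t + c"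
  shows "f (t + of_int k * p) = f t + of_int k *\<^sub>R c"
proof (induction k rule: int_induct[where k = 0])
  case (step1 i)
  then show ?case using assms[of "t + of_int i * p"] by (simp add: algebra_simps)
next
  case (step2 i)
  then show ?case using assms[of "t + of_int (i - 1) * p"] by (simp add: algebra_simps)
qed simp

text \<open>Continuity of the map and of its inverse descends from the lifts through the quotient
  map.\<close>

lemma diffeo_RP3_homeomorphic_map:
  assumes "diffeo_RP3 F"
  shows "homeomorphic_map RP3 RP3 F"
proof -
  obtain \<Psi> \<Psi>' where hom: "homeomorphism (sphere 0 1) (sphere 0 1) \<Psi> \<Psi>'"
    and l: "\<And>x. x \<in> sphere 0 1 \<Longrightarrow> antipodal_pair (\<Psi> x) = F (antipodal_pair x)"
    using lift_diffeo_RP3[OF assms] by metis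
  have bij: "bij_betw F (topspace RP3) (topspace RP3)" using assms by (simp add: diffeo_RP3_def)
  let ?G = "inv_into (topspace RP3) F"
  have GF: "?G (F p) = p" "F (?G p) = p" if "p \<in> topspace RP3" for p
    using that bij by (auto simp: bij_betw_def f_inv_into_f)
  have l': "antipodal_pair (\<Psi>' x) = ?G (antipodal_pair x)" if x: "x \<in> sphere 0 1" for x
  proof -
    have y: "\<Psi>' x \<in> sphere 0 1" "\<Psi> (\<Psi>' x) = x"
      using homeomorphism_image2[OF hom] homeomorphism_apply2[OF hom x] x by blast+
    then show ?thesis using l[OF y(1)] GF(1)[of "antipodal_pair (\<Psi>' x)"] by simp
  qed
  have "continuous_map (top_of_set (sphere 0 1)) RP3 (antipodal_pair \<circ> \<Psi>)"
    "continuous_map (top_of_set (sphere 0 1)) RP3 (antipodal_pair \<circ> \<Psi>')"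
    using homeomorphism_image1[OF hom] homeomorphism_image2[OF hom] homeomorphism_cont1[OF hom] homeomorphism_cont2[OF hom]
    by (intro continuous_map_compose[OF _ continuous_map_antipodal_pair]; fastforce)+
  note c = this
  have "continuous_map (top_of_set (sphere 0 1)) RP3 (F \<circ> antipodal_pair)"
    by (rule continuous_map_eq[OF c(1)]) (simp add: l)
  moreover have "continuous_map (top_of_set (sphere 0 1)) RP3 (?G \<circ> antipodal_pair)"
    by (rule continuous_map_eq[OF c(2)]) (simp add: l')
  ultimately have "continuous_map RP3 RP3 F" "continuous_map RP3 RP3 ?G"
    by (auto intro: continuous_compose_quotient_map[OF quotient_map_antipodal_pair])
  then show ?thesis
    unfolding homeomorphic_map_maps homeomorphic_maps_def using GF by blast
qed

lemma antipodal_pair_scale: "e = 1 \<or> e = (-1::real) \<Longrightarrow> antipodal_pair (e *\<^sub>R y) = antipodal_pair y"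
  by (elim disjE) simp_all

lemma ambient_isotopicD:
  assumes "ambient_isotopic A B"
  shows "\<exists>F. diffeo_RP3 F \<and> F ` A = B"
proof -
  obtain \<Phi> :: "real \<Rightarrow> (real^4) set \<Rightarrow> (real^4) set" where "\<forall>t\<in>{0..1}. diffeo_RP3 (\<Phi> t)" "\<Phi> 1 ` A = B"
    using assms unfolding ambient_isotopic_def by blast
  then show ?thesis by (intro exI[of _ "\<Phi> 1"]) simp
qed

lemma quotient_map_descend:
  fixes f :: "'a::topological_space \<Rightarrow> 'b::topological_space"
  assumes q: "quotient_map (top_of_set W) Y q" and f: "continuous_on W f"
    and c: "\<And>x y. x \<in> W \<Longrightarrow> y \<in> W \<Longrightarrow> q x = q y \<Longrightarrow> f x = f y"
  shows "\<exists>g. continuous_map Y euclidean g \<and> (\<forall>x\<in>W. g (q x) = f x)"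
proof -
  have "continuous_map (top_of_set W) euclidean f" using f by simp
  from quotient_map_lift_exists[OF q this] c show ?thesis
    unfolding topspace_euclidean_subtopology by metis
qed

context torus_knot begin

lemma tknot_in_RP3: "cmod c = 1 \<Longrightarrow> tknot c \<in> topspace RP3"
  by (simp add: tknot_def)

lemma continuous_map_tknot:
  assumes "\<And>t. t \<in> T \<Longrightarrow> tknot (cis t) \<in> C"
  shows "continuous_map (top_of_set T) (subtopology RP3 C) (\<lambda>t. tknot (cis t))"
proof -
  have "continuous_map (top_of_set T) (top_of_set (sphere 0 1)) (\<lambda>t. curve (cis t))"
    by (auto intro!: continuous_intros)
  from continuous_map_compose[OF this continuous_map_antipodal_pair]
  show ?thesis using assms by (auto simp: continuous_map_in_subtopology tknot_def o_def)
qed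

text \<open>If the cover is trivial over an open set containing the knot, and logarithms exist there,
  then the antipode of the lifted knot does not link the lifted knot.\<close>

lemma tknot_not_in_trivially_covered_set:
  fixes q :: "real^3 \<Rightarrow> (real^4) set" and \<sigma> :: "real^3 \<Rightarrow> real^4"
  assumes q: "quotient_map (top_of_set X) RP3 q" and W: "openin (top_of_set X) W"
    and C: "C \<subseteq> topspace RP3" "\<And>x. x \<in> X \<Longrightarrow> x \<in> W \<longleftrightarrow> q x \<in> C"
    and \<sigma>: "continuous_on W \<sigma>" "\<And>x. x \<in> W \<Longrightarrow> \<sigma> x \<in> sphere 0 1" "\<And>x. x \<in> W \<Longrightarrow> antipodal_pair (\<sigma> x) = q x"
      "\<And>x y. x \<in> W \<Longrightarrow> y \<in> W \<Longrightarrow> q x = q y \<Longrightarrow> \<sigma> x = \<sigma> y"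
    and log: "\<And>G::real^3 \<Rightarrow> complex. continuous_on W G \<Longrightarrow> (\<And>x. x \<in> W \<Longrightarrow> G x \<noteq> 0) \<Longrightarrow>
      (\<And>x y. x \<in> W \<Longrightarrow> y \<in> W \<Longrightarrow> q x = q y \<Longrightarrow> G x = G y) \<Longrightarrow>
      \<exists>L. continuous_on W L \<and> (\<forall>x\<in>W. exp (L x) = G x) \<and> (\<forall>x\<in>W. \<forall>y\<in>W. q x = q y \<longrightarrow> L x = L y)"
  shows "\<not> knot_image tknot \<subseteq> C"
proof
  assume K: "knot_image tknot \<subseteq> C"
  have WX: "W \<subseteq> X" using W openin_imp_subset by auto
  have WC: "{x \<in> topspace (top_of_set X). q x \<in> C} = W" using C WX by auto
  then have "openin RP3 C" using q C(1) W unfolding quotient_map_def by auto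
  then have qW: "quotient_map (top_of_set W) (subtopology RP3 C) q"
    using quotient_map_restriction[OF q WC] WX by (simp add: subtopology_subtopology Int_absorb1)
  have tC: "tknot (cis t) \<in> C" for t using K by auto
  have ex: "\<exists>x\<in>W. q x = tknot (cis t)" for t
  proof -
    have "tknot (cis t) \<in> q ` X"
      using tC C(1) q unfolding quotient_map_def by auto
    then show ?thesis using C(2) tC by (metis imageE)
  qed
  obtain s where s: "continuous_map (subtopology RP3 C) euclidean s" "\<And>x. x \<in> W \<Longrightarrow> s (q x) = \<sigma> x"
    using quotient_map_descend[OF qW \<sigma>(1,4)] by blast
  have sC: "s (tknot (cis t)) \<in> sphere 0 1" "antipodal_pair (s (tknot (cis t))) = tknot (cis t)" for t
    using ex[of t] s(2) \<sigma>(2,3) by metis+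
  have cs: "continuous_on T (\<lambda>t. s (tknot (cis t)))" for T
    using continuous_map_compose[OF continuous_map_tknot s(1), of T] tC by (auto simp: o_def)
  \<comment> \<open>Along the knot the section \<open>s\<close> must follow one of the two lifts;
    \<open>e\<close> records which.\<close>
  have "(\<forall>t\<in>UNIV. s (tknot (cis t)) = curve (cis t)) \<or> (\<forall>t\<in>UNIV. s (tknot (cis t)) = - curve (cis t))"
    by (rule lifts_agree_up_to_sign)
      (use sC cs in \<open>auto simp: tknot_def intro!: continuous_intros connected_UNIV\<close>)
  then obtain e :: real where e: "e = 1 \<or> e = -1" and st: "\<And>t. s (tknot (cis t)) = e *\<^sub>R curve (cis t)"
    by (metis UNIV_I scaleR_minus1_left scaleR_one)
  \<comment> \<open>The sign makes \<open>G\<close> over the knot the defect on the antipode of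
    \<open>curve\<close>. A zero of \<open>G\<close> would put
    \<open>- e *\<^sub>R \<sigma> x\<close> on the curve itself, although over the knot the section
    \<open>\<sigma>\<close> already selects \<open>e\<close> times the curve.\<close>
  define G where "G x = defect (- e *\<^sub>R \<sigma> x)" for x
  have "\<exists>L. continuous_on W L \<and> (\<forall>x\<in>W. exp (L x) = G x) \<and> (\<forall>x\<in>W. \<forall>y\<in>W. q x = q y \<longrightarrow> L x = L y)"
  proof (rule log)
    show "continuous_on W G" unfolding G_def by (intro continuous_intros \<sigma>)
    show "G x = G y" if "x \<in> W" "y \<in> W" "q x = q y" for x y
      using \<sigma>(4)[OF that] by (simp add: G_def)
    fix x assume x: "x \<in> W"
    show "G x \<noteq> 0"
    proof
      assume "G x = 0"
      moreover have "- e *\<^sub>R \<sigma> x \<in> sphere 0 1" using \<sigma>(2)[OF x] e by auto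
      ultimately obtain c where c: "cmod c = 1" "- e *\<^sub>R \<sigma> x = curve c"
        unfolding G_def using defect_eq_0_iff by blast
      obtain t where t: "c = cis t" using c(1) unit_circle_iff[of c] by auto
      have "antipodal_pair (- e *\<^sub>R \<sigma> x) = q x"
        using antipodal_pair_scale[of "- e" "\<sigma> x"] \<sigma>(3)[OF x] e by auto
      then have "q x = tknot (cis t)" unfolding c(2) unfolding t tknot_def by (rule sym)
      then have "s (tknot (cis t)) = \<sigma> x" using s(2)[OF x] by simp
      then have \<sigma>x: "\<sigma> x = e *\<^sub>R curve c" using st t by simp
      have "curve c = - curve c" using c(2) e unfolding \<sigma>x by auto
      then show False using curve_neq_minus c(1) by blast
    qed
  qed
  then obtain L where L: "continuous_on W L" "\<And>x. x \<in> W \<Longrightarrow> exp (L x) = G x"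
    "\<And>x y. x \<in> W \<Longrightarrow> y \<in> W \<Longrightarrow> q x = q y \<Longrightarrow> L x = L y" by blast
  obtain l where l: "continuous_map (subtopology RP3 C) euclidean l" "\<And>x. x \<in> W \<Longrightarrow> l (q x) = L x"
    using quotient_map_descend[OF qW L(1,3)] by blast
  have "continuous_on {0..2 * pi} (\<lambda>t. l (tknot (cis t)))"
    using continuous_map_compose[OF continuous_map_tknot l(1), of "{0..2 * pi}"] tC by (auto simp: o_def)
  moreover have "exp (l (tknot (cis t))) = defect (- curve (cis t)) ^ 1" for t
  proof -
    obtain x where x: "x \<in> W" "q x = tknot (cis t)" using ex by blast
    then have "\<sigma> x = e *\<^sub>R curve (cis t)" using s(2)[OF x(1)] st[of t] by simp
    then have "- e *\<^sub>R \<sigma> x = - curve (cis t)" using e by auto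
    then show ?thesis using L(2)[OF x(1)] l(2)[OF x(1)] x(2) by (simp add: G_def)
  qed
  ultimately have "l (tknot (cis (2 * pi))) - l (tknot (cis 0)) = 2 * of_nat (2 * n * 1) * of_real pi * \<i>"
    by (rule log_defect_minus_curve)
  then show False using n by simp
qed

lemma not_affine_tknot: "\<not> affine_knot tknot"
proof
  assume "affine_knot tknot"
  then obtain P where disj: "knot_image tknot \<inter> P = {}" and "asymptotic_plane P"
    unfolding affine_knot_def by blast
  then obtain Q where "standard_plane Q" "ambient_isotopic Q P" unfolding asymptotic_plane_def by blast
  from ambient_isotopicD[OF \<open>ambient_isotopic Q P\<close>]
  obtain \<Phi> where F: "diffeo_RP3 \<Phi>" and P: "\<Phi> ` Q = P" by blast
  from \<open>standard_plane Q\<close> obtain q0 where Q: "projective_plane Q"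
    and q0: "ball_model q0" and QW: "{x \<in> cball 0 1. q0 x \<in> Q} = sphere 0 1 \<or>
         (\<exists>v. v \<noteq> 0 \<and> {x \<in> cball 0 1. q0 x \<in> Q} = {x \<in> cball 0 1. v \<bullet> x = 0})"
    unfolding standard_plane_def by blast
  \<comment> \<open>Transporting the ball model along with the plane makes \<open>P\<close> itself
    the boundary sphere or a diametral disk in the model \<open>q\<close>.\<close>
  define q where "q = \<Phi> \<circ> q0"
  have Qs: "Q \<subseteq> topspace RP3"
    using Q unfolding projective_plane_def closed_surface_def by (auto dest: compactin_subset_topspace)
  have bij: "bij_betw \<Phi> (topspace RP3) (topspace RP3)" using F by (simp add: diffeo_RP3_def)
  have q0c: "quotient_map (top_of_set (cball 0 1)) RP3 q0" using q0 by (simp add: ball_model_def)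
  have q: "quotient_map (top_of_set (cball 0 1)) RP3 q"
    unfolding q_def
    by (rule quotient_map_compose[OF q0c diffeo_RP3_homeomorphic_map[OF F, unfolded homeomorphic_map_def, THEN conjunct1]])
  have q0s: "q0 x \<in> topspace RP3" if "x \<in> cball 0 1" for x
    using q0c that unfolding quotient_map_def by auto
  have qeq: "q x = q y \<longleftrightarrow> x = y \<or> (norm x = 1 \<and> y = - x)" if "x \<in> cball 0 1" "y \<in> cball 0 1" for x y
    using q0 that inj_on_eq_iff[OF bij_betw_imp_inj_on[OF bij] q0s[OF that(1)] q0s[OF that(2)]]
    by (simp add: q_def ball_model_def)
  have qP: "q x \<in> P \<longleftrightarrow> q0 x \<in> Q" if "x \<in> cball 0 1" for x
    unfolding q_def P[symmetric] using inj_on_image_mem_iff[OF bij_betw_imp_inj_on[OF bij] q0s[OF that] Qs] by simp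
  define C where "C = topspace RP3 - P"
  have KC: "knot_image tknot \<subseteq> C" using disj tknot_in_RP3 by (auto simp: C_def)
  have qC: "q x \<in> C \<longleftrightarrow> q0 x \<notin> Q" if "x \<in> cball 0 1" for x
    using qP[OF that] q that unfolding quotient_map_def C_def by auto
  have cq: "continuous_on (cball 0 1) (\<lambda>x. embed (q x))"
    using continuous_map_compose[OF quotient_imp_continuous_map[OF q] continuous_map_embed] by (simp add: o_def)
  have qs: "q x \<in> topspace RP3" if "x \<in> cball 0 1" for x
    using q that unfolding quotient_map_def by auto
  obtain \<sigma> where \<sigma>: "continuous_on (cball 0 1) \<sigma>" "\<And>x. x \<in> cball 0 1 \<Longrightarrow> \<sigma> x \<in> sphere 0 1"
    "\<And>x. x \<in> cball 0 1 \<Longrightarrow> antipodal_pair (\<sigma> x) = q x"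
    using lift_to_sphere[OF _ _ cq qs] convex_imp_simply_connected[OF convex_cball]
      convex_imp_locally_path_connected[OF convex_cball] by metis
  from QW show False
  proof (elim disjE exE conjE)
    \<comment> \<open>The complement of the plane is the open ball, on which \<open>q\<close> is
      injective, so sections and logarithms descend at once.\<close>
    assume S: "{x \<in> cball 0 1. q0 x \<in> Q} = sphere 0 1"
    have "\<not> knot_image tknot \<subseteq> C"
    proof (rule tknot_not_in_trivially_covered_set[OF q, of "ball 0 1" C \<sigma>])
      show "openin (top_of_set (cball 0 1)) (ball 0 (1::real) :: (real^3) set)"
        unfolding openin_open by (intro exI[of _ "ball 0 1"]) auto
      show "x \<in> ball 0 1 \<longleftrightarrow> q x \<in> C" if "x \<in> cball 0 1" for x
      proof -
        have "x \<in> sphere 0 1 \<longleftrightarrow> q0 x \<in> Q" using that unfolding S[symmetric] by simp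
        then show ?thesis using qC[OF that] that by auto
      qed
      show inj: "\<sigma> x = \<sigma> y" if "x \<in> ball 0 1" "y \<in> ball 0 1" "q x = q y" for x y
        using qeq[of x y] that by auto
      show "\<exists>L. continuous_on (ball 0 1) L \<and> (\<forall>x\<in>ball 0 1. exp (L x) = G x) \<and>
          (\<forall>x\<in>ball 0 1. \<forall>y\<in>ball 0 1. q x = q y \<longrightarrow> L x = L y)"
        if G: "continuous_on (ball 0 1) G" "\<And>x. x \<in> ball 0 1 \<Longrightarrow> G x \<noteq> 0" for G :: "real^3 \<Rightarrow> complex"
      proof -
        obtain L where "continuous_on (ball 0 1) L" "\<And>x. x \<in> ball 0 1 \<Longrightarrow> exp (L x) = G x"
          using logarithm_on_convex[OF G(1) convex_ball G(2)] by blast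
        moreover have "L x = L y" if "x \<in> ball 0 1" "y \<in> ball 0 1" "q x = q y" for x y
          using qeq[of x y] that by auto
        ultimately show ?thesis by blast
      qed
    qed (use \<sigma> in \<open>auto simp: C_def intro: continuous_on_subset\<close>)
    then show False using KC by blast
  next
    fix v :: "real^3"
    assume v: "v \<noteq> 0" and D: "{x \<in> cball 0 1. q0 x \<in> Q} = {x \<in> cball 0 1. v \<bullet> x = 0}"
    let ?U = "{x \<in> cball 0 1. v \<bullet> x > 0}" and ?V = "{x \<in> cball 0 1. v \<bullet> x < 0}"
    have sph: "connected (sphere (0::real^3) 1)" by (simp add: connected_sphere)
    have "(\<forall>x\<in>sphere 0 1. \<sigma> (- x) = \<sigma> x) \<or> (\<forall>x\<in>sphere 0 1. \<sigma> (- x) = - \<sigma> x)"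
    proof (rule lifts_agree_up_to_sign[OF sph])
      show "continuous_on (sphere 0 1) (\<lambda>x. \<sigma> (- x))"
        by (rule continuous_on_compose2[OF \<sigma>(1)]) (auto intro!: continuous_intros)
      show "antipodal_pair (\<sigma> (- x)) = antipodal_pair (\<sigma> x)" if "x \<in> sphere 0 1" for x
        using \<sigma>(3)[of x] \<sigma>(3)[of "- x"] qeq[of x "- x"] that by auto
    qed (use \<sigma> in \<open>auto intro: continuous_on_subset\<close>)
    then obtain e :: real where e: "e = 1 \<or> e = -1" "\<And>x. x \<in> sphere 0 1 \<Longrightarrow> \<sigma> (- x) = e *\<^sub>R \<sigma> x"
      by (metis scaleR_minus1_left scaleR_one)
    \<comment> \<open>The complement of the disk is two half balls, glued along boundary hemispheres
      by the antipode. The correction by \<open>e\<close> on the lower half makes the lift agree at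
      glued points.\<close>
    define \<tau> where "\<tau> x = (if v \<bullet> x > 0 then \<sigma> x else e *\<^sub>R \<sigma> x)" for x
    have oU: "openin (top_of_set (?U \<union> ?V)) ?U"
      unfolding openin_open by (intro exI[of _ "{x. v \<bullet> x > 0}"]) (auto simp: open_halfspace_gt)
    have oV: "openin (top_of_set (?U \<union> ?V)) ?V"
      unfolding openin_open by (intro exI[of _ "{x. v \<bullet> x < 0}"]) (auto simp: open_halfspace_lt)
    have qUV: "x = y \<or> (norm x = 1 \<and> y = - x \<and> (x \<in> ?U \<longleftrightarrow> y \<in> ?V) \<and> (x \<in> ?V \<longleftrightarrow> y \<in> ?U))"
      if "x \<in> ?U \<union> ?V" "y \<in> ?U \<union> ?V" "q x = q y" for x y
      using qeq[of x y] that by auto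
    have "\<not> knot_image tknot \<subseteq> C"
    proof (rule tknot_not_in_trivially_covered_set[OF q, of "?U \<union> ?V" C \<tau>])
      show "openin (top_of_set (cball 0 1)) (?U \<union> ?V)"
        unfolding openin_open by (intro exI[of _ "{x. v \<bullet> x > 0} \<union> {x. v \<bullet> x < 0}"])
          (auto simp: open_halfspace_lt open_halfspace_gt)
      show "x \<in> ?U \<union> ?V \<longleftrightarrow> q x \<in> C" if "x \<in> cball 0 1" for x
      proof -
        have "x \<in> {x \<in> cball 0 1. q0 x \<in> Q} \<longleftrightarrow> v \<bullet> x = 0" using that unfolding D by simp
        then show ?thesis using qC[OF that] that by auto
      qed
      show "continuous_on (?U \<union> ?V) \<tau>"
        unfolding \<tau>_def
        by (rule continuous_on_cases_local_open[OF oU oV])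
          (auto intro!: continuous_intros continuous_on_subset[OF \<sigma>(1)])
      show "\<tau> x \<in> sphere 0 1" if "x \<in> ?U \<union> ?V" for x
        using \<sigma>(2)[of x] that e(1) by (auto simp: \<tau>_def)
      show "antipodal_pair (\<tau> x) = q x" if "x \<in> ?U \<union> ?V" for x
        using \<sigma>(3)[of x] that antipodal_pair_scale[OF e(1), of "\<sigma> x"] by (auto simp: \<tau>_def)
      show "\<tau> x = \<tau> y" if "x \<in> ?U \<union> ?V" "y \<in> ?U \<union> ?V" "q x = q y" for x y
        using qUV[OF that] that(1,2) e(1) e(2)[of x] by (auto simp: \<tau>_def)
      show "\<exists>L. continuous_on (?U \<union> ?V) L \<and> (\<forall>x\<in>?U \<union> ?V. exp (L x) = G x) \<and>
          (\<forall>x\<in>?U \<union> ?V. \<forall>y\<in>?U \<union> ?V. q x = q y \<longrightarrow> L x = L y)"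
        if G: "continuous_on (?U \<union> ?V) G" "\<And>x. x \<in> ?U \<union> ?V \<Longrightarrow> G x \<noteq> 0"
          "\<And>x y. x \<in> ?U \<union> ?V \<Longrightarrow> y \<in> ?U \<union> ?V \<Longrightarrow> q x = q y \<Longrightarrow> G x = G y" for G :: "real^3 \<Rightarrow> complex"
      proof -
        have "?U = cball 0 1 \<inter> {x. v \<bullet> x > 0}" "?V = cball 0 1 \<inter> {x. v \<bullet> x < 0}" by auto
        then have cv: "convex ?U" "convex ?V"
          by (simp_all only: convex_Int convex_halfspace_gt convex_halfspace_lt convex_cball)
        obtain L where L: "continuous_on ?U L" "\<And>x. x \<in> ?U \<Longrightarrow> exp (L x) = G x"
          by (rule logarithm_on_convex[OF continuous_on_subset[OF G(1), of ?U] cv(1) G(2)]) auto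
        obtain M where M: "continuous_on ?V M" "\<And>x. x \<in> ?V \<Longrightarrow> exp (M x) = G x"
          by (rule logarithm_on_convex[OF continuous_on_subset[OF G(1), of ?V] cv(2) G(2)]) auto
        let ?H = "{x \<in> sphere 0 1. v \<bullet> x > 0}"
        \<comment> \<open>The open hemisphere of gluing is the radial projection of a half space.
          Being connected, it allows the logarithms on the two half balls to differ there by a
          single constant, which \<open>N\<close> removes.\<close>
        have "connected ((\<lambda>x. x /\<^sub>R norm x) ` {x. v \<bullet> x > 0})"
          by (rule connected_continuous_image)
            (auto intro!: continuous_intros convex_connected convex_halfspace_gt)
        moreover have "(\<lambda>x. x /\<^sub>R norm x) ` {x. v \<bullet> x > 0} = ?H"
        proof
          show "?H \<subseteq> (\<lambda>x. x /\<^sub>R norm x) ` {x. v \<bullet> x > 0}"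
            by (auto intro!: image_eqI)
          show "(\<lambda>x. x /\<^sub>R norm x) ` {x. v \<bullet> x > 0} \<subseteq> ?H"
          proof (rule image_subsetI)
            fix x assume x: "x \<in> {x. v \<bullet> x > 0}"
            then have "norm x > 0" by auto
            then show "x /\<^sub>R norm x \<in> ?H" using x by simp
          qed
        qed
        ultimately have "connected ?H" by simp
        moreover have "continuous_on ?H L" by (rule continuous_on_subset[OF L(1)]) auto
        moreover have "continuous_on ?H (\<lambda>x. M (- x))"
          by (rule continuous_on_compose2[OF M(1)]) (auto intro!: continuous_intros)
        moreover have "exp (L x) = exp (M (- x))" if "x \<in> ?H" for x
          using that L(2)[of x] M(2)[of "- x"] G(3)[of x "- x"] qeq[of x "- x"] by auto
        ultimately obtain k :: int where k: "\<And>x. x \<in> ?H \<Longrightarrow> L x = M (- x) + 2 * of_int k * of_real pi * \<i>"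
          using logs_differ_by_constant[of ?H L "\<lambda>x. M (- x)"] by blast
        define N where "N x = (if v \<bullet> x > 0 then L x else M x + 2 * of_int k * of_real pi * \<i>)" for x
        have "continuous_on (?U \<union> ?V) N"
          unfolding N_def
          by (rule continuous_on_cases_local_open[OF oU oV L(1) continuous_on_add[OF M(1) continuous_on_const]])
            auto
        moreover have "exp (M x + 2 * of_int k * of_real pi * \<i>) = exp (M x)" for x
          by (simp add: exp_eq)
        then have "exp (N x) = G x" if "x \<in> ?U \<union> ?V" for x
          using that L(2)[of x] M(2)[of x] by (auto simp: N_def)
        moreover have "N x = N y" if "x \<in> ?U \<union> ?V" "y \<in> ?U \<union> ?V" "q x = q y" for x y
          using qUV[OF that] that(1,2) k[of x] k[of y] by (auto simp: N_def)
        ultimately show ?thesis by blast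
      qed
    qed (auto simp: C_def)
    then show False using KC by blast
  qed
qed

text \<open>A logarithm of \<open>R\<close> along the homotopy \<open>h\<close> exists on the strip
  \<open>D\<close>, and its gain over the period 2 pi is the same for all \<open>r\<close>. At
  \<open>r = 0\<close> the path already closes up after \<open>pi / n\<close>, so the gain is
  \<open>2 * n\<close> times a gain over \<open>pi / n\<close>; at \<open>r = a\<close> it is the
  gain of \<open>M\<close>.\<close>

lemma log_increment_divisible:
  assumes R: "continuous_on (sphere 0 1) R" "\<And>x. x \<in> sphere 0 1 \<Longrightarrow> R x = 0 \<Longrightarrow> defect x = 0"
    and M: "continuous_on {0..2 * pi} M" "\<And>t. t \<in> {0..2 * pi} \<Longrightarrow> exp (M t) = R (- curve (cis t))"
  obtains j :: int where "M (2 * pi) - M 0 = 2 * of_int (2 * int n * j) * of_real pi * \<i>"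
proof -
  \<comment> \<open>Since \<open>sqrt (1 - a\<^sup>2) = a ^ (2 * n)\<close>, the end
    \<open>r = a\<close> is the antipode of the curve, and the end \<open>r = 0\<close> is the
    circle \<open>z = 0\<close> traversed \<open>2 * n\<close> times. The arguments are chosen so
    that the two terms of \<open>defect\<close> are parallel and cannot cancel.\<close>
  define h where "h = (\<lambda>(r, t). - mk (of_real r * cis t) (of_real (sqrt (1 - r\<^sup>2)) * cis (real (2 * n) * t)))"
  define D where "D = {0..a} \<times> (UNIV :: real set)"
  have a1: "r\<^sup>2 \<le> 1" if "r \<in> {0..a}" for r
  proof -
    have "r\<^sup>2 \<le> a\<^sup>2" using that by (intro power_mono) auto
    also have "\<dots> \<le> 1" using a(2) zero_le_power2[of "a ^ (2 * n)"] by linarith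
    finally show ?thesis .
  qed
  have b: "sqrt (1 - a\<^sup>2) = a ^ (2 * n)"
    using a by (intro real_sqrt_unique) auto
  have hs: "h p \<in> sphere 0 1" if "p \<in> D" for p
    using that a1 unfolding sphere_C2_iff h_def D_def by (auto simp: norm_mult)
  have hd: "defect (h p) \<noteq> 0" if p: "p \<in> D" for p
  proof -
    obtain r t where rt: "p = (r, t)" "r \<in> {0..a}" using p by (auto simp: D_def)
    have "(complex_of_real r * cis t) ^ (2 * n) = of_real (r ^ (2 * n)) * cis (real (2 * n) * t)"
      by (simp only: power_mult_distrib Complex.DeMoivre of_real_power)
    then have "defect (h p) = - of_real (sqrt (1 - r\<^sup>2) + r ^ (2 * n)) * cis (real (2 * n) * t)"
      by (simp add: defect_def h_def rt(1) algebra_simps)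
    moreover have "sqrt (1 - r\<^sup>2) + r ^ (2 * n) > 0"
    proof (cases "r = 0")
      case False
      then show ?thesis using rt a1 by (intro add_nonneg_pos) auto
    qed (simp add: add_pos_nonneg)
    ultimately show ?thesis by (metis cis_neq_zero mult_eq_0_iff neg_equal_0_iff_equal of_real_eq_0_iff less_irrefl)
  qed
  have "continuous_on D h"
    unfolding h_def case_prod_beta by (intro continuous_intros)
  then have "continuous_on D (\<lambda>p. R (h p))"
    using hs by (intro continuous_on_compose2[OF R(1)]) auto
  moreover have "convex D" unfolding D_def by (intro convex_Times) auto
  ultimately obtain \<Lambda> where \<Lambda>: "continuous_on D \<Lambda>" "\<And>p. p \<in> D \<Longrightarrow> exp (\<Lambda> p) = R (h p)"
    using hd R(2) hs by (metis logarithm_on_convex)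
  have conD: "connected D" using \<open>convex D\<close> convex_connected by blast
  define \<Lambda>' where "\<Lambda>' p = \<Lambda> (fst p, snd p + 2 * pi)" for p
  have c2: "continuous_on D \<Lambda>'"
    unfolding \<Lambda>'_def
    by (rule continuous_on_compose2[OF \<Lambda>(1)]) (auto simp: D_def intro!: continuous_intros)
  have e2: "exp (\<Lambda>' p) = exp (\<Lambda> p)" if "p \<in> D" for p
  proof -
    have "cis (real (2 * n) * (snd p + 2 * pi)) = cis (real (2 * n) * snd p) * cis (2 * pi * real (2 * n))"
      by (simp only: distrib_left cis_mult mult.commute)
    also have "\<dots> = cis (real (2 * n) * snd p)" by (simp only: cis_multiple_2pi Ints_of_nat mult_1_right)
    finally have "h (fst p, snd p + 2 * pi) = h p"
      by (simp add: h_def case_prod_beta)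
        (simp add: cis_mult[symmetric])
    then show ?thesis using \<Lambda>(2)[OF that] \<Lambda>(2)[of "(fst p, snd p + 2 * pi)"] that
      by (auto simp: D_def \<Lambda>'_def)
  qed
  obtain k :: int where k: "\<And>p. p \<in> D \<Longrightarrow> \<Lambda>' p = \<Lambda> p + 2 * of_int k * of_real pi * \<i>"
    using logs_differ_by_constant[OF conD c2 \<Lambda>(1) e2] by blast
  have c3: "continuous_on UNIV (\<lambda>t. \<Lambda> (0, t + pi / n))" "continuous_on UNIV (\<lambda>t. \<Lambda> (0, t))"
    using a by (auto intro!: continuous_on_compose2[OF \<Lambda>(1)] continuous_intros simp: D_def)
  have e3: "exp (\<Lambda> (0, t + pi / n)) = exp (\<Lambda> (0, t))" for t
  proof -
    have "real (2 * n) * (t + pi / n) = real (2 * n) * t + 2 * pi"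
      using n by (simp add: field_simps)
    then have "h (0, t + pi / n) = h (0, t)"
      unfolding h_def prod.case by (simp add: cis_mult[symmetric])
    then show ?thesis using \<Lambda>(2)[of "(0, t + pi / n)"] \<Lambda>(2)[of "(0, t)"] a by (simp add: D_def)
  qed
  obtain j :: int where j: "\<And>t. t \<in> UNIV \<Longrightarrow> \<Lambda> (0, t + pi / n) = \<Lambda> (0, t) + 2 * of_int j * of_real pi * \<i>"
    using logs_differ_by_constant[OF connected_UNIV c3 e3] by blast
  have "\<Lambda> (0, 0 + of_int (2 * int n) * (pi / n)) = \<Lambda> (0, 0) + of_int (2 * int n) *\<^sub>R (2 * of_int j * of_real pi * \<i>)"
    by (rule shift_by_int_multiple) (use j in simp)
  moreover have "0 + of_int (2 * int n) * (pi / n) = 0 + 2 * pi" using n by simp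
  ultimately have "\<Lambda> (0, 0 + 2 * pi) = \<Lambda> (0, 0) + 2 * of_int (2 * int n * j) * of_real pi * \<i>"
    by (simp add: scaleR_conv_of_real algebra_simps)
  moreover have "\<Lambda> (0, 0 + 2 * pi) = \<Lambda> (0, 0) + 2 * of_int k * of_real pi * \<i>"
    using k[of "(0, 0)"] a by (simp add: D_def \<Lambda>'_def)
  ultimately have kj: "(of_int k :: complex) = of_int (2 * int n * j)" by (simp add: ac_simps)
  have ha: "h (a, t) = - curve (cis t)" for t
    unfolding h_def curve_def prod.case b by (simp only: power_mult_distrib Complex.DeMoivre of_real_power)
  have c4: "continuous_on {0..2 * pi} (\<lambda>t. \<Lambda> (a, t))"
    using a by (intro continuous_on_compose2[OF \<Lambda>(1)] continuous_intros) (auto simp: D_def)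
  have e4: "exp (M t) = exp (\<Lambda> (a, t))" if "t \<in> {0..2 * pi}" for t
    using M(2)[OF that] \<Lambda>(2)[of "(a, t)"] a ha by (simp add: D_def)
  obtain l :: int where l: "\<And>t. t \<in> {0..2 * pi} \<Longrightarrow> M t = \<Lambda> (a, t) + 2 * of_int l * of_real pi * \<i>"
    using logs_differ_by_constant[OF connected_Icc M(1) c4 e4] by blast
  have "M (2 * pi) - M 0 = \<Lambda> (a, 0 + 2 * pi) - \<Lambda> (a, 0)" using l[of 0] l[of "2 * pi"] by simp
  also have "\<dots> = 2 * of_int k * of_real pi * \<i>" using k[of "(a, 0)"] a by (simp add: D_def \<Lambda>'_def)
  finally show thesis using that[of j] kj by simp
qed

end


subsection \<open>The knots are not isotopic\<close>

text \<open>Pulling the target defect back by \<open>e *\<^sub>R \<Psi>\<close> gives a function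
  that vanishes only on the source curve. Along the antipode it winds \<open>2 * n' * d\<close>
  times, where \<open>d\<close> is the degree of the induced map of circles, and
  \<open>log_increment_divisible\<close> makes this a multiple of \<open>2 * n\<close>.\<close>

lemma (in torus_knot) reparametrization_degree:
  assumes T': "torus_knot n' a'" and hom: "homeomorphism (sphere 0 1) (sphere 0 1) \<Psi> \<Psi>'"
    and odd: "\<And>x. x \<in> sphere 0 1 \<Longrightarrow> \<Psi> (- x) = - \<Psi> x"
    and A: "\<And>c. cmod c = 1 \<Longrightarrow> \<exists>d. cmod d = 1 \<and> antipodal_pair (\<Psi> (curve c)) = torus_knot.tknot n' a' d"
    and B: "\<And>x d. x \<in> sphere 0 1 \<Longrightarrow> cmod d = 1 \<Longrightarrow> antipodal_pair (\<Psi> x) = torus_knot.tknot n' a' d \<Longrightarrow>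
        \<exists>c. cmod c = 1 \<and> antipodal_pair x = tknot c"
  obtains e \<theta> and d :: int where "e = 1 \<or> e = (-1::real)"
    "\<And>t. e *\<^sub>R \<Psi> (curve (cis t)) = torus_knot.curve n' a' (cis (\<theta> t))"
    "continuous_on UNIV \<theta>" "\<And>t. \<theta> (t + 2 * pi) = \<theta> t + 2 * pi * of_int d" "int n dvd int n' * d"
proof -
  interpret T: torus_knot n' a' by (rule T')
  have c\<Psi>: "continuous_on (sphere 0 1) \<Psi>" and \<Psi>s: "\<And>x. x \<in> sphere 0 1 \<Longrightarrow> \<Psi> x \<in> sphere 0 1"
    using homeomorphism_cont1[OF hom] homeomorphism_image1[OF hom] by auto
  define g where "g t = \<Psi> (curve (cis t))" for t
  have cg: "continuous_on S g" for S
    unfolding g_def by (rule continuous_on_compose2[OF c\<Psi>]) (auto intro!: continuous_intros)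
  have cur: "\<exists>d. cmod d = 1 \<and> (g t = T.curve d \<or> - g t = T.curve d)" for t
    using A[of "cis t"] by (auto simp: T.tknot_def antipodal_pair_eq_iff g_def)
  \<comment> \<open>The image of the curve cannot switch between the two lifts of the target knot:
    the two closed sets of parameters are disjoint and cover the connected line.\<close>
  have "{t. T.defect (g t) = 0} \<inter> UNIV = {} \<or> {t. T.defect (- g t) = 0} \<inter> UNIV = {}"
  proof (rule connected_closedD[OF connected_UNIV])
    show "closed {t. T.defect (g t) = 0}" "closed {t. T.defect (- g t) = 0}"
      by (intro closed_Collect_eq continuous_intros cg)+
    have "T.defect (g t) = 0 \<or> T.defect (- g t) = 0" for t
      using cur[of t] T.defect_curve by metis
    then show "UNIV \<subseteq> {t. T.defect (g t) = 0} \<union> {t. T.defect (- g t) = 0}" by blast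
    have "\<not> (T.defect (g t) = 0 \<and> T.defect (- g t) = 0)" for t
      using cur[of t] T.defect_minus_curve_ne_0 by (metis add.inverse_inverse)
    then show "{t. T.defect (g t) = 0} \<inter> {t. T.defect (- g t) = 0} \<inter> UNIV = {}" by blast
  qed
  then have "(\<forall>t. T.defect (g t) \<noteq> 0) \<or> (\<forall>t. T.defect (- g t) \<noteq> 0)" by blast
  then obtain e :: real where e: "e = 1 \<or> e = -1" and eg: "\<And>t. \<exists>d. cmod d = 1 \<and> e *\<^sub>R g t = T.curve d"
    using cur T.defect_curve by (metis scaleR_minus1_left scaleR_one)
  define y where "y t = zc (e *\<^sub>R g t) / of_real a'" for t
  have y: "cmod (y t) = 1" "e *\<^sub>R g t = T.curve (y t)" for t
  proof -
    obtain d where "cmod d = 1" "e *\<^sub>R g t = T.curve d" using eg by blast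
    moreover from this have "y t = d" using T.a by (simp add: y_def T.curve_def)
    ultimately show "cmod (y t) = 1" "e *\<^sub>R g t = T.curve (y t)" by auto
  qed
  have "continuous_on UNIV y" unfolding y_def using T.a by (intro continuous_intros cg) auto
  moreover have "y t \<noteq> 0" for t using y(1)[of t] by auto
  ultimately obtain l where l: "continuous_on UNIV l" "\<And>t. exp (l t) = y t"
    using logarithm_on_convex[of UNIV y] by auto
  define \<theta> where "\<theta> t = Im (l t)" for t
  have cis\<theta>: "cis (\<theta> t) = y t" for t
  proof -
    have "exp (Re (l t)) = 1" using l(2)[of t] y(1)[of t] norm_exp_eq_Re[of "l t"] by simp
    then show ?thesis using l(2)[of t] exp_eq_polar[of "l t"] by (simp add: \<theta>_def)
  qed
  have c\<theta>: "continuous_on S \<theta>" for S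
    unfolding \<theta>_def by (intro continuous_intros continuous_on_subset[OF l(1)]) auto
  have c1: "continuous_on UNIV (\<lambda>t. \<i> * of_real (\<theta> (t + 2 * pi)))" "continuous_on UNIV (\<lambda>t. \<i> * of_real (\<theta> t))"
    by (intro continuous_on_mult continuous_on_of_real continuous_on_const
        continuous_on_compose2[OF c\<theta>[of UNIV], of UNIV "\<lambda>t. t + 2 * pi"] c\<theta>; auto intro!: continuous_intros)+
  have e1: "exp (\<i> * of_real (\<theta> (t + 2 * pi))) = exp (\<i> * of_real (\<theta> t))" for t
  proof -
    have "y (t + 2 * pi) = y t" by (simp add: y_def g_def cis_mult[symmetric])
    then show ?thesis using cis\<theta>[of t] cis\<theta>[of "t + 2 * pi"] by (simp add: cis_conv_exp)
  qed
  obtain d :: int where d: "\<And>t. t \<in> UNIV \<Longrightarrow> \<i> * of_real (\<theta> (t + 2 * pi)) = \<i> * of_real (\<theta> t) + 2 * of_int d * of_real pi * \<i>"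
    using logs_differ_by_constant[OF connected_UNIV c1 e1] by blast
  have \<theta>d: "\<theta> (t + 2 * pi) = \<theta> t + 2 * pi * of_int d" for t
    using arg_cong[OF d[of t], of Im] by simp
  define R where "R x = T.defect (e *\<^sub>R \<Psi> x)" for x
  define M where "M t = Ln (- 2 * of_real a' ^ (2 * n')) + of_nat (2 * n') * of_real (\<theta> t) * \<i>" for t
  have cR: "continuous_on (sphere 0 1) R" unfolding R_def by (intro continuous_intros c\<Psi>)
  have R0: "defect x = 0" if x: "x \<in> sphere 0 1" "R x = 0" for x
  proof -
    have "e *\<^sub>R \<Psi> x \<in> sphere 0 1" using \<Psi>s[OF x(1)] e by auto
    then obtain c where c: "cmod c = 1" "e *\<^sub>R \<Psi> x = T.curve c"
      using T.defect_eq_0_iff x(2) unfolding R_def by blast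
    then have "antipodal_pair (\<Psi> x) = T.tknot c"
      using antipodal_pair_scale[OF e, of "\<Psi> x"] by (simp add: T.tknot_def)
    then obtain c' where c': "cmod c' = 1" "antipodal_pair x = tknot c'" using B x c by blast
    then obtain t where t: "c' = cis t" using unit_circle_iff[of c'] by auto
    from c'(2) have "x = curve c' \<or> x = - curve c'" by (simp add: tknot_def antipodal_pair_eq_iff)
    \<comment> \<open>Oddness sends the antipode of the source curve to the antipode of the target
      curve, where the target defect does not vanish.\<close>
    moreover have "x \<noteq> - curve c'"
    proof
      assume "x = - curve c'"
      then have "e *\<^sub>R \<Psi> x = - (e *\<^sub>R g t)" using odd[of "curve c'"] t by (simp add: g_def)
      then have "T.curve c = - T.curve (y t)" using c(2) y(2)[of t] by simp
      then show False using T.curve_neq_minus[OF y(1)] by blast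
    qed
    ultimately show ?thesis by auto
  qed
  have cM: "continuous_on {0..2 * pi} M" unfolding M_def by (intro continuous_intros c\<theta>)
  have eM: "exp (M t) = R (- curve (cis t))" for t
  proof -
    have "R (- curve (cis t)) = T.defect (- (e *\<^sub>R g t))"
      using odd[of "curve (cis t)"] by (simp add: R_def g_def)
    also have "\<dots> = - 2 * (of_real a' * cis (\<theta> t)) ^ (2 * n')"
      unfolding y(2) cis\<theta> T.defect_minus_curve ..
    also have "\<dots> = (- 2 * of_real a' ^ (2 * n')) * exp (of_nat (2 * n') * (\<i> * of_real (\<theta> t)))"
      by (simp only: power_mult_distrib cis_conv_exp exp_of_nat_mult mult.assoc)
    also have "\<dots> = exp (M t)"
      using T.a by (simp add: M_def exp_add mult.commute mult.left_commute)
    finally show ?thesis by simp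
  qed
  obtain j :: int where j: "M (2 * pi) - M 0 = 2 * of_int (2 * int n * j) * of_real pi * \<i>"
    using log_increment_divisible[OF cR R0 cM eM] by blast
  have "of_nat (2 * n') * (2 * pi * of_int d) = 2 * of_int (2 * int n * j) * pi"
    using arg_cong[OF j, of Im] \<theta>d[of 0] by (simp add: M_def algebra_simps)
  then have "real_of_int (int n' * d) = real_of_int (int n * j)" by simp
  then have "int n' * d = int n * j" by linarith
  then have "int n dvd int n' * d" by simp
  with e y(2) cis\<theta> c\<theta> \<theta>d show thesis by (intro that[of e \<theta> d]) (auto simp: g_def)
qed

text \<open>The lifted diffeomorphism and its inverse reparametrize the curves with degrees
  \<open>d\<close> and \<open>d'\<close>. Since \<open>d * d' = 1\<close>, the two divisibilities
  reduce to \<open>m\<close> dividing \<open>n\<close> and \<open>n\<close> dividing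
  \<open>m\<close>.\<close>

lemma isotopic_torus_knots_eq:
  assumes "torus_knot m a" "torus_knot n b"
    and iso: "ambient_isotopic (knot_image (torus_knot.tknot m a)) (knot_image (torus_knot.tknot n b))"
  shows "m = n"
proof -
  interpret A: torus_knot m a by fact
  interpret B: torus_knot n b by fact
  obtain F where F: "diffeo_RP3 F" and FK: "F ` knot_image A.tknot = knot_image B.tknot"
    using ambient_isotopicD[OF iso] by blast
  obtain \<Psi> \<Psi>' where hom: "homeomorphism (sphere 0 1) (sphere 0 1) \<Psi> \<Psi>'"
    and l: "\<And>x. x \<in> sphere 0 1 \<Longrightarrow> antipodal_pair (\<Psi> x) = F (antipodal_pair x)"
    and odd: "\<And>x. x \<in> sphere 0 1 \<Longrightarrow> \<Psi> (- x) = - \<Psi> x" "\<And>x. x \<in> sphere 0 1 \<Longrightarrow> \<Psi>' (- x) = - \<Psi>' x"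
    using lift_diffeo_RP3[OF F] by metis
  have \<Psi>': "\<Psi>' x \<in> sphere 0 1" "\<Psi> (\<Psi>' x) = x" if "x \<in> sphere 0 1" for x
    using homeomorphism_image2[OF hom] homeomorphism_apply2[OF hom that] that by blast+
  have inj: "inj_on F (topspace RP3)" using F unfolding diffeo_RP3_def bij_betw_def by blast
  have fwd: "\<exists>d. cmod d = 1 \<and> antipodal_pair (\<Psi> x) = B.tknot d"
    if "x \<in> sphere 0 1" "cmod c = 1" "antipodal_pair x = A.tknot c" for x c
  proof -
    have "F (A.tknot c) \<in> knot_image B.tknot" unfolding FK[symmetric] using that by auto
    then show ?thesis using l[OF that(1)] that(3) by auto
  qed
  have bwd: "\<exists>c. cmod c = 1 \<and> antipodal_pair x = A.tknot c"
    if "x \<in> sphere 0 1" "cmod d = 1" "antipodal_pair (\<Psi> x) = B.tknot d" for x d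
  proof -
    have "F (antipodal_pair x) \<in> F ` knot_image A.tknot" unfolding FK using that l by auto
    then obtain c where c: "cmod c = 1" "F (antipodal_pair x) = F (A.tknot c)" by auto
    then have "antipodal_pair x = A.tknot c"
      using inj_onD[OF inj c(2)] that(1) A.tknot_in_RP3 by auto
    then show ?thesis using c by blast
  qed
  obtain e \<theta> d where e: "e = 1 \<or> e = (-1::real)"
    and \<theta>: "\<And>t. e *\<^sub>R \<Psi> (A.curve (cis t)) = B.curve (cis (\<theta> t))" "continuous_on UNIV \<theta>"
      "\<And>t. \<theta> (t + 2 * pi) = \<theta> t + 2 * pi * of_int d" and mn: "int m dvd int n * d"
    by (rule A.reparametrization_degree[OF \<open>torus_knot n b\<close> hom odd(1)])
      (use fwd bwd in \<open>auto simp: A.tknot_def\<close>)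
  obtain e' \<theta>' d' where e': "e' = 1 \<or> e' = (-1::real)"
    and \<theta>': "\<And>t. e' *\<^sub>R \<Psi>' (B.curve (cis t)) = A.curve (cis (\<theta>' t))" "continuous_on UNIV \<theta>'"
      "\<And>t. \<theta>' (t + 2 * pi) = \<theta>' t + 2 * pi * of_int d'" and nm: "int n dvd int m * d'"
  proof (rule B.reparametrization_degree[OF \<open>torus_knot m a\<close> homeomorphism_symD[OF hom] odd(2)])
    show "\<exists>d. cmod d = 1 \<and> antipodal_pair (\<Psi>' (B.curve c)) = A.tknot d" if "cmod c = 1" for c
      using bwd[OF \<Psi>'(1)[of "B.curve c"] that] \<Psi>'(2)[of "B.curve c"] that by (simp add: B.tknot_def)
    show "\<exists>c. cmod c = 1 \<and> antipodal_pair x = B.tknot c"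
      if "x \<in> sphere 0 1" "cmod d = 1" "antipodal_pair (\<Psi>' x) = A.tknot d" for x d
      using fwd[OF \<Psi>'(1)[OF that(1)] that(2,3)] \<Psi>'(2)[OF that(1)] by simp
  qed blast+
  have comp: "cis (\<theta>' (\<theta> t)) = cis t" for t
  proof -
    let ?x = "A.curve (cis t)"
    have x: "?x \<in> sphere 0 1" by simp
    have "\<Psi> ?x \<in> sphere 0 1" using homeomorphism_image1[OF hom] x by blast
    then have "\<Psi>' (e *\<^sub>R \<Psi> ?x) = e *\<^sub>R ?x"
      using e odd(2)[of "\<Psi> ?x"] homeomorphism_apply1[OF hom x] by auto
    then have "A.curve (cis (\<theta>' (\<theta> t))) = (e' * e) *\<^sub>R ?x"
      using \<theta>'(1)[of "\<theta> t"] \<theta>(1)[of t] by simp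
    moreover have "e' * e = 1 \<or> e' * e = -1" using e e' by auto
    ultimately show ?thesis
      using A.curve_neq_minus[of "cis t" "cis (\<theta>' (\<theta> t))"] by (auto simp: A.curve_eq_iff)
  qed
  have c1: "continuous_on UNIV (\<lambda>t. \<i> * of_real (\<theta>' (\<theta> t)))" "continuous_on UNIV (\<lambda>t::real. \<i> * of_real t)"
    by (intro continuous_on_mult continuous_on_of_real continuous_on_const continuous_on_id
        continuous_on_compose2[OF \<theta>'(2) \<theta>(2)]; simp)+
  have e1: "exp (\<i> * of_real (\<theta>' (\<theta> t))) = exp (\<i> * of_real t)" for t
    using comp by (simp add: cis_conv_exp)
  obtain k :: int where k: "\<And>t::real. t \<in> UNIV \<Longrightarrow> \<i> * of_real (\<theta>' (\<theta> t)) = \<i> * of_real t + 2 * of_int k * of_real pi * \<i>"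
    using logs_differ_by_constant[OF connected_UNIV c1 e1] by blast
  have k': "\<theta>' (\<theta> t) = t + 2 * of_int k * pi" for t using arg_cong[OF k[of t], of Im] by simp
  \<comment> \<open>One turn of the parameter is \<open>d\<close> turns of \<open>\<theta>\<close>,
    each of which adds \<open>d'\<close> turns of \<open>\<theta>'\<close>; the composite is the
    identity up to a constant, so the total is one turn.\<close>
  have "\<theta>' (\<theta> 0 + of_int d * (2 * pi)) = \<theta>' (\<theta> 0) + of_int d *\<^sub>R (2 * pi * of_int d')"
    by (rule shift_by_int_multiple) (rule \<theta>'(3))
  moreover have "\<theta> 0 + of_int d * (2 * pi) = \<theta> (2 * pi)" using \<theta>(3)[of 0] by (simp add: mult.commute)
  ultimately have "2 * pi = 2 * pi * of_int (d * d')" using k'[of 0] k'[of "2 * pi"] by simp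
  then have "real_of_int (d * d') = 1" by simp
  then have "d * d' = 1" by linarith
  then have d: "\<bar>d\<bar> = 1" "\<bar>d'\<bar> = 1" by (auto simp: zmult_eq_1_iff)
  have "int m dvd int n" using mn d(1) by (metis dvd_mult_unit_iff zdvd1_eq abs_dvd_iff dvd_abs_iff mult.right_neutral abs_mult abs_of_nat)
  moreover have "int n dvd int m" using nm d(2) by (metis dvd_mult_unit_iff zdvd1_eq abs_dvd_iff dvd_abs_iff mult.right_neutral abs_mult abs_of_nat)
  ultimately show "m = n" by (simp add: dvd_antisym)
qed


subsection \<open>Logarithms and first homology\<close>

text \<open>Total, so that it can be applied to the restriction of a function to any singular edge;
  the value is determined as soon as some continuous logarithm exists.\<close>

definition log_increment :: "(real \<Rightarrow> complex) \<Rightarrow> complex" where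
  "log_increment f = (SOME v. \<exists>L. continuous_on {0..1} L \<and> (\<forall>t\<in>{0..1}. exp (L t) = f t) \<and> v = L 1 - L 0)"

lemma log_increment_eq:
  assumes L: "continuous_on {0..1} L" "\<And>t. t \<in> {0..1} \<Longrightarrow> exp (L t) = f t"
  shows "log_increment f = L 1 - L 0"
proof -
  have "v = L 1 - L 0"
    if M: "continuous_on {0..1} M" "\<forall>t\<in>{0..1}. exp (M t) = f t" "v = M 1 - M 0" for v M
  proof -
    have "exp (M t) = exp (L t)" if "t \<in> {0..1}" for t using M(2) L(2) that by simp
    then obtain k :: int where "\<forall>t\<in>{0..1}. M t = L t + 2 * of_int k * of_real pi * \<i>"
      using logs_differ_by_constant[OF connected_Icc M(1) L(1)] by blast
    then show ?thesis using M(3) by simp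
  qed
  then show ?thesis
    unfolding log_increment_def using L by (intro some_equality) blast+
qed

section \<open>Gains of logarithms as a singular cocycle\<close>

definition edge_point :: "real \<Rightarrow> nat \<Rightarrow> real" where
  "edge_point t = (\<lambda>i. if i = 0 then 1 - t else if i = 1 then t else 0)"

definition triangle_point :: "real \<times> real \<Rightarrow> nat \<Rightarrow> real" where
  "triangle_point p = (\<lambda>i. if i = 0 then 1 - fst p - snd p else if i = 1 then fst p else if i = 2 then snd p else 0)"

definition triangle :: "(real \<times> real) set" where
  "triangle = {p. fst p \<ge> 0 \<and> snd p \<ge> 0 \<and> fst p + snd p \<le> 1}"

lemma edge_point_in_simplex: "t \<in> {0..1} \<Longrightarrow> edge_point t \<in> standard_simplex 1"
  by (auto simp: standard_simplex_def edge_point_def)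

lemma triangle_point_in_simplex: "p \<in> triangle \<Longrightarrow> triangle_point p \<in> standard_simplex 2"
  by (auto simp: standard_simplex_def triangle_point_def triangle_def numeral_2_eq_2)

lemma continuous_on_triangle_point: "continuous_on S triangle_point"
proof (rule continuous_on_coordinatewise_then_product)
  show "continuous_on S (\<lambda>p. triangle_point p i)" for i
    by (cases "i = 0"; cases "i = 1"; cases "i = 2")
      (auto simp: triangle_point_def intro!: continuous_intros)
qed

lemma convex_triangle: "convex triangle"
proof -
  have "triangle = {p. (-1, 0) \<bullet> p \<le> 0} \<inter> {p. (0, -1) \<bullet> p \<le> 0} \<inter> {p. (1, 1) \<bullet> p \<le> 1}"
    by (auto simp: triangle_def inner_prod_def)
  then show ?thesis by (metis convex_Int convex_halfspace_le)
qed

text \<open>Plays the role of integrating the form dG/G over a singular 1-chain, for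
  \<open>G\<close> that is merely continuous.\<close>

definition chain_log_increment :: "('a \<Rightarrow> complex) \<Rightarrow> 'a chain \<Rightarrow> complex" where
  "chain_log_increment G c = (\<Sum>\<sigma>\<in>Poly_Mapping.keys c.
     of_int (poly_mapping.lookup c \<sigma>) * log_increment (\<lambda>t. G (\<sigma> (edge_point t))))"

lemma chain_log_increment_superset:
  assumes "finite S" "Poly_Mapping.keys c \<subseteq> S"
  shows "chain_log_increment G c = (\<Sum>\<sigma>\<in>S. of_int (poly_mapping.lookup c \<sigma>) * log_increment (\<lambda>t. G (\<sigma> (edge_point t))))"
  unfolding chain_log_increment_def
  using assms by (intro sum.mono_neutral_left) (auto simp: in_keys_iff)

lemma chain_log_increment_diff:
  "chain_log_increment G (c - d) = chain_log_increment G c - chain_log_increment G d"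
proof -
  let ?S = "Poly_Mapping.keys c \<union> Poly_Mapping.keys d"
  have "finite ?S" by simp
  then show ?thesis
    using keys_diff[of c d]
    by (simp add: chain_log_increment_superset[of ?S] lookup_minus left_diff_distrib sum_subtractf)
qed

lemma chain_log_increment_0: "chain_log_increment G 0 = 0"
  by (simp add: chain_log_increment_def)

lemma chain_log_increment_of:
  "chain_log_increment G (frag_of \<sigma>) = log_increment (\<lambda>t. G (\<sigma> (edge_point t)))"
  by (simp add: chain_log_increment_def)

lemma singular_simplex_euclidean:
  "singular_simplex p (top_of_set F) \<sigma> \<longleftrightarrow>
    continuous_on (standard_simplex p) \<sigma> \<and> \<sigma> ` standard_simplex p \<subseteq> F \<and> \<sigma> \<in> extensional (standard_simplex p)"
  by (auto simp: singular_simplex_def euclidean_product_topology continuous_map_in_subtopology)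

text \<open>A single logarithm exists on the whole triangle, because it is convex, and its gains
  along the three faces telescope.\<close>

lemma chain_log_increment_boundary_simplex:
  fixes G :: "'a::topological_space \<Rightarrow> complex"
  assumes G: "continuous_on F G" "\<And>x. x \<in> F \<Longrightarrow> G x \<noteq> 0" and \<tau>: "singular_simplex 2 (top_of_set F) \<tau>"
  shows "chain_log_increment G (chain_boundary 2 (frag_of \<tau>)) = 0"
proof -
  have c\<tau>: "continuous_on (standard_simplex 2) \<tau>" "\<tau> ` standard_simplex 2 \<subseteq> F"
    using \<tau> by (auto simp: singular_simplex_euclidean)
  have "continuous_on triangle (\<lambda>p. \<tau> (triangle_point p))"
    by (rule continuous_on_compose2[OF c\<tau>(1) continuous_on_triangle_point]) (use triangle_point_in_simplex in auto)
  then have "continuous_on triangle (\<lambda>p. G (\<tau> (triangle_point p)))"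
    by (rule continuous_on_compose2[OF G(1)]) (use triangle_point_in_simplex c\<tau>(2) in auto)
  moreover have "G (\<tau> (triangle_point p)) \<noteq> 0" if "p \<in> triangle" for p
    using G(2) triangle_point_in_simplex[OF that] c\<tau>(2) by auto
  ultimately obtain l where l: "continuous_on triangle l" "\<And>p. p \<in> triangle \<Longrightarrow> exp (l p) = G (\<tau> (triangle_point p))"
    using logarithm_on_convex[OF _ convex_triangle] by metis
  have face: "log_increment (\<lambda>t. G (singular_face 2 k \<tau> (edge_point t))) = l (h 1) - l (h 0)"
    if h: "continuous_on {0..1} h" "\<And>t. t \<in> {0..1} \<Longrightarrow> h t \<in> triangle"
      "\<And>t. simplical_face k (edge_point t) = triangle_point (h t)" for k and h :: "real \<Rightarrow> real \<times> real"
  proof (rule log_increment_eq)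
    show "continuous_on {0..1} (\<lambda>t. l (h t))"
      by (rule continuous_on_compose2[OF l(1) h(1)]) (use h(2) in auto)
    show "exp (l (h t)) = G (singular_face 2 k \<tau> (edge_point t))" if "t \<in> {0..1}" for t
      using l(2)[OF h(2)[OF that]] edge_point_in_simplex[OF that] h(3)[of t] by (simp add: singular_face_def)
  qed
  have 0: "log_increment (\<lambda>t. G (singular_face 2 0 \<tau> (edge_point t))) = l (0, 1) - l (1, 0)"
    by (subst face[of "\<lambda>t. (1 - t, t)"])
      (auto simp: triangle_def simplical_face_def edge_point_def triangle_point_def fun_eq_iff intro!: continuous_intros)
  have 1: "log_increment (\<lambda>t. G (singular_face 2 1 \<tau> (edge_point t))) = l (0, 1) - l (0, 0)"
    by (subst face[of "\<lambda>t. (0, t)"])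
      (auto simp: triangle_def simplical_face_def edge_point_def triangle_point_def fun_eq_iff intro!: continuous_intros)
  have 2: "log_increment (\<lambda>t. G (singular_face 2 2 \<tau> (edge_point t))) = l (1, 0) - l (0, 0)"
    by (subst face[of "\<lambda>t. (t, 0)"])
      (auto simp: triangle_def simplical_face_def edge_point_def triangle_point_def fun_eq_iff intro!: continuous_intros)
  \<comment> \<open>Written with differences alone, the last one starting from 0, so that
    \<open>chain_log_increment_diff\<close> evaluates it.\<close>
  have "chain_boundary 2 (frag_of \<tau>) =
      frag_of (singular_face 2 0 \<tau>) - frag_of (singular_face 2 1 \<tau>) - (0 - frag_of (singular_face 2 2 \<tau>))"
    by (simp add: chain_boundary_of numeral_2_eq_2)
  then show ?thesis
    by (simp only: chain_log_increment_diff chain_log_increment_of chain_log_increment_0 0 1 2) simp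
qed

lemma chain_log_increment_boundary:
  fixes G :: "'a::topological_space \<Rightarrow> complex"
  assumes G: "continuous_on F G" "\<And>x. x \<in> F \<Longrightarrow> G x \<noteq> 0" and d: "singular_chain 2 (top_of_set F) d"
  shows "chain_log_increment G (chain_boundary 2 d) = 0"
  using d unfolding singular_chain_def
proof (induction d rule: frag_induction)
  case (diff a b)
  then show ?case by (simp add: chain_boundary_diff chain_log_increment_diff)
qed (use chain_log_increment_boundary_simplex[OF G] in \<open>auto simp: chain_log_increment_0\<close>)

text \<open>Log increments form a cocycle, so they vanish on loops of a space without first homology.\<close>

lemma log_increment_loop_trivial_homology:
  fixes G :: "'a::topological_space \<Rightarrow> complex"
  assumes H: "trivial_group (homology_group 1 (top_of_set F))"
    and G: "continuous_on F G" "\<And>x. x \<in> F \<Longrightarrow> G x \<noteq> 0"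
    and \<gamma>: "continuous_on {0..1} \<gamma>" "\<gamma> ` {0..1} \<subseteq> F" "\<gamma> 0 = \<gamma> 1"
    and L: "continuous_on {0..1} L" "\<And>t. t \<in> {0..1} \<Longrightarrow> exp (L t) = G (\<gamma> t)"
  shows "L 1 = L (0::real)"
proof -
  let ?X = "top_of_set F"
  define \<sigma> where "\<sigma> = restrict (\<lambda>x. \<gamma> (x 1)) (standard_simplex 1)"
  have s1: "x 1 \<in> {0..1}" if "x \<in> standard_simplex 1" for x using that by (auto simp: standard_simplex_def)
  have "continuous_on (standard_simplex 1) (\<lambda>x. \<gamma> (x 1))"
    by (rule continuous_on_compose2[OF \<gamma>(1)]) (use s1 in \<open>auto intro: continuous_on_product_coordinates continuous_on_subset\<close>)
  then have \<sigma>: "singular_simplex 1 ?X \<sigma>"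
    using s1 \<gamma>(2) by (auto simp: singular_simplex_euclidean \<sigma>_def cong: continuous_on_cong_simp)
  \<comment> \<open>Both faces are the same 0-simplex since the path is closed, so they cancel in
    the boundary.\<close>
  have "singular_face 1 k \<sigma> = restrict (\<lambda>x. \<gamma> 0) (standard_simplex 0)" if "k \<le> 1" for k
  proof -
    have "simplical_face k x \<in> standard_simplex 1" if "x \<in> standard_simplex 0" for x
      using simplical_face_in_standard_simplex[of 1 k x] that \<open>k \<le> 1\<close> by simp
    moreover have "\<gamma> (simplical_face k x 1) = \<gamma> 0" if "x \<in> standard_simplex 0" for x :: "nat \<Rightarrow> real"
      using that \<open>k \<le> 1\<close> \<gamma>(3) by (cases k) (auto simp: standard_simplex_0 simplical_face_def)
    ultimately show ?thesis by (auto simp: singular_face_def \<sigma>_def restrict_def fun_eq_iff)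
  qed
  from this[of 0] this[of 1] have "chain_boundary 1 (frag_of \<sigma>) = 0"
    by (simp add: chain_boundary_of)
  then have cyc: "singular_relcycle 1 ?X {} (frag_of \<sigma>)"
    using \<sigma> by (simp add: singular_cycle singular_chain_of)
  then have "homologous_rel_set 1 ?X {} (frag_of \<sigma>) \<in> carrier (homology_group (int 1) ?X)"
    unfolding carrier_relative_homology_group by blast
  then have "homologous_rel_set 1 ?X {} (frag_of \<sigma>) = singular_relboundary_set 1 ?X {}"
    using H one_relative_homology_group[of 1 ?X "{}"] by (simp add: trivial_group_def)
  then have "singular_relboundary 1 ?X {} (frag_of \<sigma>)"
    by (simp add: homologous_rel_set_eq_relboundary)
  then obtain d where "singular_chain 2 ?X d" "chain_boundary 2 d = frag_of \<sigma>"
    unfolding singular_boundary by (auto simp: numeral_2_eq_2)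
  then have "log_increment (\<lambda>t. G (\<sigma> (edge_point t))) = 0"
    using chain_log_increment_boundary[OF G] chain_log_increment_of by metis
  moreover have "\<sigma> (edge_point t) = \<gamma> t" if "t \<in> {0..1}" for t
    using edge_point_in_simplex[OF that] by (simp add: \<sigma>_def edge_point_def)
  then have "log_increment (\<lambda>t. G (\<sigma> (edge_point t))) = L 1 - L 0"
    using L by (intro log_increment_eq) auto
  ultimately show ?thesis by simp
qed

text \<open>Extending \<open>\<tau>\<close> to a basis of the plane leaves a single vector
  \<open>e\<close> whose image spans the range; if that image is 0, any unit number serves as
  \<open>\<zeta>\<close>.\<close>

lemma plane_map_with_kernel_has_rank_le_1:
  fixes B :: "'a::euclidean_space \<Rightarrow> complex"
  assumes "subspace L" "dim L = 2" "linear B" "\<tau> \<in> L" "\<tau> \<noteq> 0" "B \<tau> = 0"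
  obtains \<zeta> where "cmod \<zeta> = 1" "\<And>v. v \<in> L \<Longrightarrow> \<exists>s::real. B v = of_real s * \<zeta>"
proof -
  obtain C where C: "{\<tau>} \<subseteq> C" "C \<subseteq> L" "independent C" "L \<subseteq> span C"
    using maximal_independent_subset_extend[of "{\<tau>}" L] assms by auto
  then have "card C = 2" using dim_unique[of C L] assms(2) by simp
  then obtain e where e: "C = {\<tau>, e}"
    using C(1) by (auto simp: card_2_iff)
  define \<zeta> where "\<zeta> = (if B e = 0 then 1 else sgn (B e))"
  show thesis
  proof (rule that[of \<zeta>])
    show "cmod \<zeta> = 1" by (simp add: \<zeta>_def norm_sgn)
    fix v assume "v \<in> L"
    then have "v \<in> span {\<tau>, e}" using C(4) e by blast
    then obtain p q where "v = p *\<^sub>R \<tau> + q *\<^sub>R e"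
      by (auto simp: span_insert span_singleton) (metis add.commute diff_add_cancel)
    then have "B v = q *\<^sub>R B e" using assms by (simp add: linear_add linear_cmul)
    also have "\<dots> = of_real (q * cmod (B e)) * \<zeta>"
      by (auto simp: \<zeta>_def sgn_eq scaleR_conv_of_real)
    finally show "\<exists>s::real. B v = of_real s * \<zeta>" by blast
  qed
qed

text \<open>After rotating by \<open>cnj \<zeta>\<close> the line is real, and
  \<open>p\<^sup>2 - 1 = p * (p - cnj p)\<close> has modulus twice \<open>\<bar>Im p\<bar>\<close>,
  where the imaginary part is at most the distance to any real number. Squaring identifies the two
  directions of the line, so the sign of \<open>s\<close> is immaterial.\<close>

lemma square_close_if_near_line:
  assumes q: "cmod q = 1" and \<zeta>: "cmod \<zeta> = 1" and s: "cmod (q - of_real s * \<zeta>) \<le> \<eta>"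
  shows "cmod (q\<^sup>2 - \<zeta>\<^sup>2) \<le> 2 * \<eta>"
proof -
  define p where "p = q * cnj \<zeta>"
  have \<zeta>c: "\<zeta> * cnj \<zeta> = 1" using \<zeta> by (simp add: complex_norm_square[symmetric])
  have p1: "cmod p = 1" using q \<zeta> by (simp add: p_def norm_mult)
  then have pc: "p * cnj p = 1" by (simp add: complex_norm_square[symmetric])
  have qp: "q = p * \<zeta>" using \<zeta>c by (simp add: p_def mult.assoc mult.commute[of "cnj \<zeta>"])
  have "p\<^sup>2 - 1 = p * (p - cnj p)" using pc by (simp add: power2_eq_square algebra_simps)
  also have "p - cnj p = of_real (2 * Im p) * \<i>" by (simp add: complex_eq_iff)
  finally have "cmod (p\<^sup>2 - 1) = 2 * \<bar>Im p\<bar>" using p1 by (simp add: norm_mult)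
  also have "\<bar>Im p\<bar> = \<bar>Im (p - of_real s)\<bar>" by simp
  also have "\<dots> \<le> cmod (p - of_real s)" by (rule abs_Im_le_cmod)
  also have "\<dots> = cmod ((p - of_real s) * \<zeta>)" using \<zeta> by (simp add: norm_mult)
  also have "(p - of_real s) * \<zeta> = q - of_real s * \<zeta>" by (simp add: qp algebra_simps)
  finally have "cmod (p\<^sup>2 - 1) \<le> 2 * \<eta>" using s by linarith
  moreover have "q\<^sup>2 - \<zeta>\<^sup>2 = (p\<^sup>2 - 1) * \<zeta>\<^sup>2" by (simp add: qp algebra_simps power2_eq_square)
  ultimately show ?thesis using \<zeta> by (simp add: norm_mult norm_power)
qed

text \<open>Continuity along \<open>Z\<close> comes from density: close to a point \<open>x\<close>
  of \<open>Z\<close> there is a point \<open>v\<close> outside \<open>Z\<close> at which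
  \<open>u\<close> is close to both \<open>g x\<close> and \<open>g y\<close>.\<close>

lemma extend_by_limits:
  fixes u :: "'a::metric_space \<Rightarrow> 'b::metric_space"
  assumes u: "continuous_on (M - Z) u" and Z: "closed Z"
    and lim: "\<And>y e. y \<in> M \<inter> Z \<Longrightarrow> e > 0 \<Longrightarrow> \<exists>d>0. \<forall>x\<in>M - Z. dist x y < d \<longrightarrow> dist (u x) (g y) < e"
    and dense: "\<And>y d. y \<in> M \<inter> Z \<Longrightarrow> d > 0 \<Longrightarrow> \<exists>x\<in>M - Z. dist x y < d"
  shows "continuous_on M (\<lambda>y. if y \<in> Z then g y else u y)"
  unfolding continuous_on_iff
proof (intro ballI allI impI)
  fix y e assume y: "y \<in> M" and "(e::real) > 0"
  show "\<exists>d>0. \<forall>x\<in>M. dist x y < d \<longrightarrow> dist (if x \<in> Z then g x else u x) (if y \<in> Z then g y else u y) < e"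
  proof (cases "y \<in> Z")
    case True
    obtain d where d: "d > 0" "\<And>x. x \<in> M - Z \<Longrightarrow> dist x y < d \<Longrightarrow> dist (u x) (g y) < e / 2"
      using lim[of y "e / 2"] True y \<open>e > 0\<close> by auto
    have "dist (g x) (g y) < e" if x: "x \<in> M" "x \<in> Z" "dist x y < d" for x
    proof -
      obtain d' where d': "d' > 0" "\<And>v. v \<in> M - Z \<Longrightarrow> dist v x < d' \<Longrightarrow> dist (u v) (g x) < e / 2"
        using lim[of x "e / 2"] x \<open>e > 0\<close> by auto
      obtain v where v: "v \<in> M - Z" "dist v x < min d' (d - dist x y)"
        using dense[of x "min d' (d - dist x y)"] x d' by auto
      have "dist v y < d" using v(2) dist_triangle[of v y x] by simp
      then show ?thesis
        using d(2)[OF v(1)] d'(2)[OF v(1)] v(2) dist_triangle_half_r[of "u v" "g x" e "g y"] by simp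
    qed
    moreover have "dist (u x) (g y) < e" if "x \<in> M - Z" "dist x y < d" for x
      using d(2)[OF that] \<open>e > 0\<close> by linarith
    ultimately show ?thesis using True d(1) by (intro exI[of _ d]) auto
  next
    case False
    then obtain d1 where d1: "d1 > 0" "ball y d1 \<subseteq> - Z"
      using Z open_contains_ball[of "- Z"] by (auto simp: open_Compl)
    obtain d2 where d2: "d2 > 0" "\<And>x. x \<in> M - Z \<Longrightarrow> dist x y < d2 \<Longrightarrow> dist (u x) (u y) < e"
      using u y False \<open>e > 0\<close> unfolding continuous_on_iff by blast
    have "x \<notin> Z" if "dist x y < d1" for x using d1(2) that by (auto simp: dist_commute subset_eq)
    then show ?thesis using False d1(1) d2 by (intro exI[of _ "min d1 d2"]) auto
  qed
qed


subsection \<open>The genus is positive\<close>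

text \<open>The factor \<open>a ^ k\<close> is one of the nonnegative summands of the quotient of
  the power difference by \<open>r - a\<close>.\<close>

lemma power_diff_lower_bound:
  fixes r a :: real
  assumes "r \<ge> 0" "a \<ge> 0"
  shows "a ^ k * \<bar>r - a\<bar> \<le> \<bar>r ^ Suc k - a ^ Suc k\<bar>"
proof (cases "a \<le> r")
  case True
  then have "r * a ^ k \<le> r * r ^ k" using assms by (intro mult_left_mono power_mono) auto
  moreover have "a * a ^ k \<le> r * a ^ k" using True assms by (intro mult_right_mono) auto
  ultimately show ?thesis using True by (simp add: algebra_simps)
next
  case False
  then have "r * r ^ k \<le> r * a ^ k" using assms by (intro mult_left_mono power_mono) auto
  moreover have "r * a ^ k \<le> a * a ^ k" using False assms by (intro mult_right_mono) auto
  ultimately show ?thesis using False by (simp add: algebra_simps)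
qed

lemma smooth_on_imp_continuous_on: "smooth_on U f \<Longrightarrow> continuous_on U f"
  unfolding smooth_on_def by (metis Ck_on.simps(1))

context torus_knot begin

text \<open>In general not the metrically nearest point, but the point of the curve whose first
  coordinate has the same argument; \<open>distance_to_curve_le_defect\<close> shows that this is
  close enough.\<close>

definition nearest :: "real^4 \<Rightarrow> real^4" where
  "nearest x = curve (sgn (zc x))"

text \<open>A quantitative form of the transversality of \<open>defect\<close> to the curve. The
  radial error in \<open>z\<close> is at most the defect divided by \<open>a ^ (2 * n - 1)\<close>,
  and the error in \<open>w\<close> at most twice the defect; these give the two terms of
  \<open>C\<close>.\<close>

lemma distance_to_curve_le_defect:
  obtains C where "C > 0" "\<And>x. x \<in> sphere 0 1 \<Longrightarrow> zc x \<noteq> 0 \<Longrightarrow> norm (x - nearest x) \<le> C * cmod (defect x)"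
proof -
  define k where "k = 2 * n - 1"
  have k: "2 * n = Suc k" using n by (simp add: k_def)
  have ak: "a ^ k > 0" using a by simp
  define C where "C = 1 / a ^ k + 2"
  have "C > 0" using ak by (simp add: C_def add_pos_pos)
  moreover have "norm (x - nearest x) \<le> C * cmod (defect x)" if x: "x \<in> sphere 0 1" "zc x \<noteq> 0" for x
  proof -
    let ?w = "sgn (zc x)" and ?r = "cmod (zc x)" and ?P = "cmod (defect x)"
    have w: "cmod ?w = 1" "zc x = of_real ?r * ?w"
      using x(2) by (simp add: norm_sgn, simp add: sgn_eq)
    have est: "\<bar>?r ^ (2 * n) - a ^ (2 * n)\<bar> \<le> ?P" using defect_estimate[OF x(1)] by linarith
    have "zc x - of_real a * ?w = of_real (?r - a) * ?w" by (subst (1) w(2)) (simp add: algebra_simps)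
    then have 1: "cmod (zc x - of_real a * ?w) = \<bar>?r - a\<bar>"
      using w(1) by (simp only: norm_mult norm_of_real mult_1_right)
    have "a ^ k * \<bar>?r - a\<bar> \<le> ?P" using power_diff_lower_bound[of ?r a k] est a k by simp
    then have 2: "\<bar>?r - a\<bar> \<le> ?P / a ^ k" using ak by (simp add: field_simps)
    have "zc x ^ (2 * n) - (of_real a * ?w) ^ (2 * n) = of_real (?r ^ (2 * n) - a ^ (2 * n)) * ?w ^ (2 * n)"
      by (subst (1) w(2)) (simp add: power_mult_distrib algebra_simps)
    then have "cmod (zc x ^ (2 * n) - (of_real a * ?w) ^ (2 * n)) = \<bar>?r ^ (2 * n) - a ^ (2 * n)\<bar>"
      using w(1) by (simp only: norm_mult norm_of_real norm_power power_one mult_1_right)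
    moreover have "cmod (wc x - (of_real a * ?w) ^ (2 * n)) \<le> cmod (wc x - zc x ^ (2 * n)) + cmod (zc x ^ (2 * n) - (of_real a * ?w) ^ (2 * n))"
      by (metis norm_triangle_ineq diff_add_cancel add_diff_eq)
    ultimately have 3: "cmod (wc x - (of_real a * ?w) ^ (2 * n)) \<le> 2 * ?P"
      using est by (simp add: defect_def)
    have "x - nearest x = mk (zc x - of_real a * ?w) (wc x - (of_real a * ?w) ^ (2 * n))"
      unfolding mk_diff[symmetric] by (simp add: nearest_def curve_def)
    then have "norm (x - nearest x) \<le> cmod (zc x - of_real a * ?w) + cmod (wc x - (of_real a * ?w) ^ (2 * n))"
      using norm_mk_le by simp
    also have "\<dots> \<le> ?P / a ^ k + 2 * ?P" using 1 2 3 by linarith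
    also have "\<dots> = C * ?P" by (simp add: C_def algebra_simps)
    finally show ?thesis .
  qed
  ultimately show thesis by (rule that)
qed

lemma strictly_differentiable_defect: "\<exists>A. strictly_differentiable defect A p"
proof -
  have "strictly_differentiable defect (\<lambda>v. wc v - of_nat (2 * n) * zc v * zc p ^ (2 * n - 1)) p"
  proof (rule continuous_derivative_imp_strictly_differentiable[OF open_UNIV UNIV_I])
    fix x
    have "((\<lambda>x. zc x ^ (2 * n)) has_derivative (\<lambda>v. of_nat (2 * n) * zc v * zc x ^ (2 * n - 1))) (at x)"
      by (rule has_derivative_power) (rule bounded_linear_imp_has_derivative[OF bounded_linear_zc])
    then show "(defect has_derivative (\<lambda>v. wc v - of_nat (2 * n) * zc v * zc x ^ (2 * n - 1))) (at x)"
      unfolding defect_def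
      by (intro has_derivative_diff bounded_linear_imp_has_derivative[OF bounded_linear_wc])
  qed (intro continuous_intros)
  then show ?thesis by blast
qed

lemma tendsto_curve: "(f \<longlongrightarrow> l) F \<Longrightarrow> ((\<lambda>x. curve (f x)) \<longlongrightarrow> curve l) F"
  using continuous_on_curve[OF continuous_on_id, of UNIV]
  by (auto simp: continuous_on_eq_continuous_at intro: isCont_tendsto_compose)

text \<open>The directions of secants of \<open>M\<close> at a point of the knot that join points with equal argument of
  the first coordinate tend to a line, because \<open>M\<close> is a surface tangent to the knot. Hence so does the
  direction of \<open>defect\<close>, and its square converges.\<close>

lemma squared_direction_limit:
  fixes \<Psi> \<Psi>' :: "real^4 \<Rightarrow> real^4"
  assumes hom: "homeomorphism (sphere 0 1) (sphere 0 1) \<Psi> \<Psi>'"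
    and sm: "\<And>p. p \<in> sphere 0 1 \<Longrightarrow> \<exists>U g. open U \<and> p \<in> U \<and> smooth_on U g \<and> (\<forall>x\<in>sphere 0 1 \<inter> U. g x = \<Psi> x)"
    and sm': "\<And>p. p \<in> sphere 0 1 \<Longrightarrow> \<exists>U g. open U \<and> p \<in> U \<and> smooth_on U g \<and> (\<forall>x\<in>sphere 0 1 \<inter> U. g x = \<Psi>' x)"
    and M: "M \<subseteq> sphere 0 1" "smooth_submanifold 2 M"
    and KM: "\<And>c. cmod c = 1 \<Longrightarrow> \<Psi> (curve c) \<in> M" and c0: "cmod c0 = 1"
  shows "\<exists>\<sigma>. cmod \<sigma> = 1 \<and> (\<forall>e>0. \<forall>\<^sub>F y in at (\<Psi> (curve c0)) within M.
      defect (\<Psi>' y) \<noteq> 0 \<longrightarrow> dist ((sgn (defect (\<Psi>' y)))\<^sup>2) \<sigma> < e)"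
    and "d > 0 \<Longrightarrow> \<exists>y\<in>M. defect (\<Psi>' y) \<noteq> 0 \<and> dist y (\<Psi> (curve c0)) < d"
proof -
  define x0 where "x0 = curve c0"
  define y0 where "y0 = \<Psi> x0"
  have x0S: "x0 \<in> sphere 0 1" using c0 by (simp add: x0_def)
  have c\<Psi>: "continuous_on (sphere 0 1) \<Psi>" "continuous_on (sphere 0 1) \<Psi>'"
    using homeomorphism_cont1[OF hom] homeomorphism_cont2[OF hom] by auto
  have inv: "\<Psi>' (\<Psi> x) = x" "\<Psi> (\<Psi>' x) = x" "\<Psi> x \<in> sphere 0 1" "\<Psi>' x \<in> sphere 0 1" if "x \<in> sphere 0 1" for x
    using homeomorphism_apply1[OF hom that] homeomorphism_apply2[OF hom that]
      homeomorphism_image1[OF hom] homeomorphism_image2[OF hom] that by blast+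
  have y0: "y0 \<in> M" "y0 \<in> sphere 0 1" "\<Psi>' y0 = x0"
    using KM[OF c0] M(1) inv[OF x0S] by (auto simp: y0_def x0_def simp del: mem_sphere)
  obtain U V :: "(real^4) set" and \<phi> \<psi> and L :: "(real^4) set"
    where U: "open U" "y0 \<in> U" and V: "open V" and \<phi>\<psi>: "homeomorphism U V \<phi> \<psi>"
      and s\<phi>: "smooth_on U \<phi>" and s\<psi>: "smooth_on V \<psi>" and L: "subspace L" "dim L = 2"
      and img: "\<phi> ` (M \<inter> U) = V \<inter> L"
    using M(2) y0(1) unfolding smooth_submanifold_def by meson
  define u0 where "u0 = \<phi> y0"
  have \<psi>\<phi>: "\<psi> (\<phi> y) = y" if "y \<in> U" for y using homeomorphism_apply1[OF \<phi>\<psi> that] .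
  have u0: "u0 \<in> V" "u0 \<in> L" "\<psi> u0 = y0" using img U y0(1) \<psi>\<phi> by (auto simp: u0_def)
  have \<phi>L: "\<phi> y \<in> L" if "y \<in> M" "y \<in> U" for y using img that by blast
  obtain U1 g1 where g1: "open U1" "y0 \<in> U1" "smooth_on U1 g1" "\<forall>x\<in>sphere 0 1 \<inter> U1. g1 x = \<Psi>' x"
    using sm'[OF y0(2)] by blast
  obtain U2 g2 where g2: "open U2" "x0 \<in> U2" "smooth_on U2 g2" "\<forall>x\<in>sphere 0 1 \<inter> U2. g2 x = \<Psi> x"
    using sm[OF x0S] by blast
  have g10: "g1 y0 = x0" using g1 y0 by blast
  have g20: "g2 x0 = y0" using g2 x0S y0_def by blast
  \<comment> \<open>\<open>Q\<close> is the defect read in the slice chart of the surface, with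
    derivative \<open>B\<close> at \<open>u0\<close>; \<open>N\<close> goes from the sphere into the
    chart and supplies the Lipschitz bound for secants.\<close>
  define Q where "Q u = defect (g1 (\<psi> u))" for u
  define N where "N x = \<phi> (g2 x)" for x
  obtain A1 where A1: "strictly_differentiable \<psi> A1 u0"
    using smooth_on_imp_strictly_differentiable[OF s\<psi> V u0(1)] .
  obtain A2 where A2: "strictly_differentiable g1 A2 (\<psi> u0)"
    unfolding u0(3) using smooth_on_imp_strictly_differentiable[OF g1(3,1,2)] .
  obtain A3 where A3: "strictly_differentiable defect A3 (g1 (\<psi> u0))"
    using strictly_differentiable_defect by blast
  define B where "B v = A3 (A2 (A1 v))" for v
  have sQ: "strictly_differentiable Q B u0"
    unfolding Q_def B_def
    using strictly_differentiable_compose[OF strictly_differentiable_compose[OF A1 A2] A3] by simp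
  then have blB: "bounded_linear B" by (simp add: strictly_differentiable_def)
  obtain A4 where A4: "strictly_differentiable g2 A4 x0"
    using smooth_on_imp_strictly_differentiable[OF g2(3,1,2)] .
  obtain A5 where A5: "strictly_differentiable \<phi> A5 (g2 x0)"
    unfolding g20 using smooth_on_imp_strictly_differentiable[OF s\<phi> U] .
  obtain C1 d1 where C1: "C1 > 0" "d1 > 0"
    "\<And>x y. x \<in> ball x0 d1 \<Longrightarrow> y \<in> ball x0 d1 \<Longrightarrow> norm (N x - N y) \<le> C1 * norm (x - y)"
    using strictly_differentiable_lipschitz[OF strictly_differentiable_compose[OF A4 A5]]
    unfolding N_def by metis
  obtain C2 where C2: "C2 > 0" "\<And>x. x \<in> sphere 0 1 \<Longrightarrow> zc x \<noteq> 0 \<Longrightarrow> norm (x - nearest x) \<le> C2 * cmod (defect x)"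
    using distance_to_curve_le_defect by blast
  have Q\<phi>: "Q (\<phi> y) = defect (\<Psi>' y)" if "y \<in> M" "y \<in> U" "y \<in> U1" for y
    using \<psi>\<phi>[OF that(2)] g1(4) that M(1) by (auto simp: Q_def simp del: mem_sphere)
  have iso\<phi>: "isCont \<phi> y0"
    using smooth_on_imp_continuous_on[OF s\<phi>] U by (simp add: continuous_on_eq_continuous_at)
  \<comment> \<open>A tangent direction of the knot. If \<open>B\<close> were injective on
    \<open>L\<close>, compactness of the unit circle of \<open>L\<close> would give a lower bound
    \<open>m * norm v\<close> for it, but \<open>Q\<close> vanishes at \<open>u0\<close> and at the
    images of nearby points of the knot, against the strict estimate with error
    \<open>m / 2\<close>.\<close>
  have "\<exists>\<tau>\<in>L. \<tau> \<noteq> 0 \<and> B \<tau> = 0"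
  proof (rule ccontr)
    assume nB: "\<not> ?thesis"
    define L' where "L' = L \<inter> sphere 0 1"
    have k1: "compact L'" unfolding L'_def using L(1) closed_subspace by (intro closed_Int_compact) auto
    have k2: "L' \<noteq> {}"
    proof -
      obtain v where v: "v \<in> L" "v \<noteq> 0" using L(2) dim_eq_0[of L] by auto
      then have "v /\<^sub>R norm v \<in> L'" using L(1) by (auto simp: L'_def intro: subspace_scale)
      then show ?thesis by blast
    qed
    have k3: "continuous_on L' (\<lambda>v. cmod (B v))"
      by (intro continuous_intros linear_continuous_on blB)
    obtain v0 where v0: "v0 \<in> L'" "\<And>v. v \<in> L' \<Longrightarrow> cmod (B v0) \<le> cmod (B v)"
      using continuous_attains_inf[OF k1 k2 k3] by blast
    define m where "m = cmod (B v0)"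
    have m: "m > 0" using v0(1) nB by (auto simp: m_def L'_def)
    have mB: "m * norm v \<le> cmod (B v)" if "v \<in> L" for v
    proof (cases "v = 0")
      case False
      then have "v /\<^sub>R norm v \<in> L'" using L(1) that by (auto simp: L'_def intro: subspace_scale)
      from v0(2)[OF this] have "m \<le> cmod (B v) / norm v"
        using blB by (simp add: m_def bounded_linear.linear linear_cmul divide_inverse mult.commute)
      then show ?thesis using False by (simp add: field_simps)
    qed simp
    obtain d where d: "d > 0" "\<And>u v. u \<in> ball u0 d \<Longrightarrow> v \<in> ball u0 d \<Longrightarrow> cmod (Q u - Q v - B (u - v)) \<le> m / 2 * norm (u - v)"
      using sQ m unfolding strictly_differentiable_def by (meson half_gt_zero)
    define Y where "Y t = \<Psi> (curve (c0 * cis t))" for t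
    have YM: "Y t \<in> M" for t using KM c0 by (simp add: Y_def norm_mult)
    have "continuous_on UNIV Y" unfolding Y_def
      by (rule continuous_on_compose2[OF c\<Psi>(1)]) (use c0 in \<open>auto intro!: continuous_intros simp: norm_mult\<close>)
    then have "isCont Y 0" by (simp add: continuous_on_eq_continuous_at)
    moreover have "Y 0 = y0" by (simp add: Y_def y0_def x0_def)
    ultimately have tY: "(Y \<longlongrightarrow> y0) (at 0)" by (simp add: isCont_def)
    have tu: "((\<lambda>t. \<phi> (Y t)) \<longlongrightarrow> u0) (at 0)"
      unfolding u0_def by (rule isCont_tendsto_compose[OF iso\<phi> tY])
    have "\<forall>\<^sub>F t in at (0::real). t \<in> {-1<..<1} - {0}"
      by (rule eventually_at_in_open) auto
    moreover have "\<forall>\<^sub>F t in at 0. Y t \<in> U" "\<forall>\<^sub>F t in at 0. Y t \<in> U1" "\<forall>\<^sub>F t in at 0. \<phi> (Y t) \<in> ball u0 d"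
      using topological_tendstoD[OF tY U] topological_tendstoD[OF tY g1(1,2)]
        topological_tendstoD[OF tu open_ball[of u0 d]] d(1) by auto
    ultimately have "\<forall>\<^sub>F t in at 0. t \<in> {-1<..<1} - {0} \<and> Y t \<in> U \<and> Y t \<in> U1 \<and> \<phi> (Y t) \<in> ball u0 d"
      by eventually_elim auto
    then obtain t :: real where t: "t \<in> {-1<..<1} - {0}" "Y t \<in> U" "Y t \<in> U1" "\<phi> (Y t) \<in> ball u0 d"
      using eventually_happens'[OF at_neq_bot] by blast
    let ?u = "\<phi> (Y t)"
    have ne: "?u \<noteq> u0"
    proof
      assume "?u = u0"
      then have "\<psi> (\<phi> (Y t)) = \<psi> (\<phi> y0)" by (simp only: u0_def)
      then have "Y t = y0" unfolding \<psi>\<phi>[OF t(2)] \<psi>\<phi>[OF U(2)] .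
      then have eq: "\<Psi> (curve (c0 * cis t)) = \<Psi> (curve c0)" by (simp only: Y_def y0_def x0_def)
      have s: "curve (c0 * cis t) \<in> sphere 0 1" "curve c0 \<in> sphere 0 1" using c0 by (simp_all add: norm_mult)
      have "curve (c0 * cis t) = curve c0"
        using arg_cong[OF eq, of \<Psi>'] unfolding inv(1)[OF s(1)] inv(1)[OF s(2)] .
      then have "cis t = 1" using c0 by (auto simp: curve_eq_iff)
      then have "sin t = 0" by (metis cis.simps(2) one_complex.simps(2))
      moreover have "sin \<bar>t\<bar> > 0" using t(1) pi_gt3 by (intro sin_gt_zero) auto
      ultimately show False by (auto simp: abs_if split: if_splits)
    qed
    have "\<Psi>' (Y t) = curve (c0 * cis t)" using inv(1) c0 by (simp add: Y_def norm_mult)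
    then have "Q ?u = 0" using Q\<phi>[OF YM t(2,3)] by simp
    moreover have "Q u0 = 0" using Q\<phi>[OF y0(1) U(2) g1(2)] y0(3) by (simp add: u0_def x0_def)
    ultimately have "cmod (B (?u - u0)) \<le> m / 2 * norm (?u - u0)"
      using d(2)[OF t(4), of u0] d(1) by simp
    moreover have "m * norm (?u - u0) \<le> cmod (B (?u - u0))"
      using mB \<phi>L[OF YM t(2)] u0(2) L(1) by (simp add: subspace_diff)
    moreover have "m / 2 * norm (?u - u0) < m * norm (?u - u0)" using m ne by simp
    ultimately show False by linarith
  qed
  then obtain \<tau> where "\<tau> \<in> L" "\<tau> \<noteq> 0" "B \<tau> = 0" by blast
  then obtain \<zeta> where \<zeta>: "cmod \<zeta> = 1" "\<And>v. v \<in> L \<Longrightarrow> \<exists>s::real. B v = of_real s * \<zeta>"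
    using plane_map_with_kernel_has_rank_le_1[OF L bounded_linear.linear[OF blB]] by metis
  have "\<forall>\<^sub>F y in at y0 within M. defect (\<Psi>' y) \<noteq> 0 \<longrightarrow> dist ((sgn (defect (\<Psi>' y)))\<^sup>2) (\<zeta>\<^sup>2) < e" if e: "e > 0" for e
  proof -
    \<comment> \<open>The secant from \<open>y\<close> to the knot has length at most
      \<open>C1 * C2\<close> times the defect in the chart, so the linearization error is at most
      \<open>e / 4\<close> times the defect. Squaring the direction doubles this to
      \<open>e / 2\<close>.\<close>
    define \<eta> where "\<eta> = e / (4 * C1 * C2)"
    have \<eta>: "\<eta> > 0" using e C1 C2 by (simp add: \<eta>_def)
    obtain d where d: "d > 0" "\<And>u v. u \<in> ball u0 d \<Longrightarrow> v \<in> ball u0 d \<Longrightarrow> cmod (Q u - Q v - B (u - v)) \<le> \<eta> * norm (u - v)"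
      using sQ \<eta> unfolding strictly_differentiable_def by meson
    let ?F = "at y0 within M"
    have evM: "\<forall>\<^sub>F y in ?F. y \<in> M" by (simp add: eventually_at_filter)
    have tX: "(\<Psi>' \<longlongrightarrow> x0) ?F"
      using c\<Psi>(2) y0 M(1) tendsto_within_subset unfolding continuous_on_def by metis
    have tid: "((\<lambda>y. y) \<longlongrightarrow> y0) ?F" by (rule tendsto_ident_at)
    have z0: "zc x0 \<noteq> 0" "sgn (zc x0) = c0" using a c0 by (auto simp: x0_def curve_def sgn_mult sgn_of_real) (simp add: sgn_eq)
    have tz: "((\<lambda>y. zc (\<Psi>' y)) \<longlongrightarrow> zc x0) ?F" by (rule bounded_linear.tendsto[OF bounded_linear_zc tX])
    have tN: "((\<lambda>y. nearest (\<Psi>' y)) \<longlongrightarrow> x0) ?F"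
      using tendsto_curve[OF tendsto_sgn[OF tz z0(1)]] z0(2) by (simp add: nearest_def x0_def)
    have evz: "\<forall>\<^sub>F y in ?F. zc (\<Psi>' y) \<noteq> 0" using tendsto_imp_eventually_ne[OF tz z0(1)] .
    have evn: "\<forall>\<^sub>F y in ?F. nearest (\<Psi>' y) \<in> sphere 0 1"
      using evz by eventually_elim (simp add: nearest_def norm_sgn)
    have tY: "((\<lambda>y. \<Psi> (nearest (\<Psi>' y))) \<longlongrightarrow> y0) ?F"
      unfolding y0_def by (rule continuous_on_tendsto_compose[OF c\<Psi>(1) tN[unfolded y0_def] x0S evn[unfolded y0_def]])
    have tu: "(\<phi> \<longlongrightarrow> u0) ?F" unfolding u0_def by (rule isCont_tendsto_compose[OF iso\<phi> tid])
    have tu': "((\<lambda>y. \<phi> (\<Psi> (nearest (\<Psi>' y)))) \<longlongrightarrow> u0) ?F"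
      unfolding u0_def by (rule isCont_tendsto_compose[OF iso\<phi> tY])
    have ev1: "\<forall>\<^sub>F y in ?F. y \<in> U" "\<forall>\<^sub>F y in ?F. y \<in> U1"
      "\<forall>\<^sub>F y in ?F. \<Psi> (nearest (\<Psi>' y)) \<in> U" "\<forall>\<^sub>F y in ?F. \<Psi> (nearest (\<Psi>' y)) \<in> U1"
      using topological_tendstoD[OF tid U] topological_tendstoD[OF tid g1(1,2)]
        topological_tendstoD[OF tY U] topological_tendstoD[OF tY g1(1,2)] by auto
    have ev2: "\<forall>\<^sub>F y in ?F. \<phi> y \<in> ball u0 d" "\<forall>\<^sub>F y in ?F. \<phi> (\<Psi> (nearest (\<Psi>' y))) \<in> ball u0 d"
      using topological_tendstoD[OF tu open_ball[of u0 d]] topological_tendstoD[OF tu' open_ball[of u0 d]] d(1) by auto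
    have ev3: "\<forall>\<^sub>F y in ?F. \<Psi>' y \<in> U2" "\<forall>\<^sub>F y in ?F. nearest (\<Psi>' y) \<in> U2"
      "\<forall>\<^sub>F y in ?F. \<Psi>' y \<in> ball x0 d1" "\<forall>\<^sub>F y in ?F. nearest (\<Psi>' y) \<in> ball x0 d1"
      using topological_tendstoD[OF tX g2(1,2)] topological_tendstoD[OF tN g2(1,2)]
        topological_tendstoD[OF tX open_ball[of x0 d1]] topological_tendstoD[OF tN open_ball[of x0 d1]] C1(2) by auto
    show ?thesis
      using evM evz evn ev1 ev2 ev3
    proof eventually_elim
      case (elim y)
      let ?x = "\<Psi>' y" and ?x' = "nearest (\<Psi>' y)"
      let ?y' = "\<Psi> ?x'" and ?P = "defect (\<Psi>' y)"
      have yS: "y \<in> sphere 0 1" using elim(1) M(1) by blast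
      have xS: "?x \<in> sphere 0 1" "\<Psi> ?x = y" using inv[OF yS] by auto
      have y'M: "?y' \<in> M" unfolding nearest_def by (rule KM) (use elim(2) in \<open>simp add: norm_sgn\<close>)
      have Q': "Q (\<phi> ?y') = 0"
        using Q\<phi>[OF y'M elim(6,7)] inv(1)[OF elim(3)] by (simp add: nearest_def)
      have Qy: "Q (\<phi> y) = ?P" using Q\<phi>[OF elim(1,4,5)] .
      have "N ?x = \<phi> y" "N ?x' = \<phi> ?y'"
        using g2(4) xS elim(3,10,11) by (auto simp: N_def simp del: mem_sphere)
      then have "norm (\<phi> y - \<phi> ?y') \<le> C1 * norm (?x - ?x')" using C1(3)[OF elim(12,13)] by simp
      also have "\<dots> \<le> C1 * (C2 * cmod ?P)" using C2(2)[OF xS(1) elim(2)] C1(1) by simp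
      finally have dist: "norm (\<phi> y - \<phi> ?y') \<le> C1 * (C2 * cmod ?P)" .
      have "cmod (?P - B (\<phi> y - \<phi> ?y')) \<le> \<eta> * norm (\<phi> y - \<phi> ?y')"
        using d(2)[OF elim(8,9)] Q' Qy by simp
      also have "\<dots> \<le> \<eta> * (C1 * (C2 * cmod ?P))" using dist \<eta> by (intro mult_left_mono) auto
      also have "\<dots> = e / 4 * cmod ?P" using C1 C2 by (simp add: \<eta>_def)
      finally have near: "cmod (?P - B (\<phi> y - \<phi> ?y')) \<le> e / 4 * cmod ?P" .
      \<comment> \<open>Both ends of the secant lie on the surface, so its chart image lies in
        \<open>L\<close> and \<open>B\<close> maps it to the line of \<open>\<zeta>\<close>.\<close>
      obtain s :: real where s: "B (\<phi> y - \<phi> ?y') = of_real s * \<zeta>"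
        using \<zeta>(2)[of "\<phi> y - \<phi> ?y'"] \<phi>L elim(1,4,6) y'M L(1) subspace_diff by blast
      show "?P \<noteq> 0 \<longrightarrow> dist ((sgn ?P)\<^sup>2) (\<zeta>\<^sup>2) < e"
      proof
        assume P: "?P \<noteq> 0"
        then have sgn1: "cmod (sgn ?P) = 1" by (simp add: norm_sgn)
        have "sgn ?P - of_real (s / cmod ?P) * \<zeta> = (?P - of_real s * \<zeta>) / of_real (cmod ?P)"
          using P by (simp add: sgn_eq diff_divide_distrib)
        then have "cmod (sgn ?P - of_real (s / cmod ?P) * \<zeta>) = cmod (?P - of_real s * \<zeta>) / cmod ?P"
          by (simp only: norm_divide norm_of_real abs_norm_cancel)
        also have "\<dots> \<le> e / 4" using near P unfolding s by (simp add: field_simps)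
        finally have "cmod (sgn ?P - of_real (s / cmod ?P) * \<zeta>) \<le> e / 4" .
        then have "cmod ((sgn ?P)\<^sup>2 - \<zeta>\<^sup>2) \<le> 2 * (e / 4)"
          by (rule square_close_if_near_line[OF sgn1 \<zeta>(1)])
        then show "dist ((sgn ?P)\<^sup>2) (\<zeta>\<^sup>2) < e" using e by (simp add: dist_norm)
      qed
    qed
  qed
  then show "\<exists>\<sigma>. cmod \<sigma> = 1 \<and> (\<forall>e>0. \<forall>\<^sub>F y in at (\<Psi> (curve c0)) within M.
      defect (\<Psi>' y) \<noteq> 0 \<longrightarrow> dist ((sgn (defect (\<Psi>' y)))\<^sup>2) \<sigma> < e)"
    using \<zeta>(1) unfolding y0_def x0_def by (intro exI[of _ "\<zeta>\<^sup>2"]) (auto simp: norm_power)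
  \<comment> \<open>Otherwise the surface near the point would be contained in the curve, and a
    nonempty open piece of the plane \<open>L\<close> would inject continuously into the reals,
    against invariance of dimension.\<close>
  show "\<exists>y\<in>M. defect (\<Psi>' y) \<noteq> 0 \<and> dist y (\<Psi> (curve c0)) < d" if d: "d > 0"
  proof (rule ccontr)
    assume no: "\<not> ?thesis"
    \<comment> \<open>On the curve \<open>h\<close> is the parameter relative to \<open>c0\<close>,
      a number of modulus 1. Restricting to positive real part makes it determined by its imaginary
      part.\<close>
    define h where "h u = zc (\<Psi>' (\<psi> u)) / (of_real a * c0)" for u
    define T where "T = ((V \<inter> L) \<inter> \<psi> -` ball y0 d) \<inter> ((V \<inter> L) \<inter> h -` {z. Re z > 0})"
    have \<psi>M: "\<psi> u \<in> M" if u: "u \<in> V \<inter> L" for u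
    proof -
      have "u \<in> \<phi> ` (M \<inter> U)" using u unfolding img .
      then show ?thesis using \<psi>\<phi> by auto
    qed
    have c\<psi>: "continuous_on (V \<inter> L) \<psi>"
      using smooth_on_imp_continuous_on[OF s\<psi>] by (rule continuous_on_subset) blast
    have "continuous_on (V \<inter> L) (\<lambda>u. \<Psi>' (\<psi> u))"
      by (rule continuous_on_compose2[OF c\<Psi>(2) c\<psi>]) (use \<psi>M M(1) in blast)
    then have ch: "continuous_on (V \<inter> L) h"
      unfolding h_def using a c0 by (intro continuous_intros) auto
    have hc: "\<exists>c. cmod c = 1 \<and> \<Psi>' (\<psi> u) = curve c \<and> h u = c / c0" if u: "u \<in> T" for u
    proof -
      have u': "u \<in> V \<inter> L" "dist (\<psi> u) y0 < d" using u by (auto simp: T_def dist_commute)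
      then have "defect (\<Psi>' (\<psi> u)) = 0" using no \<psi>M unfolding y0_def x0_def by blast
      moreover have "\<Psi>' (\<psi> u) \<in> sphere 0 1" using \<psi>M[OF u'(1)] M(1) inv(4) by blast
      ultimately obtain c where "cmod c = 1" "\<Psi>' (\<psi> u) = curve c" using defect_eq_0_iff by blast
      then show ?thesis using a by (intro exI[of _ c]) (simp add: h_def curve_def)
    qed
    have "dim L \<le> dim (UNIV :: real set)"
    proof (rule invariance_of_dimension_subspaces)
      have "openin (top_of_set (V \<inter> L)) T"
        unfolding T_def
        by (intro openin_Int continuous_openin_preimage_gen c\<psi> ch open_ball open_halfspace_Re_gt)
      moreover have "openin (top_of_set L) (V \<inter> L)" using V by (metis Int_commute openin_open_Int)
      ultimately show "openin (top_of_set L) T" using openin_trans by blast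
      show "continuous_on T (\<lambda>u. Im (h u))"
        by (intro continuous_intros continuous_on_subset[OF ch]) (auto simp: T_def)
      show "inj_on (\<lambda>u. Im (h u)) T"
      proof (rule inj_onI)
        fix u v assume uv: "u \<in> T" "v \<in> T" "Im (h u) = Im (h v)"
        obtain c where c: "cmod c = 1" "\<Psi>' (\<psi> u) = curve c" "h u = c / c0" using hc[OF uv(1)] by blast
        obtain c' where c': "cmod c' = 1" "\<Psi>' (\<psi> v) = curve c'" "h v = c' / c0" using hc[OF uv(2)] by blast
        have "cmod (h u) = 1" "cmod (h v) = 1" using c c' c0 by (auto simp: norm_divide)
        then have "(Re (h u))\<^sup>2 = (Re (h v))\<^sup>2" using uv(3) cmod_power2[of "h u"] cmod_power2[of "h v"] by simp
        moreover have "Re (h u) > 0" "Re (h v) > 0" using uv by (auto simp: T_def)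
        ultimately have "Re (h u) = Re (h v)" by (simp add: power2_eq_iff)
        then have "h u = h v" using uv(3) by (simp add: complex_eq_iff)
        then have "c = c'" using c c' c0 by auto
        then have "\<Psi>' (\<psi> u) = \<Psi>' (\<psi> v)" using c c' by simp
        moreover have "u \<in> V \<inter> L" "v \<in> V \<inter> L" using uv by (auto simp: T_def)
        ultimately have "\<psi> u = \<psi> v" using inv(2) \<psi>M M(1) by (metis subsetD)
        then show "u = v" using homeomorphism_apply2[OF \<phi>\<psi>] \<open>u \<in> V \<inter> L\<close> \<open>v \<in> V \<inter> L\<close> by (metis IntD1)
      qed
      have "h u0 = 1" using u0(3) y0(3) a c0 by (auto simp: h_def x0_def curve_def)
      then show "T \<noteq> {}" using u0 d by (auto simp: T_def intro!: exI[of _ u0])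
    qed (use L in auto)
    then show False using L(2) by simp
  qed
qed

text \<open>The surface contains an isotopic copy of the knot, so \<open>defect\<close> is pulled
  back along \<open>\<Psi>'\<close> and studied on the preimage \<open>M\<close>. Genus 0 means that
  the first homology of \<open>M\<close> vanishes, which forces zero gain along every loop in
  \<open>M\<close>.\<close>

lemma good_genus_tknot_pos:
  assumes "good_genus tknot g"
  shows "1 \<le> g"
proof (rule ccontr)
  assume "\<not> 1 \<le> g"
  then have "g = 0" by simp
  then obtain f' S where iso: "(tknot, f') \<in> knot_isotopy" and S: "good_surface S f'"
    and H: "surface_has_genus (cover_preimage S) 0"
    using assms unfolding good_genus_def by blast
  define M where "M = cover_preimage S"
  have "homology_group 1 (top_of_set M) \<cong> free_Abelian_group ({} :: nat set)"
    using H by (simp add: surface_has_genus_def M_def)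
  moreover have "trivial_group (free_Abelian_group ({} :: nat set))"
    by (auto simp: trivial_group_def)
  ultimately have triv: "trivial_group (homology_group 1 (top_of_set M))"
    using isomorphic_group_triviality by (metis group_free_Abelian_group group_relative_homology_group)
  have M: "M \<subseteq> sphere 0 1" "smooth_submanifold 2 M"
    using S by (auto simp: M_def cover_preimage_def good_surface_def closed_surface_def)
  have "ambient_isotopic (knot_image tknot) (knot_image f')" using iso by (simp add: knot_isotopy_def)
  then obtain F where F: "diffeo_RP3 F" and FK: "F ` knot_image tknot = knot_image f'"
    using ambient_isotopicD by blast
  obtain \<Psi> \<Psi>' where hom: "homeomorphism (sphere 0 1) (sphere 0 1) \<Psi> \<Psi>'"
    and l: "\<And>x. x \<in> sphere 0 1 \<Longrightarrow> antipodal_pair (\<Psi> x) = F (antipodal_pair x)"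
    and sm: "\<And>p. p \<in> sphere 0 1 \<Longrightarrow> \<exists>U g. open U \<and> p \<in> U \<and> smooth_on U g \<and> (\<forall>x\<in>sphere 0 1 \<inter> U. g x = \<Psi> x)"
      "\<And>p. p \<in> sphere 0 1 \<Longrightarrow> \<exists>U g. open U \<and> p \<in> U \<and> smooth_on U g \<and> (\<forall>x\<in>sphere 0 1 \<inter> U. g x = \<Psi>' x)"
    by (rule lift_diffeo_RP3[OF F]) blast
  have c\<Psi>: "continuous_on (sphere 0 1) \<Psi>" "continuous_on (sphere 0 1) \<Psi>'"
    using homeomorphism_cont1[OF hom] homeomorphism_cont2[OF hom] by auto
  have inv: "\<Psi>' (\<Psi> x) = x" "\<Psi> (\<Psi>' x) = x" "\<Psi> x \<in> sphere 0 1" "\<Psi>' x \<in> sphere 0 1" if "x \<in> sphere 0 1" for x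
    using homeomorphism_apply1[OF hom that] homeomorphism_apply2[OF hom that]
      homeomorphism_image1[OF hom] homeomorphism_image2[OF hom] that by blast+
  have KM: "\<Psi> x \<in> M" if x: "x \<in> sphere 0 1" "antipodal_pair x = tknot c" "cmod c = 1" for x c
  proof -
    have "F (tknot c) \<in> knot_image f'" unfolding FK[symmetric] using x by auto
    then have "F (tknot c) \<in> S" using S by (auto simp: good_surface_def)
    then show ?thesis using l[OF x(1)] x inv(3) by (simp add: M_def cover_preimage_def)
  qed
  have KM1: "\<Psi> (curve c) \<in> M" if "cmod c = 1" for c
    using KM[of "curve c" c] that by (simp add: tknot_def)
  \<comment> \<open>\<open>M\<close> is a full preimage under the covering, so it contains both
    lifts of the knot; the antipodal one is the loop along which the gain is measured.\<close>
  have KM2: "\<Psi> (- curve c) \<in> M" if "cmod c = 1" for c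
    using KM[of "- curve c" c] that by (simp add: tknot_def)
  define Z where "Z = {y \<in> sphere 0 1. defect (\<Psi>' y) = 0}"
  define u where "u y = (sgn (defect (\<Psi>' y)))\<^sup>2" for y
  have cd: "continuous_on (sphere 0 1) (\<lambda>y. defect (\<Psi>' y))" by (intro continuous_intros c\<Psi>)
  have "closedin (top_of_set (sphere 0 1)) Z"
    unfolding Z_def using continuous_closedin_preimage_constant[OF cd, of 0] by simp
  then have clZ: "closed Z" by (rule closedin_closed_trans) (rule closed_sphere)
  have MZ: "M - Z = {y \<in> M. defect (\<Psi>' y) \<noteq> 0}" using M(1) by (auto simp: Z_def)
  have cu: "continuous_on (M - Z) u"
    unfolding u_def MZ by (intro continuous_intros continuous_on_subset[OF cd] continuous_on_sgn) (use M(1) in auto)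
  have ZK: "\<exists>c. cmod c = 1 \<and> y = \<Psi> (curve c)" if "y \<in> M \<inter> Z" for y
  proof -
    have y: "y \<in> sphere 0 1" "defect (\<Psi>' y) = 0" using that by (auto simp: Z_def)
    then obtain c where "cmod c = 1" "\<Psi>' y = curve c" using defect_eq_0_iff inv(4) by blast
    then show ?thesis using inv(2)[OF y(1)] by metis
  qed
  have "\<exists>\<sigma>. cmod \<sigma> = 1 \<and> (\<forall>e>0. \<exists>d>0. \<forall>x\<in>M - Z. dist x y < d \<longrightarrow> dist (u x) \<sigma> < e)"
    if y: "y \<in> M \<inter> Z" for y
  proof -
    obtain c where c: "cmod c = 1" "y = \<Psi> (curve c)" using ZK[OF y] by blast
    obtain \<sigma> where \<sigma>: "cmod \<sigma> = 1" "\<And>e. e > 0 \<Longrightarrow> \<forall>\<^sub>F x in at y within M.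
        defect (\<Psi>' x) \<noteq> 0 \<longrightarrow> dist ((sgn (defect (\<Psi>' x)))\<^sup>2) \<sigma> < e"
      using squared_direction_limit(1)[OF hom sm M KM1 c(1)] unfolding c(2) by blast
    have "\<exists>d>0. \<forall>x\<in>M - Z. dist x y < d \<longrightarrow> dist (u x) \<sigma> < e" if e: "e > 0" for e
    proof -
      obtain d where "d > 0" "\<forall>x\<in>M. x \<noteq> y \<and> dist x y < d \<longrightarrow>
          defect (\<Psi>' x) \<noteq> 0 \<longrightarrow> dist ((sgn (defect (\<Psi>' x)))\<^sup>2) \<sigma> < e"
        using \<sigma>(2)[OF e] unfolding eventually_at by blast
      then show ?thesis using y unfolding MZ u_def by (intro exI[of _ d]) (auto simp: Z_def)
    qed
    then show ?thesis using \<sigma>(1) by blast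
  qed
  then obtain \<sigma> where \<sigma>: "\<And>y. y \<in> M \<inter> Z \<Longrightarrow> cmod (\<sigma> y) = 1"
    "\<And>y e. y \<in> M \<inter> Z \<Longrightarrow> e > 0 \<Longrightarrow> \<exists>d>0. \<forall>x\<in>M - Z. dist x y < d \<longrightarrow> dist (u x) (\<sigma> y) < e"
    by metis
  define G where "G y = (if y \<in> Z then \<sigma> y else u y)" for y
  have cG: "continuous_on M G"
    unfolding G_def
  proof (rule extend_by_limits[OF cu clZ \<sigma>(2)])
    fix y and d :: real assume y: "y \<in> M \<inter> Z" and d: "d > 0"
    obtain c where c: "cmod c = 1" "y = \<Psi> (curve c)" using ZK[OF y] by blast
    show "\<exists>x\<in>M - Z. dist x y < d"
      using squared_direction_limit(2)[OF hom sm M KM1 c(1) d] unfolding c(2) MZ by blast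
  qed
  have G0: "G y \<noteq> 0" if "y \<in> M" for y
  proof (cases "y \<in> Z")
    case True
    then show ?thesis using \<sigma>(1)[of y] that by (auto simp: G_def)
  next
    case False
    then have "defect (\<Psi>' y) \<noteq> 0" using that MZ by blast
    then show ?thesis using False by (simp add: G_def u_def sgn_zero_iff)
  qed
  obtain L where L: "continuous_on {0..2 * pi} L"
    "\<And>t. t \<in> {0..2 * pi} \<Longrightarrow> exp (L t) = defect (- curve (cis t)) ^ 2"
  proof (rule logarithm_on_convex[of "{0..2 * pi}" "\<lambda>t. defect (- curve (cis t)) ^ 2"])
    show "continuous_on {0..2 * pi} (\<lambda>t. (defect (- curve (cis t)))\<^sup>2)" by (intro continuous_intros)
  qed (use defect_minus_curve_ne_0 in auto)
  define \<gamma> where "\<gamma> t = \<Psi> (- curve (cis (2 * pi * t)))" for t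
  \<comment> \<open>The constant modulus of \<open>defect\<close> on the antipode of the curve.
    Along the loop, normalizing the squared defect is division by \<open>r\<^sup>2\<close>, which
    shifts the logarithm by a constant and keeps its gain.\<close>
  define r where "r = 2 * a ^ (2 * n)"
  have r: "r > 0" using a by (simp add: r_def)
  have "(\<lambda>t. L (2 * pi * t) - of_real (ln (r\<^sup>2))) 1 = (\<lambda>t. L (2 * pi * t) - of_real (ln (r\<^sup>2))) (0::real)"
  proof (rule log_increment_loop_trivial_homology[OF triv cG G0])
    show "continuous_on {0..1} \<gamma>"
      unfolding \<gamma>_def by (rule continuous_on_compose2[OF c\<Psi>(1)]) (auto intro!: continuous_intros)
    show "\<gamma> ` {0..1} \<subseteq> M" using KM2 by (auto simp: \<gamma>_def)
    show "\<gamma> 0 = \<gamma> 1" by (simp add: \<gamma>_def)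
    show "continuous_on {0..1} (\<lambda>t. L (2 * pi * t) - of_real (ln (r\<^sup>2)))"
      by (intro continuous_intros continuous_on_compose2[OF L(1)]) (auto simp: mult_le_cancel_left1)
    fix t :: real assume t: "t \<in> {0..1}"
    let ?c = "cis (2 * pi * t)"
    have \<Psi>'\<gamma>: "\<Psi>' (\<gamma> t) = - curve ?c" using inv(1)[of "- curve ?c"] by (simp add: \<gamma>_def)
    have "\<gamma> t \<notin> Z" using \<Psi>'\<gamma> defect_minus_curve_ne_0[of ?c] by (simp add: Z_def)
    then have "G (\<gamma> t) = (sgn (defect (- curve ?c)))\<^sup>2" by (simp add: G_def u_def \<Psi>'\<gamma>)
    also have "cmod (defect (- curve ?c)) = r"
      using a by (simp add: defect_minus_curve norm_mult norm_power r_def)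
    then have "(sgn (defect (- curve ?c)))\<^sup>2 = (defect (- curve ?c))\<^sup>2 / of_real (r\<^sup>2)"
      by (simp add: sgn_eq power_divide)
    also have "\<dots> = exp (L (2 * pi * t)) / exp (of_real (ln (r\<^sup>2)))"
      using L(2)[of "2 * pi * t"] t r by (simp add: exp_of_real mult_le_cancel_left1)
    finally show "exp (L (2 * pi * t) - of_real (ln (r\<^sup>2))) = G (\<gamma> t)" by (simp add: exp_diff)
  qed auto
  then have "L (2 * pi) - L 0 = 0" by simp
  moreover have "L (2 * pi) - L 0 = 2 * of_nat (2 * n * 2) * of_real pi * \<i>"
    by (rule log_defect_minus_curve[OF L])
  ultimately show False using n by simp
qed

lemma tknot_isotopic_refl: "(tknot, tknot) \<in> knot_isotopy"
  using knot_tknot ambient_isotopic_refl[OF knot_image_subset[OF knot_tknot]] by (simp add: knot_isotopy_def)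

lemma knot_has_genus_tknot: "knot_has_genus tknot 1"
  unfolding knot_has_genus_def
proof (intro conjI allI impI)
  show "good_genus tknot 1"
    unfolding good_genus_def using tknot_isotopic_refl good_surface_torus by blast
  show "1 \<le> g" if "good_genus tknot g" for g using good_genus_tknot_pos[OF that] .
qed

end

theorem mainTheorem10:
  shows "infinite ({f. knot f \<and> class_0 f \<and> \<not> affine_knot f \<and> knot_has_genus f 1} // knot_isotopy)"
proof -
  have "\<exists>a. torus_knot (Suc n) a" for n
    by (rule torus_knot_exists[of "Suc n"]) auto
  then obtain a where a: "\<And>n. torus_knot (Suc n) (a n)" by metis
  let ?k = "\<lambda>n. torus_knot.tknot (Suc n) (a n)"
  have refl: "(?k n, ?k n) \<in> knot_isotopy" for n using torus_knot.tknot_isotopic_refl[OF a] .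
  \<comment> \<open>By reflexivity the class of each knot contains the knot itself, so equal classes
    make the two representatives isotopic.\<close>
  have "inj (\<lambda>n. knot_isotopy `` {?k n})"
  proof (rule injI)
    fix m n assume "knot_isotopy `` {?k m} = knot_isotopy `` {?k n}"
    then have "(?k m, ?k n) \<in> knot_isotopy" using refl[of n] by blast
    then have "ambient_isotopic (knot_image (?k m)) (knot_image (?k n))" by (simp add: knot_isotopy_def)
    then show "m = n" using isotopic_torus_knots_eq[OF a a] by blast
  qed
  then have "infinite (range (\<lambda>n. knot_isotopy `` {?k n}))" by (rule range_inj_infinite)
  moreover have "range (\<lambda>n. knot_isotopy `` {?k n}) \<subseteq>
      {f. knot f \<and> class_0 f \<and> \<not> affine_knot f \<and> knot_has_genus f 1} // knot_isotopy"
    using torus_knot.knot_tknot[OF a] torus_knot.class_0_tknot[OF a] torus_knot.not_affine_tknot[OF a]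
      torus_knot.knot_has_genus_tknot[OF a] by (auto intro!: quotientI)
  ultimately show ?thesis using finite_subset by blast
qed

end
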